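(* Let $\Omega\subset\mathbb{R}^d$, $d\ge 2$, be a domain with $C^2$ boundary $\Gamma$ and with $N$ cylindrical outlets to infinity (as described in the context), and let $k$ be a real scalar. Then the following two conditions are equivalent: (i) there exists a constant $\epsilon>0$ such that $$\int_\Omega \big(|\nabla u|^2-k^2|u|^2\big)\,dx\ \ge\ \epsilon\,\|u\|^2_{H^1(\Omega)}\qquad\text{for all } u\in H^1(\Omega,\Gamma);$$ (ii) there exist constants $\mu>0$ and $\delta>0$ such that $$\int_\Omega \big(|\nabla u|^2-k^2|u|^2\big)\,dx+\mu\int_{\Gamma}|u|^2\,dS\ \ge\ \delta\,\|u\|^2_{H^1(\Omega)}\qquad\text{for all } u\in H^1(\Omega).$$
   Context: $\Omega\subset\mathbb{R}^d$ ($d\ge2$) is a domain with $C^2$ boundary $\Gamma=\partial\Omega$ and with $N$ cylindrical outlets to infinity: for sufficiently large $|x|$ the domain $\Omega$ coincides with the union of $N$ disjoint cylinders $\mathcal{C}^{(j)}$, $j=1,\dots,N$, each of which is described in certain Cartesian coordinates $x^{(j)}=(y^{(j)},z^{(j)})$ as $\mathcal{C}^{(j)}=\{x^{(j)}: y^{(j)}\in\omega^{(j)},\ z^{(j)}\in\mathbb{R}\}$, where the cross-sections $\omega^{(j)}$ are bounded domains in $\mathbb{R}^{d-1}$ with $C^2$ boundaries. $H^1(\Omega)$ is the Sobolev space with norm $\|u\|_{H^1(\Omega)}=\big(\int_\Omega(|\nabla u|^2+|u|^2)\,dx\big)^{1/2}$, and $H^1(\Omega,\Gamma)$ is the subspace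 of functions in $H^1(\Omega)$ vanishing on $\Gamma$ (in the sense of traces). In the integral over $\Gamma$, $u$ denotes the trace of $u$ and $dS$ is surface measure. *)

theory Defs
  imports "HOL-Analysis.Analysis"
begin

section \<open>Continuously differentiable functions and domains with smooth boundary\<close>

text \<open>
  \<open>Ck k f\<close>: \<open>f\<close> is of class \<open>C\<^sup>k\<close> on the whole space.  The partial derivatives
  are the values of the Frechet derivative on the standard basis.
\<close>

primrec Ck :: "nat \<Rightarrow> ('a::euclidean_space \<Rightarrow> 'b::real_normed_vector) \<Rightarrow> bool" where
  "Ck 0 f \<longleftrightarrow> continuous_on UNIV f"
| "Ck (Suc k) f \<longleftrightarrow> f differentiable_on UNIV \<and>
     (\<forall>b\<in>Basis. Ck k (\<lambda>x. frechet_derivative f (at x) b))"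

definition supported_in :: "'a::topological_space set \<Rightarrow> ('a \<Rightarrow> 'b::zero) \<Rightarrow> bool" where
  "supported_in K f \<longleftrightarrow> (\<forall>x. x \<notin> K \<longrightarrow> f x = 0)"

definition domain :: "'a::topological_space set \<Rightarrow> bool" where
  "domain \<Omega> \<longleftrightarrow> open \<Omega> \<and> connected \<Omega> \<and> \<Omega> \<noteq> {}"

text \<open>
  Near each boundary point \<open>\<Omega>\<close> is the strict epigraph of a \<open>C\<^sup>2\<close> function over a
  hyperplane.  In Cartesian coordinates whose last axis is the unit vector \<open>\<nu>\<close>, the last
  coordinate of \<open>x\<close> is \<open>x \<bullet> \<nu>\<close> and the remaining ones are those of
  \<open>x - (x \<bullet> \<nu>) *\<^sub>R \<nu>\<close>.  Only the values of \<open>g\<close> on the hyperplane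
  orthogonal to \<open>\<nu>\<close> matter; a \<open>C\<^sup>2\<close> function on the hyperplane extends to the whole
  space by composition with the orthogonal projection.
\<close>

definition C2_boundary :: "'a::euclidean_space set \<Rightarrow> bool" where
  "C2_boundary \<Omega> \<longleftrightarrow>
     (\<forall>p\<in>frontier \<Omega>. \<exists>r>0. \<exists>\<nu> g. norm \<nu> = 1 \<and> Ck 2 (g :: 'a \<Rightarrow> real) \<and>
        (\<forall>x\<in>ball p r. x \<in> \<Omega> \<longleftrightarrow> g (x - (x \<bullet> \<nu>) *\<^sub>R \<nu>) < x \<bullet> \<nu>))"


section \<open>Cylindrical outlets to infinity\<close>

text \<open>
  Cartesian coordinates \<open>(y, z)\<close> on Euclidean space are given by the inverse of an isometry
  \<open>\<Phi>\<close> (the metric of the product type is the Euclidean one).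
\<close>

definition cartesian_coords :: "('b::metric_space \<Rightarrow> 'a::metric_space) \<Rightarrow> bool" where
  "cartesian_coords \<Phi> \<longleftrightarrow> bij \<Phi> \<and> (\<forall>p q. dist (\<Phi> p) (\<Phi> q) = dist p q)"

definition cylinder :: "('b \<times> real \<Rightarrow> 'a) \<Rightarrow> 'b set \<Rightarrow> 'a set" where
  "cylinder \<Phi> \<omega> = {\<Phi> (y, z) |y z. y \<in> \<omega> \<and> z \<in> (UNIV :: real set)}"

definition cylindrical_outlets ::
    "'a::euclidean_space set \<Rightarrow> nat \<Rightarrow> (nat \<Rightarrow> 'b::euclidean_space set)
       \<Rightarrow> (nat \<Rightarrow> 'b \<times> real \<Rightarrow> 'a) \<Rightarrow> bool" where
  "cylindrical_outlets \<Omega> N \<omega> \<Phi> \<longleftrightarrow>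
     (\<forall>j\<in>{1..N}. cartesian_coords (\<Phi> j) \<and>
        domain (\<omega> j) \<and> bounded (\<omega> j) \<and> C2_boundary (\<omega> j)) \<and>
     disjoint_family_on (\<lambda>j. cylinder (\<Phi> j) (\<omega> j)) {1..N} \<and>
     (\<exists>R. \<forall>x. norm x > R \<longrightarrow> (x \<in> \<Omega> \<longleftrightarrow> x \<in> (\<Union>j\<in>{1..N}. cylinder (\<Phi> j) (\<omega> j))))"


section \<open>Surface measure\<close>

text \<open>
  Normalised \<open>m\<close>-dimensional Hausdorff (outer) measure, for \<open>m \<ge> 1\<close>.  Covering sets
  are required to be bounded because \<^const>\<open>diameter\<close> is meaningless for unbounded sets.
\<close>

definition hausdorff_outer :: "nat \<Rightarrow> 'a::euclidean_space set \<Rightarrow> ennreal" where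
  "hausdorff_outer m A =
     (SUP \<delta>\<in>{0<..}. INF U\<in>{U :: nat \<Rightarrow> 'a set. A \<subseteq> (\<Union>i. U i) \<and>
                                   (\<forall>i. bounded (U i) \<and> diameter (U i) \<le> \<delta>)}.
        (\<Sum>i. ennreal (unit_ball_vol (real m) * (diameter (U i) / 2) ^ m)))"

definition hausdorff_measure :: "nat \<Rightarrow> 'a::euclidean_space measure" where
  "hausdorff_measure m = measure_of UNIV (sets borel) (hausdorff_outer m)"

definition surface_measure :: "'a::euclidean_space set \<Rightarrow> 'a measure" where
  "surface_measure \<Omega> = restrict_space (hausdorff_measure (DIM('a) - 1)) (frontier \<Omega>)"


section \<open>The Sobolev space of order one\<close>

text \<open>
  Functions on \<open>\<Omega>\<close> are complex valued and represented by functions on the whole space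
  whose values outside \<open>\<Omega>\<close> are irrelevant.
\<close>

definition square_integrable ::
    "'a::euclidean_space set \<Rightarrow> ('a \<Rightarrow> 'b::real_normed_vector) \<Rightarrow> bool" where
  "square_integrable \<Omega> f \<longleftrightarrow>
     f \<in> borel_measurable (lebesgue_on \<Omega>) \<and> integrable (lebesgue_on \<Omega>) (\<lambda>x. (norm (f x))\<^sup>2)"

definition test_function :: "(real^'n) set \<Rightarrow> (real^'n \<Rightarrow> real) \<Rightarrow> bool" where
  "test_function \<Omega> \<phi> \<longleftrightarrow>
     (\<forall>k. Ck k \<phi>) \<and> (\<exists>K. compact K \<and> K \<subseteq> \<Omega> \<and> supported_in K \<phi>)"

definition has_weak_gradient ::
    "(real^'n) set \<Rightarrow> (real^'n \<Rightarrow> complex) \<Rightarrow> (real^'n \<Rightarrow> complex^'n) \<Rightarrow> bool" where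
  "has_weak_gradient \<Omega> u G \<longleftrightarrow>
     square_integrable \<Omega> u \<and> square_integrable \<Omega> G \<and>
     (\<forall>\<phi> i. test_function \<Omega> \<phi> \<longrightarrow>
        integral\<^sup>L (lebesgue_on \<Omega>) (\<lambda>x. frechet_derivative \<phi> (at x) (axis i 1) *\<^sub>R u x) =
        - integral\<^sup>L (lebesgue_on \<Omega>) (\<lambda>x. \<phi> x *\<^sub>R (G x $ i)))"

definition H1 :: "(real^'n) set \<Rightarrow> (real^'n \<Rightarrow> complex) set" where
  "H1 \<Omega> = {u. \<exists>G. has_weak_gradient \<Omega> u G}"

text \<open>The weak gradient of \<open>u \<in> H1 \<Omega>\<close>, unique up to null sets.\<close>

definition weak_grad :: "(real^'n) set \<Rightarrow> (real^'n \<Rightarrow> complex) \<Rightarrow> real^'n \<Rightarrow> complex^'n" where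
  "weak_grad \<Omega> u = (SOME G. has_weak_gradient \<Omega> u G)"

definition H1_norm :: "(real^'n) set \<Rightarrow> (real^'n \<Rightarrow> complex) \<Rightarrow> real" where
  "H1_norm \<Omega> u =
     sqrt (integral\<^sup>L (lebesgue_on \<Omega>) (\<lambda>x. (norm (weak_grad \<Omega> u x))\<^sup>2 + (norm (u x))\<^sup>2))"


section \<open>Traces\<close>

text \<open>
  The trace is the continuous extension, from \<open>H1 \<Omega>\<close> to the \<open>L\<^sup>2\<close> space of the surface
  measure, of the map restricting compactly supported \<open>C\<^sup>1\<close> functions on the whole space to
  the boundary.  \<open>has_trace \<Omega> u v\<close> states that \<open>v\<close> is (a representative of) the trace of
  \<open>u\<close>.  For the domains considered here the trace theorem gives every \<open>u \<in> H1 \<Omega>\<close> a trace,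
  unique up to null sets.  The distance in \<open>L\<^sup>2\<close> is a Lebesgue integral with values in
  \<^typ>\<open>ennreal\<close>, so its convergence to zero includes square integrability.
\<close>

definition has_trace ::
    "(real^'n) set \<Rightarrow> (real^'n \<Rightarrow> complex) \<Rightarrow> (real^'n \<Rightarrow> complex) \<Rightarrow> bool" where
  "has_trace \<Omega> u v \<longleftrightarrow>
     u \<in> H1 \<Omega> \<and> v \<in> borel_measurable (surface_measure \<Omega>) \<and>
     (\<exists>\<phi> :: nat \<Rightarrow> real^'n \<Rightarrow> complex.
        (\<forall>n. Ck 1 (\<phi> n) \<and> (\<exists>K. compact K \<and> supported_in K (\<phi> n))) \<and>
        (\<lambda>n. H1_norm \<Omega> (\<lambda>x. \<phi> n x - u x)) \<longlonglongrightarrow> 0 \<and>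
        (\<lambda>n. \<integral>\<^sup>+x. ennreal ((norm (\<phi> n x - v x))\<^sup>2) \<partial>surface_measure \<Omega>) \<longlonglongrightarrow> 0)"

definition H1_zero :: "(real^'n) set \<Rightarrow> (real^'n \<Rightarrow> complex) set" where
  "H1_zero \<Omega> = {u \<in> H1 \<Omega>. has_trace \<Omega> u (\<lambda>x. 0)}"

definition energy :: "real \<Rightarrow> (real^'n) set \<Rightarrow> (real^'n \<Rightarrow> complex) \<Rightarrow> real" where
  "energy k \<Omega> u =
     integral\<^sup>L (lebesgue_on \<Omega>) (\<lambda>x. (norm (weak_grad \<Omega> u x))\<^sup>2 - k\<^sup>2 * (norm (u x))\<^sup>2)"

end

theory Submission
  imports Defs
begin

text \<open>
  (ii) gives (i) because the boundary term of a function with zero trace vanishes.  For the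
  converse, the plan is to replace a function \<open>u\<close> in \<open>H1 \<Omega>\<close> by \<open>\<zeta> u\<close> in \<open>H1_zero \<Omega>\<close>, with a cutoff
  \<open>\<zeta>\<close>, and to insert \<open>\<zeta> u\<close> in (i).  The difficulty is that the square integral of the trace does not control the
  distance from \<open>u\<close> to \<open>H1_zero \<Omega>\<close>, so the term with \<open>\<nabla>\<zeta>\<close> cannot be charged to the boundary
  alone.  It is charged to the energy, with a small factor, by means of a Hardy inequality with
  a boundary term.  Let \<open>d\<close> be the distance to the complement of \<open>\<Omega>\<close>.  There is \<open>C\<close> such that
  for all \<open>s > 0\<close>

  \<open>\<integral>\<^sub>\<Omega> |u|\<^sup>2 / (d + s)\<^sup>2 \<le> C (\<integral>\<^sub>\<Omega> |\<nabla>u|\<^sup>2 + \<integral>\<^sub>\<Omega> |u|\<^sup>2 + (1/s) \<integral>\<^sub>\<Gamma> |u|\<^sup>2)\<close>.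

  This is \<open>hardy_domain\<close>.  Given small \<open>a\<close> and \<open>\<eta>\<close>, there are \<open>s\<close>, exponentially small in \<open>1/a\<close>,
  and a cutoff \<open>\<zeta>\<close> that grows logarithmically from 0 on \<open>\<Gamma>\<close> to 1 at depth \<open>\<eta>\<close>, so that
  \<open>|\<nabla>\<zeta>| \<le> a / (d + s)\<close> (\<open>log_cutoff\<close>).  Hardy's inequality then bounds the
  increase of the Dirichlet integral from \<open>u\<close> to \<open>\<zeta> u\<close> by a small multiple of the squared norm of
  \<open>u\<close> plus a large multiple of \<open>\<integral>\<^sub>\<Gamma> |u|\<^sup>2\<close>.  The mass that \<open>u\<close> has at depth less than \<open>\<eta>\<close> is bounded
  in the same way, by Hardy's inequality with \<open>s = \<eta>\<close>.  So (i) for \<open>\<zeta> u\<close> yields (ii) for \<open>u\<close> with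
  \<open>\<delta> = \<epsilon>/2\<close> (\<open>coercive_smooth\<close>).

  Hardy's inequality is an integration of the derivative of \<open>- |f(t)|\<^sup>2 / (t + s)\<close> along segments that
  enter \<open>\<Omega>\<close> from \<open>\<Gamma>\<close> (\<open>hardy_interval\<close>), followed by Fubini's theorem in coordinates adapted to a
  boundary chart (\<open>hardy_patch\<close>).  Finitely many charts suffice although \<open>\<Gamma>\<close> need not be compact,
  because a chart of the boundary of a cross-section, multiplied by the far part of the axis, is a
  chart of \<open>\<Omega>\<close> (\<open>outlet_collar_patch\<close>, \<open>finite_collar_cover\<close>).  The surface measure enters through
  two facts: it dominates a multiple of the Lebesgue measure in the base of a chart
  (\<open>lborel_le_hausdorff_outer\<close>), and it is finite on bounded parts of \<open>\<Gamma>\<close>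
  (\<open>surface_locally_finite\<close>).

  All this concerns \<open>C\<^sup>1\<close> functions with compact support.  A pair of a function and its trace is by
  definition a limit of such functions, and all terms of (ii) converge along the defining sequence
  (\<open>trace_limit\<close>).  There the chosen weak gradients have to be compared with classical ones,
  which rests on the uniqueness of weak gradients (\<open>weak_gradient_unique\<close>).
\<close>

section \<open>Continuously differentiable functions, bumps and mollification\<close>

lemma has_derivative_frechet:
  "f differentiable (at x) \<Longrightarrow> (f has_derivative frechet_derivative f (at x)) (at x)"
  by (simp add: frechet_derivative_works)

lemma frechet_derivative_eqI:
  "(f has_derivative f') (at x) \<Longrightarrow> frechet_derivative f (at x) = f'"
  by (metis frechet_derivative_at)

lemma Ck_Suc_imp_Ck: "Ck (Suc k) f \<Longrightarrow> Ck k f"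
proof (induction k arbitrary: f)
  case 0
  then show ?case by (simp add: differentiable_imp_continuous_on)
next
  case (Suc k)
  then have "f differentiable_on UNIV" "\<forall>b\<in>Basis. Ck (Suc k) (\<lambda>x. frechet_derivative f (at x) b)"
    by simp_all
  then show ?case using Suc.IH by auto
qed

lemma Ck_differentiable: "Ck (Suc k) f \<Longrightarrow> f differentiable (at x)"
  by (simp add: differentiable_on_def)

lemma Ck_has_derivative: "Ck (Suc k) f \<Longrightarrow> (f has_derivative frechet_derivative f (at x)) (at x)"
  by (rule has_derivative_frechet[OF Ck_differentiable])

lemma Ck_continuous: "Ck k f \<Longrightarrow> continuous_on UNIV f"
  by (cases k) (auto intro: differentiable_imp_continuous_on)

lemma Ck_SucI:
  assumes "\<And>x. (f has_derivative f' x) (at x)" "\<And>b. b \<in> Basis \<Longrightarrow> Ck k (\<lambda>x. f' x b)"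
  shows "Ck (Suc k) f"
proof -
  have "frechet_derivative f (at x) = f' x" for x by (rule frechet_derivative_eqI[OF assms(1)])
  moreover have "f differentiable_on UNIV"
    using assms(1) by (auto simp: differentiable_on_def intro: differentiableI)
  ultimately show ?thesis using assms(2) by simp
qed

lemma Ck_const [simp]: "Ck k (\<lambda>x. c)"
proof (induction k arbitrary: c)
  case (Suc k)
  show ?case by (rule Ck_SucI[where f' = "\<lambda>_ _. 0"]) (use Suc in \<open>auto intro: derivative_eq_intros\<close>)
qed simp

lemma Ck_add: "Ck k f \<Longrightarrow> Ck k g \<Longrightarrow> Ck k (\<lambda>x. f x + g x)"
proof (induction k arbitrary: f g)
  case 0
  then show ?case by (auto intro: continuous_on_add)
next
  case (Suc k)
  show ?case
  proof (rule Ck_SucI)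
    show "((\<lambda>x. f x + g x) has_derivative
        (\<lambda>h. frechet_derivative f (at x) h + frechet_derivative g (at x) h)) (at x)" for x
      by (intro has_derivative_add Ck_has_derivative[OF Suc.prems(1)] Ck_has_derivative[OF Suc.prems(2)])
  qed (use Suc in \<open>auto intro: Suc.IH\<close>)
qed

lemma Ck_scaleR:
  fixes f :: "'a::euclidean_space \<Rightarrow> real" and g :: "'a \<Rightarrow> 'b::real_normed_vector"
  shows "Ck k f \<Longrightarrow> Ck k g \<Longrightarrow> Ck k (\<lambda>x. f x *\<^sub>R g x)"
proof (induction k arbitrary: f g)
  case 0
  then show ?case by (auto intro: continuous_on_scaleR)
next
  case (Suc k)
  show ?case
  proof (rule Ck_SucI)
    show "((\<lambda>x. f x *\<^sub>R g x) has_derivative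
        (\<lambda>h. f x *\<^sub>R frechet_derivative g (at x) h + frechet_derivative f (at x) h *\<^sub>R g x)) (at x)" for x
      by (intro has_derivative_scaleR Ck_has_derivative[OF Suc.prems(1)] Ck_has_derivative[OF Suc.prems(2)])
    show "Ck k (\<lambda>x. f x *\<^sub>R frechet_derivative g (at x) b + frechet_derivative f (at x) b *\<^sub>R g x)"
      if "b \<in> Basis" for b
      using Suc.prems(1,2)[THEN Ck_Suc_imp_Ck] Suc.prems that by (intro Ck_add Suc.IH) simp_all
  qed
qed

lemma Ck_mult:
  fixes f g :: "'a::euclidean_space \<Rightarrow> real"
  shows "Ck k f \<Longrightarrow> Ck k g \<Longrightarrow> Ck k (\<lambda>x. f x * g x)"
  using Ck_scaleR[of k f g] by simp

lemma Ck_diff: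
  fixes f g :: "'a::euclidean_space \<Rightarrow> 'b::real_normed_vector"
  assumes "Ck k f" "Ck k g" shows "Ck k (\<lambda>x. f x - g x)"
  using Ck_add[OF assms(1) Ck_scaleR[OF Ck_const[of k "-1"] assms(2)]] by simp

lemma Ck_prod:
  fixes f :: "'i \<Rightarrow> 'a::euclidean_space \<Rightarrow> real"
  shows "finite I \<Longrightarrow> (\<And>i. i \<in> I \<Longrightarrow> Ck k (f i)) \<Longrightarrow> Ck k (\<lambda>x. \<Prod>i\<in>I. f i x)"
  by (induction I rule: finite_induct) (auto intro: Ck_mult)


text \<open>
  The functions \<open>t\<^sup>-\<^sup>n exp (- 1/t)\<close>, extended by 0 to \<open>t \<le> 0\<close>.  The derivative of one of them is a
  linear combination of two others, so a single induction for all \<open>n\<close> shows that they are smooth.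
\<close>

definition flat :: "nat \<Rightarrow> real \<Rightarrow> real" where
  "flat n t = (if t > 0 then (1 / t) ^ n * exp (- (1 / t)) else 0)"

lemma flat_nonneg: "flat n t \<ge> 0"
  by (simp add: flat_def)

lemma flat_tendsto_0: "(flat n \<longlongrightarrow> 0) (at 0)"
proof -
  have "((\<lambda>t. t ^ n / exp t) \<longlongrightarrow> 0) (at_top :: real filter)"
    by (rule tendsto_power_div_exp_0)
  then have "((\<lambda>t. (1 / t) ^ n * exp (- (1 / t))) \<longlongrightarrow> 0) (at_right (0::real))"
    using filterlim_compose[OF _ filterlim_inverse_at_top_right, of "\<lambda>t. t ^ n / exp t" "nhds 0"]
    by (simp add: exp_minus field_simps)
  then have "(flat n \<longlongrightarrow> 0) (at_right 0)"
    by (rule Lim_transform_eventually)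
       (auto simp: flat_def eventually_at_filter intro!: always_eventually)
  moreover have "(flat n \<longlongrightarrow> 0) (at_left 0)"
    by (rule Lim_transform_eventually[OF tendsto_const])
       (auto simp: flat_def eventually_at_filter intro!: always_eventually)
  ultimately show ?thesis by (simp add: filterlim_split_at)
qed

lemma DERIV_flat: "(flat n has_real_derivative (flat (n + 2) t - real n * flat (n + 1) t)) (at t)"
proof -
  consider "t > 0" | "t < 0" | "t = 0" by linarith
  then show ?thesis
  proof cases
    case 1
    have "((\<lambda>t. (1 / t) ^ n * exp (- (1 / t))) has_real_derivative (flat (n + 2) t - real n * flat (n + 1) t)) (at t)"
    proof -
      have d: "((\<lambda>t. 1 / t) has_real_derivative - ((1 / t)^2)) (at t)"
        using 1 by (auto intro!: derivative_eq_intros simp: power2_eq_square)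
      have p: "((\<lambda>t. (1 / t) ^ n) has_real_derivative - (real n * (1 / t) ^ (n + 1))) (at t)"
        using DERIV_power[OF d, of n] by (cases n) (simp_all add: power2_eq_square mult_ac)
      have e: "((\<lambda>t. exp (- (1 / t))) has_real_derivative (exp (- (1 / t)) * (1 / t)^2)) (at t)"
        using DERIV_fun_exp[OF DERIV_minus[OF d]] by simp
      show ?thesis
        using DERIV_mult[OF p e] 1 by (simp add: flat_def algebra_simps power2_eq_square)
    qed
    then show ?thesis
      by (rule has_field_derivative_transform_within_open[where S = "{0<..}"])
         (use 1 in \<open>auto simp: flat_def\<close>)
  next
    case 2
    have "((\<lambda>t. 0) has_real_derivative (flat (n + 2) t - real n * flat (n + 1) t)) (at t)"
      using 2 by (simp add: flat_def)
    then show ?thesis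
      by (rule has_field_derivative_transform_within_open[where S = "{..<0}"])
         (use 2 in \<open>auto simp: flat_def\<close>)
  next
    case 3
    \<comment> \<open>The difference quotient of \<open>flat n\<close> at 0 is \<open>flat (n + 1)\<close>.\<close>
    have "((\<lambda>h. (flat n (0 + h) - flat n 0) / h) \<longlongrightarrow> 0) (at 0)"
      by (rule Lim_transform_eventually[OF flat_tendsto_0[of "n + 1"]])
         (auto simp: flat_def eventually_at_filter intro!: always_eventually)
    then show ?thesis using 3 by (simp add: DERIV_def flat_def)
  qed
qed

lemma Ck_flat_affine:
  fixes a :: "'a::euclidean_space"
  shows "Ck k (\<lambda>x. flat n (a \<bullet> x + c))"
proof (induction k arbitrary: n)
  case 0
  have "continuous_on UNIV (flat n)"
    using DERIV_flat by (intro continuous_at_imp_continuous_on) (auto intro: DERIV_isCont)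
  then show ?case
    by (auto intro!: continuous_on_compose2[of UNIV "flat n"] continuous_intros)
next
  case (Suc k)
  define D where "D t = flat (n + 2) t - real n * flat (n + 1) t" for t
  have D: "(flat n has_derivative (\<lambda>h. h * D t)) (at t)" for t
    using DERIV_flat[of n t] by (simp add: has_field_derivative_def D_def mult.commute[of _ "_ - _"])
  show ?case
  proof (rule Ck_SucI)
    show "((\<lambda>x. flat n (a \<bullet> x + c)) has_derivative (\<lambda>h. (a \<bullet> h) * D (a \<bullet> x + c))) (at x)" for x
      by (rule has_derivative_compose[OF _ D, of "\<lambda>x. a \<bullet> x + c" "\<lambda>h. a \<bullet> h" x UNIV, simplified])
         (auto intro!: derivative_eq_intros)
    show "Ck k (\<lambda>x. (a \<bullet> b) * D (a \<bullet> x + c))" for b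
      unfolding D_def by (intro Ck_mult Ck_diff Ck_const Suc.IH)
  qed
qed

text \<open>
  As \<open>exp (- 1 / (n t))\<close> increases to 1 for \<open>t > 0\<close>, these smooth functions increase to the
  indicator of the open box when \<open>n\<close> tends to infinity.
\<close>

definition box_bump :: "nat \<Rightarrow> 'a::euclidean_space \<Rightarrow> 'a \<Rightarrow> 'a \<Rightarrow> real" where
  "box_bump n a b x = (\<Prod>i\<in>Basis. flat 0 (real n * ((x - a) \<bullet> i)) * flat 0 (real n * ((b - x) \<bullet> i)))"

lemma Ck_box_bump: "Ck k (box_bump n a b)"
proof -
  have 1: "Ck k (\<lambda>x::'a. flat 0 (real n * ((x - a) \<bullet> i)))" for i
    using Ck_flat_affine[of k 0 "real n *\<^sub>R i" "- real n * (a \<bullet> i)"]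
    by (simp add: inner_diff_left algebra_simps inner_commute)
  have 2: "Ck k (\<lambda>x::'a. flat 0 (real n * ((b - x) \<bullet> i)))" for i
    using Ck_flat_affine[of k 0 "- real n *\<^sub>R i" "real n * (b \<bullet> i)"]
    by (simp add: inner_diff_left algebra_simps inner_commute)
  show ?thesis unfolding box_bump_def by (intro Ck_prod Ck_mult 1 2 finite_Basis)
qed

lemma flat_0_le_1: "flat 0 t \<le> 1"
  by (simp add: flat_def)

lemma box_bump_bounds: "0 \<le> box_bump n a b x" "box_bump n a b x \<le> 1"
  unfolding box_bump_def
  by (auto intro!: prod_nonneg prod_le_1 mult_le_one mult_nonneg_nonneg flat_nonneg flat_0_le_1)

lemma box_bump_outside: "x \<notin> box a b \<Longrightarrow> box_bump n a b x = 0"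
proof -
  assume "x \<notin> box a b"
  then obtain i where i: "i \<in> Basis" "(x - a) \<bullet> i \<le> 0 \<or> (b - x) \<bullet> i \<le> 0"
    by (force simp: box_def inner_diff_left not_less)
  have "flat 0 (real n * ((x - a) \<bullet> i)) = 0 \<or> flat 0 (real n * ((b - x) \<bullet> i)) = 0"
    using i(2) by (auto simp: flat_def zero_less_mult_iff)
  then show ?thesis unfolding box_bump_def using i(1) by (intro prod_zero finite_Basis bexI[of _ i]) auto
qed

lemma box_bump_pos: "n > 0 \<Longrightarrow> x \<in> box a b \<Longrightarrow> box_bump n a b x > 0"
  unfolding box_bump_def by (intro prod_pos) (auto simp: flat_def box_def inner_diff_left)

lemma box_bump_tendsto: "(\<lambda>n. box_bump n a b x) \<longlonglongrightarrow> indicator (box a b) x"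
proof (cases "x \<in> box a b")
  case True
  have *: "(\<lambda>n. flat 0 (real n * t)) \<longlonglongrightarrow> 1" if "t > 0" for t
  proof -
    have "(\<lambda>n. exp (- (1 / (real n * t)))) \<longlonglongrightarrow> exp (- 0)"
    proof (intro tendsto_exp tendsto_minus)
      have "(\<lambda>n. (1 / t) * (1 / real n)) \<longlonglongrightarrow> (1 / t) * 0"
        by (intro tendsto_mult tendsto_const lim_1_over_n)
      then show "(\<lambda>n. 1 / (real n * t)) \<longlonglongrightarrow> 0" by (simp add: mult.commute)
    qed
    then have "(\<lambda>n. exp (- (1 / (real n * t)))) \<longlonglongrightarrow> 1" by simp
    then show ?thesis
      by (rule Lim_transform_eventually)
         (use that in \<open>auto simp: flat_def intro!: eventually_mono[OF eventually_gt_at_top[of 0]]\<close>)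
  qed
  have "(\<lambda>n. box_bump n a b x) \<longlonglongrightarrow> (\<Prod>i\<in>(Basis::'a set). 1 * 1)"
    unfolding box_bump_def using True
    by (intro tendsto_prod tendsto_mult *) (auto simp: box_def inner_diff_left)
  then show ?thesis using True by simp
qed (simp add: box_bump_outside)

definition grad :: "('a::euclidean_space \<Rightarrow> real) \<Rightarrow> 'a \<Rightarrow> 'a" where
  "grad f x = (\<Sum>b\<in>Basis. frechet_derivative f (at x) b *\<^sub>R b)"

lemma frechet_derivative_eq_grad:
  assumes "f differentiable (at x)"
  shows "frechet_derivative f (at x) h = grad f x \<bullet> h"
proof -
  interpret linear "frechet_derivative f (at x)"
    using has_derivative_frechet[OF assms] by (rule has_derivative_linear)
  have "frechet_derivative f (at x) h = frechet_derivative f (at x) (\<Sum>b\<in>Basis. (h \<bullet> b) *\<^sub>R b)"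
    by (simp add: euclidean_representation)
  also have "\<dots> = grad f x \<bullet> h"
    unfolding grad_def by (subst sum) (simp add: scale inner_sum_left inner_sum_right inner_commute mult.commute)
  finally show ?thesis .
qed

lemma continuous_on_grad: "Ck 1 f \<Longrightarrow> continuous_on UNIV (grad f)"
  unfolding grad_def by (auto intro!: continuous_intros)

lemma has_derivative_grad:
  assumes "Ck 1 f" shows "(f has_derivative (\<lambda>h. grad f x \<bullet> h)) (at x)"
proof -
  have f: "Ck (Suc 0) f" using assms by simp
  have "frechet_derivative f (at x) = (\<lambda>h. grad f x \<bullet> h)"
    by (rule ext) (rule frechet_derivative_eq_grad[OF Ck_differentiable[OF f]])
  then show ?thesis using Ck_has_derivative[OF f, of x] by simp
qed

lemma Ck_1I:
  assumes "\<And>x. (f has_derivative (\<lambda>h. g x \<bullet> h)) (at x)" "continuous_on UNIV g"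
  shows "Ck 1 f"
  using Ck_SucI[of f "\<lambda>x h. g x \<bullet> h" 0] assms by (simp add: continuous_on_inner)

lemma has_derivative_unique_grad:
  assumes "Ck 1 f" "(f has_derivative (\<lambda>h. g \<bullet> h)) (at x)"
  shows "grad f x = g"
proof -
  have "(\<lambda>h. grad f x \<bullet> h) = (\<lambda>h. g \<bullet> h)"
    by (rule has_derivative_unique[OF has_derivative_grad[OF assms(1)] assms(2)])
  then show ?thesis by (metis inner_eq_zero_iff inner_diff_left right_minus_eq)
qed

text \<open>
  Differentiate in the direction of the gradient itself.
\<close>

lemma norm_grad_le:
  assumes f: "Ck 1 f" and r: "r > 0"
    and lip: "\<And>y. dist x y < r \<Longrightarrow> \<bar>f y - f x\<bar> \<le> L * dist x y"
  shows "norm (grad f x) \<le> L"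
proof (cases "grad f x = 0")
  case True
  obtain b :: 'a where b: "b \<in> Basis" using nonempty_Basis by blast
  have "0 \<le> L * dist x (x + (r/2) *\<^sub>R b)"
    using r b by (intro order_trans[OF abs_ge_zero lip]) (auto simp: dist_norm)
  then show ?thesis using True r b by (simp add: dist_norm zero_le_mult_iff)
next
  case False
  define v where "v = grad f x"
  have "((\<lambda>t. f (x + t *\<^sub>R v)) has_derivative (\<lambda>t. v \<bullet> (t *\<^sub>R v))) (at 0)"
  proof -
    have "((\<lambda>t. x + t *\<^sub>R v) has_derivative (\<lambda>t. t *\<^sub>R v)) (at 0)"
      by (auto intro!: derivative_eq_intros)
    from has_derivative_compose[OF this has_derivative_grad[OF f]] show ?thesis
      by (simp add: v_def)
  qed
  then have "((\<lambda>t. f (x + t *\<^sub>R v)) has_real_derivative (v \<bullet> v)) (at 0)"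
    unfolding has_field_derivative_def inner_scaleR_right by (simp only: mult.commute[of _ "v \<bullet> v"])
  then have lim: "((\<lambda>t. (f (x + t *\<^sub>R v) - f x) / t) \<longlongrightarrow> v \<bullet> v) (at 0)"
    by (simp add: DERIV_def)
  have "eventually (\<lambda>t::real. dist 0 t < r / norm v \<and> t \<noteq> 0) (at 0)"
    using r False by (intro eventually_conj) (auto simp: eventually_at v_def dist_commute intro!: exI[of _ "r / norm (grad f x)"])
  then have ev: "eventually (\<lambda>t. (f (x + t *\<^sub>R v) - f x) / t \<le> L * norm v) (at 0)"
  proof eventually_elim
    case (elim t)
    have "dist x (x + t *\<^sub>R v) = \<bar>t\<bar> * norm v" by (simp add: dist_norm)
    moreover have "\<bar>t\<bar> * norm v < r" using elim False by (simp add: v_def field_simps)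
    ultimately have "\<bar>f (x + t *\<^sub>R v) - f x\<bar> \<le> L * (\<bar>t\<bar> * norm v)" using lip by metis
    then have "\<bar>(f (x + t *\<^sub>R v) - f x) / t\<bar> \<le> L * norm v" using elim by (simp add: abs_divide field_simps)
    then show ?case by linarith
  qed
  have "v \<bullet> v \<le> L * norm v" by (rule tendsto_upperbound[OF lim ev]) simp
  then have "norm v * norm v \<le> L * norm v" by (simp add: dot_square_norm power2_eq_square)
  then show ?thesis using False by (simp add: v_def)
qed


lemma integrable_continuous_cbox_support:
  fixes g :: "'a::euclidean_space \<Rightarrow> 'b::euclidean_space"
  assumes "continuous_on UNIV g" "\<And>x. x \<notin> cbox a b \<Longrightarrow> g x = 0"
  shows "integrable lborel g"
proof -
  have "integrable lborel (\<lambda>x. indicator (cbox a b) x *\<^sub>R g x)"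
    by (rule borel_integrable_compact) (auto intro: continuous_on_subset[OF assms(1)])
  also have "(\<lambda>x. indicator (cbox a b) x *\<^sub>R g x) = g"
    using assms(2) by (auto simp: indicator_def)
  finally show ?thesis .
qed

lemma integral_lborel_reflect:
  fixes g :: "'a::euclidean_space \<Rightarrow> 'b::euclidean_space"
  assumes [measurable]: "g \<in> borel_measurable borel"
  shows "(\<integral>y. g (x - y) \<partial>lborel) = (\<integral>y. g y \<partial>lborel)"
proof -
  have "lborel = distr lborel borel (\<lambda>y. x + (-1) *\<^sub>R y)"
    using lborel_affine[of "-1" x] by (simp add: density_1)
  then have "(\<integral>y. g y \<partial>lborel) = (\<integral>y. g y \<partial>distr lborel borel (\<lambda>y. x - y))" by simp
  also have "\<dots> = (\<integral>y. g (x - y) \<partial>lborel)" by (rule integral_distr) measurable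
  finally show ?thesis ..
qed

text \<open>
  The reflection \<open>y \<mapsto> x - y\<close> moves the variable \<open>x\<close> from \<open>f\<close> to the kernel, which is
  differentiable.  For \<open>x\<close> in a unit ball the integrand lives in a fixed box, and there the Leibniz rule
  for integrals over boxes applies.
\<close>

lemma Ck_1_convolution:
  fixes f K :: "'a::euclidean_space \<Rightarrow> real"
  assumes f: "continuous_on UNIV f" and K: "Ck 1 K" and supp: "\<And>x. x \<notin> cbox (- (e *\<^sub>R One)) (e *\<^sub>R One) \<Longrightarrow> K x = 0"
  shows "Ck 1 (\<lambda>x. \<integral>y. K y * f (x - y) \<partial>lborel)"
proof -
  define C where "C x = cbox (x - (e + 1) *\<^sub>R One) (x + (e + 1) *\<^sub>R One)" for x :: 'a
  have K0: "continuous_on UNIV K" using Ck_continuous[OF K] .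
  have gK: "continuous_on UNIV (grad K)" using continuous_on_grad[OF K] .
  have suppg: "grad K x = 0" if x: "x \<notin> cbox (- (e *\<^sub>R One)) (e *\<^sub>R One)" for x
  proof (rule has_derivative_unique_grad[OF K])
    have "((\<lambda>_. 0::real) has_derivative (\<lambda>h. 0)) (at x)" by simp
    then have "(K has_derivative (\<lambda>h. 0)) (at x)"
      by (rule has_derivative_transform_within_open[where s = "- cbox (- (e *\<^sub>R One)) (e *\<^sub>R One)"])
         (use x supp in auto)
    then show "(K has_derivative (\<lambda>h. 0 \<bullet> h)) (at x)" by simp
  qed
  have far: "x - y \<notin> cbox (- (e *\<^sub>R One)) (e *\<^sub>R One)" if "y \<notin> C x0" "x \<in> ball x0 1" for x x0 y
  proof
    assume a: "x - y \<in> cbox (- (e *\<^sub>R One)) (e *\<^sub>R One)"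
    have "y \<in> C x0" unfolding C_def mem_box
    proof
      fix i :: 'a assume i: "i \<in> Basis"
      have "\<bar>(x0 - x) \<bullet> i\<bar> \<le> 1" using that(2) Basis_le_norm[OF i, of "x0 - x"] by (simp add: dist_norm)
      moreover have "- e \<le> (x - y) \<bullet> i" "(x - y) \<bullet> i \<le> e" using a i by (auto simp: mem_box)
      ultimately show "(x0 - (e + 1) *\<^sub>R One) \<bullet> i \<le> y \<bullet> i \<and> y \<bullet> i \<le> (x0 + (e + 1) *\<^sub>R One) \<bullet> i"
        using i by (simp add: inner_diff_left inner_add_left) linarith
    qed
    with that show False by simp
  qed
  define G where "G x = integral UNIV (\<lambda>y. K (x - y) * f y)" for x
  define g where "g x = integral UNIV (\<lambda>y. f y *\<^sub>R grad K (x - y))" for x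
  have G_loc: "G x = integral (C x0) (\<lambda>y. K (x - y) * f y)" if "x \<in> ball x0 1" for x x0
    unfolding G_def by (subst integral_restrict_UNIV[symmetric]) (use far[OF _ that] supp in \<open>auto intro!: arg_cong[where f = "integral UNIV"]\<close>)
  have g_loc: "g x = integral (C x0) (\<lambda>y. f y *\<^sub>R grad K (x - y))" if "x \<in> ball x0 1" for x x0
    unfolding g_def by (subst integral_restrict_UNIV[symmetric]) (use far[OF _ that] suppg in \<open>auto intro!: arg_cong[where f = "integral UNIV"]\<close>)
  note [continuous_intros] = continuous_on_compose2[OF f] continuous_on_compose2[OF K0] continuous_on_compose2[OF gK]
  have G_eq: "(\<integral>y. K y * f (x - y) \<partial>lborel) = G x" for x
  proof -
    have "continuous_on UNIV (\<lambda>y. K (x - y) * f y)" by (intro continuous_intros) auto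
    then have int: "integrable lborel (\<lambda>y. K (x - y) * f y)"
      by (rule integrable_continuous_cbox_support[of _ "x - (e + 1) *\<^sub>R One" "x + (e + 1) *\<^sub>R One"])
         (use far[of _ x x] supp in \<open>auto simp: C_def\<close>)
    have "(\<integral>y. K y * f (x - y) \<partial>lborel) = (\<integral>y. (\<lambda>y. K (x - y) * f y) (x - y) \<partial>lborel)" by simp
    also have "\<dots> = (\<integral>y. K (x - y) * f y \<partial>lborel)"
      using int by (intro integral_lborel_reflect) (simp add: borel_measurable_integrable)
    also have "\<dots> = G x" unfolding G_def by (rule integral_lborel[OF int, symmetric])
    finally show ?thesis .
  qed
  have D: "(G has_derivative (\<lambda>h. g x0 \<bullet> h)) (at x0)" for x0
  proof -
    have "((\<lambda>x. integral (C x0) (\<lambda>y. K (x - y) * f y)) has_derivative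
        integral (C x0) (\<lambda>y. blinfun_inner_right (f y *\<^sub>R grad K (x0 - y)))) (at x0 within ball x0 1)"
      unfolding C_def
    proof (rule leibniz_rule)
      fix x y
      have "((\<lambda>x. x - y) has_derivative (\<lambda>h. h)) (at x within ball x0 1)"
        by (auto intro!: derivative_eq_intros)
      from has_derivative_compose[OF this has_derivative_grad[OF K]]
      have "((\<lambda>x. K (x - y)) has_derivative (\<lambda>h. grad K (x - y) \<bullet> h)) (at x within ball x0 1)" .
      from has_derivative_mult_left[OF this, of "f y"]
      moreover have "blinfun_apply (blinfun_inner_right (f y *\<^sub>R grad K (x - y))) = (\<lambda>h. (grad K (x - y) \<bullet> h) * f y)"
        by (auto simp: mult.commute)
      ultimately show "((\<lambda>x. K (x - y) * f y) has_derivative blinfun_apply (blinfun_inner_right (f y *\<^sub>R grad K (x - y)))) (at x within ball x0 1)"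
        by (simp only:)
    next
      fix x
      show "(\<lambda>y. K (x - y) * f y) integrable_on cbox (x0 - (e + 1) *\<^sub>R One) (x0 + (e + 1) *\<^sub>R One)"
        by (intro integrable_continuous continuous_intros) auto
    next
      show "continuous_on (ball x0 1 \<times> cbox (x0 - (e + 1) *\<^sub>R One) (x0 + (e + 1) *\<^sub>R One))
          (\<lambda>(x, y). blinfun_inner_right (f y *\<^sub>R grad K (x - y)))"
        unfolding split_beta
        by (intro bounded_linear.continuous_on[OF bounded_linear_blinfun_inner_right] continuous_intros) auto
    qed auto
    moreover have "blinfun_apply (integral (C x0) (\<lambda>y. blinfun_inner_right (f y *\<^sub>R grad K (x0 - y)))) = (\<lambda>h. g x0 \<bullet> h)"
    proof -
      have "(\<lambda>y. f y *\<^sub>R grad K (x0 - y)) integrable_on C x0"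
        unfolding C_def by (intro integrable_continuous continuous_intros) auto
      from integral_linear[OF this bounded_linear_blinfun_inner_right]
      have "integral (C x0) (\<lambda>y. blinfun_inner_right (f y *\<^sub>R grad K (x0 - y))) = blinfun_inner_right (g x0)"
        by (simp add: o_def g_loc[of x0 x0])
      then show ?thesis by simp
    qed
    ultimately have "((\<lambda>x. integral (C x0) (\<lambda>y. K (x - y) * f y)) has_derivative (\<lambda>h. g x0 \<bullet> h)) (at x0)"
      by (simp add: at_within_open[of x0 "ball x0 1"])
    then show ?thesis
      by (rule has_derivative_transform_within_open[where s = "ball x0 1"]) (auto simp: G_loc)
  qed
  have "continuous_on UNIV g"
  proof (intro continuous_at_imp_continuous_on ballI)
    fix x0
    have "continuous_on (ball x0 1) (\<lambda>x. integral (C x0) (\<lambda>y. f y *\<^sub>R grad K (x - y)))"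
      unfolding C_def
      by (rule integral_continuous_on_param) (unfold split_beta, intro continuous_intros, auto)
    then have "continuous_on (ball x0 1) g" by (subst continuous_on_cong[OF refl g_loc])
    then show "isCont g x0" by (simp add: continuous_on_eq_continuous_at)
  qed
  from Ck_1I[OF D this] show ?thesis by (simp add: G_eq)
qed

text \<open>
  Averages inherit bounds on values and on differences.  Both bounds are stated locally because the
  function that will be mollified has a Lipschitz constant that varies with the distance to the
  boundary.
\<close>

lemma mollify:
  fixes f :: "'a::euclidean_space \<Rightarrow> real"
  assumes f: "continuous_on UNIV f" and h: "h > 0"
  obtains F where "Ck 1 F"
    "\<And>x a b. \<forall>y. dist x y \<le> h \<longrightarrow> a \<le> f y \<and> f y \<le> b \<Longrightarrow> a \<le> F x \<and> F x \<le> b"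
    "\<And>x x' L. \<forall>y. norm y \<le> h \<longrightarrow> \<bar>f (x - y) - f (x' - y)\<bar> \<le> L \<Longrightarrow> \<bar>F x - F x'\<bar> \<le> L"
proof -
  \<comment> \<open>The cube of half side \<open>e\<close> lies in the ball of radius \<open>h\<close>.\<close>
  define e where "e = h / DIM('a)"
  have e: "e > 0" using h by (simp add: e_def)
  define K :: "'a \<Rightarrow> real" where "K = box_bump 1 (- (e *\<^sub>R One)) (e *\<^sub>R One)"
  have K: "Ck 1 K" "\<And>x. K x \<ge> 0" "\<And>x. x \<notin> box (- (e *\<^sub>R One)) (e *\<^sub>R One) \<Longrightarrow> K x = 0"
    "\<And>x. x \<in> box (- (e *\<^sub>R One)) (e *\<^sub>R One) \<Longrightarrow> K x > 0"
    unfolding K_def using Ck_box_bump box_bump_bounds box_bump_outside box_bump_pos zero_less_one by blast+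
  have K3: "K x = 0" if "x \<notin> cbox (- (e *\<^sub>R One)) (e *\<^sub>R One)" for x
    using K(3) that box_subset_cbox by blast
  have small: "norm y \<le> h" if "y \<in> box (- (e *\<^sub>R One)) (e *\<^sub>R One)" for y :: 'a
  proof -
    have "\<bar>y \<bullet> b\<bar> \<le> e" if b: "b \<in> Basis" for b
      using \<open>y \<in> _\<close> b by (fastforce simp: mem_box abs_le_iff)
    then have "(\<Sum>b\<in>Basis. \<bar>y \<bullet> b\<bar>) \<le> of_nat (card (Basis :: 'a set)) * e" by (rule sum_bounded_above)
    then show ?thesis using norm_le_l1[of y] by (simp add: e_def)
  qed
  have contK: "continuous_on UNIV K" using Ck_continuous[OF K(1)] .
  have int: "integrable lborel (\<lambda>y. K y * g y)" if "continuous_on UNIV g" for g :: "'a \<Rightarrow> real"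
    by (rule integrable_continuous_cbox_support[of _ "- (e *\<^sub>R One)" "e *\<^sub>R One"])
       (use that contK K3 in \<open>auto intro!: continuous_intros\<close>)
  have intf: "integrable lborel (\<lambda>y. K y * f (x - y))" for x
    by (rule int) (intro continuous_on_compose2[OF f] continuous_intros, auto)
  have intc: "integrable lborel (\<lambda>y. K y * a)" for a by (rule int) auto
  have intK: "integrable lborel K" using int[of "\<lambda>_. 1"] by simp
  define c where "c = (\<integral>y. K y \<partial>lborel)"
  have c: "c > 0"
  proof -
    have "c \<ge> 0" unfolding c_def using K(2) by (intro Bochner_Integration.integral_nonneg) auto
    moreover have "c \<noteq> 0"
    proof
      assume "c = 0"
      then have "AE x in lborel. K x = 0"
        using integral_nonneg_eq_0_iff_AE[OF intK] K(2) by (simp add: c_def)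
      then have "AE x::'a in lborel. x \<notin> box (- (e *\<^sub>R One)) (e *\<^sub>R One)"
        by eventually_elim (use K(4) in force)
      then have "emeasure lborel (box (- (e *\<^sub>R One)) (e *\<^sub>R One) :: 'a set) = 0"
        by (subst (asm) AE_iff_measurable[OF _ refl]) auto
      moreover have "0 < (\<Prod>i\<in>(Basis::'a set). (e *\<^sub>R One + e *\<^sub>R One) \<bullet> i)"
        using e by (intro prod_pos) (simp add: inner_add_left)
      ultimately show False using e by (auto simp: emeasure_lborel_box_eq inner_add_left)
    qed
    ultimately show ?thesis by simp
  qed
  define F where "F x = (1 / c) * (\<integral>y. K y * f (x - y) \<partial>lborel)" for x
  show ?thesis
  proof (rule that[of F])
    show "Ck 1 F" unfolding F_def
      by (intro Ck_mult Ck_const Ck_1_convolution[OF f K(1) K3])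
  next
    fix x a b assume ab: "\<forall>y. dist x y \<le> h \<longrightarrow> a \<le> f y \<and> f y \<le> b"
    have pt: "K y * a \<le> K y * f (x - y)" "K y * f (x - y) \<le> K y * b" for y
      using ab[rule_format, of "x - y"] small[of y] K(2,3)[of y] by (cases "y \<in> box (- (e *\<^sub>R One)) (e *\<^sub>R One)";
        auto simp: dist_norm intro!: mult_left_mono)+
    have "(\<integral>y. K y * a \<partial>lborel) \<le> (\<integral>y. K y * f (x - y) \<partial>lborel)"
      by (intro integral_mono intf intc pt)
    moreover have "(\<integral>y. K y * f (x - y) \<partial>lborel) \<le> (\<integral>y. K y * b \<partial>lborel)"
      by (intro integral_mono intf intc pt)
    ultimately show "a \<le> F x \<and> F x \<le> b" using c intK by (simp add: F_def c_def[symmetric] field_simps)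
  next
    fix x x' L assume L: "\<forall>y. norm y \<le> h \<longrightarrow> \<bar>f (x - y) - f (x' - y)\<bar> \<le> L"
    have "F x - F x' = (1 / c) * (\<integral>y. K y * f (x - y) - K y * f (x' - y) \<partial>lborel)"
      by (simp add: F_def intf right_diff_distrib)
    also have "\<bar>\<dots>\<bar> \<le> (1 / c) * (\<integral>y. K y * L \<partial>lborel)"
    proof -
      have "\<bar>\<integral>y. K y * f (x - y) - K y * f (x' - y) \<partial>lborel\<bar> \<le> (\<integral>y. K y * L \<partial>lborel)"
      proof (rule integral_abs_bound_integral)
        fix y
        show "\<bar>K y * f (x - y) - K y * f (x' - y)\<bar> \<le> K y * L"
          using L[rule_format, of y] small[of y] K(2,3)[of y]
          by (cases "y \<in> box (- (e *\<^sub>R One)) (e *\<^sub>R One)")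
             (auto simp: abs_mult right_diff_distrib[symmetric] intro!: mult_left_mono)
      qed (intro Bochner_Integration.integrable_diff intf intc)+
      then show ?thesis using c by (simp add: abs_mult divide_right_mono)
    qed
    also have "\<dots> = L" using c intK by (simp add: c_def)
    finally show "\<bar>F x - F x'\<bar> \<le> L" .
  qed
qed

section \<open>Weak gradients\<close>

lemma integrable_norm_sq_diff:
  fixes f g :: "'x \<Rightarrow> 'b::euclidean_space"
  assumes [measurable]: "f \<in> borel_measurable M" "g \<in> borel_measurable M"
    and int: "integrable M (\<lambda>x. (norm (f x))\<^sup>2)" "integrable M (\<lambda>x. (norm (g x))\<^sup>2)"
  shows "integrable M (\<lambda>x. (norm (f x - g x))\<^sup>2)"
proof (rule Bochner_Integration.integrable_bound)
  show "integrable M (\<lambda>x. 2 * (norm (f x))\<^sup>2 + 2 * (norm (g x))\<^sup>2)" using int by simp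
  show "AE x in M. norm ((norm (f x - g x))\<^sup>2) \<le> norm (2 * (norm (f x))\<^sup>2 + 2 * (norm (g x))\<^sup>2)"
  proof (rule AE_I2)
    fix x
    have "(norm (f x - g x))\<^sup>2 \<le> (norm (f x) + norm (g x))\<^sup>2"
      by (intro power_mono norm_triangle_ineq4) simp
    also have "\<dots> \<le> 2 * (norm (f x))\<^sup>2 + 2 * (norm (g x))\<^sup>2"
      using sum_squares_bound[of "norm (f x)" "norm (g x)"] by (simp add: power2_sum)
    finally show "norm ((norm (f x - g x))\<^sup>2) \<le> norm (2 * (norm (f x))\<^sup>2 + 2 * (norm (g x))\<^sup>2)" by simp
  qed
qed measurable

text \<open>
  Young's inequality with weight \<open>\<theta>\<close>.  With \<open>\<theta>\<close> fixed while the first term tends to 0, and then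
  \<open>\<theta>\<close> small, it yields convergence of norms in \<open>L\<^sup>2\<close>.
\<close>

lemma abs_norm_sq_diff_le:
  fixes a b :: "'b::real_inner"
  assumes "\<theta> > 0"
  shows "\<bar>(norm a)\<^sup>2 - (norm b)\<^sup>2\<bar> \<le> (1 + 1 / \<theta>) * (norm (a - b))\<^sup>2 + \<theta> * (norm b)\<^sup>2"
proof -
  define d where "d = norm (a - b)"
  have "\<bar>norm a - norm b\<bar> \<le> d" unfolding d_def by (rule norm_triangle_ineq3)
  moreover have "norm a + norm b \<le> d + 2 * norm b"
    unfolding d_def using norm_triangle_sub[of a b] by simp
  ultimately have "\<bar>norm a - norm b\<bar> * (norm a + norm b) \<le> d * (d + 2 * norm b)"
    by (intro mult_mono) (auto simp: d_def)
  moreover have "\<bar>(norm a)\<^sup>2 - (norm b)\<^sup>2\<bar> = \<bar>norm a - norm b\<bar> * (norm a + norm b)"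
    by (simp add: power2_eq_square square_diff_square_factored abs_mult)
  moreover have "2 * (d * norm b) \<le> d\<^sup>2 / \<theta> + \<theta> * (norm b)\<^sup>2"
  proof -
    have "0 \<le> (d - \<theta> * norm b)\<^sup>2 / \<theta>" using assms by simp
    also have "\<dots> = d\<^sup>2 / \<theta> - 2 * (d * norm b) + \<theta> * (norm b)\<^sup>2"
      using assms by (simp add: power2_eq_square field_simps)
    finally show ?thesis by simp
  qed
  ultimately show ?thesis by (simp add: d_def[symmetric] power2_eq_square algebra_simps)
qed

text \<open>
  The integrability of the limit belongs to the conclusion: the Bochner integral of a nonnegative
  function that is not integrable is 0, which would spoil the convergence of the integrals.
\<close>

lemma L2_norm_tendsto:
  fixes f :: "'x \<Rightarrow> 'b::euclidean_space"
  assumes meas[measurable]: "\<And>n. F n \<in> borel_measurable M" "f \<in> borel_measurable M"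
    and int: "\<And>n. integrable M (\<lambda>x. (norm (F n x))\<^sup>2)"
    and lim: "(\<lambda>n. \<integral>\<^sup>+x. ennreal ((norm (F n x - f x))\<^sup>2) \<partial>M) \<longlonglongrightarrow> 0"
  shows "integrable M (\<lambda>x. (norm (f x))\<^sup>2)"
    and "(\<lambda>n. \<integral>x. (norm (F n x))\<^sup>2 \<partial>M) \<longlonglongrightarrow> (\<integral>x. (norm (f x))\<^sup>2 \<partial>M)"
proof -
  have "eventually (\<lambda>n. (\<integral>\<^sup>+x. ennreal ((norm (F n x - f x))\<^sup>2) \<partial>M) < 1) sequentially"
    using lim by (rule order_tendstoD) simp
  then obtain n where n: "(\<integral>\<^sup>+x. ennreal ((norm (F n x - f x))\<^sup>2) \<partial>M) < 1"
    by (auto simp: eventually_sequentially)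
  have "integrable M (\<lambda>x. (norm (F n x - f x))\<^sup>2)"
    using n by (intro integrableI_bounded) (auto intro: less_trans)
  then have "integrable M (\<lambda>x. (norm (F n x - (F n x - f x)))\<^sup>2)"
    by (rule integrable_norm_sq_diff[OF _ _ int, rotated 2]) auto
  then show intf: "integrable M (\<lambda>x. (norm (f x))\<^sup>2)" by simp
  define d where "d n = (\<integral>x. (norm (F n x - f x))\<^sup>2 \<partial>M)" for n
  have intd: "integrable M (\<lambda>x. (norm (F n x - f x))\<^sup>2)" for n
    by (intro integrable_norm_sq_diff int intf) auto
  have "(\<lambda>n. ennreal (d n)) \<longlonglongrightarrow> ennreal 0"
    using lim by (simp add: d_def nn_integral_eq_integral[OF intd])
  then have d0: "d \<longlonglongrightarrow> 0"
    by (subst (asm) tendsto_ennreal_iff) (auto simp: d_def)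
  define I where "I = (\<integral>x. (norm (f x))\<^sup>2 \<partial>M)"
  have I0: "I \<ge> 0" by (simp add: I_def)
  have bound: "\<bar>(\<integral>x. (norm (F n x))\<^sup>2 \<partial>M) - I\<bar> \<le> (1 + 1 / \<theta>) * d n + \<theta> * I" if "\<theta> > 0" for \<theta> n
  proof -
    have "(\<integral>x. (norm (F n x))\<^sup>2 \<partial>M) - I = (\<integral>x. (norm (F n x))\<^sup>2 - (norm (f x))\<^sup>2 \<partial>M)"
      unfolding I_def using int intf by simp
    also have "\<bar>\<dots>\<bar> \<le> (\<integral>x. (1 + 1 / \<theta>) * (norm (F n x - f x))\<^sup>2 + \<theta> * (norm (f x))\<^sup>2 \<partial>M)"
      by (rule order_trans[OF integral_abs_bound integral_mono])
         (use int intf intd abs_norm_sq_diff_le[OF that] in auto)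
    also have "\<dots> = (1 + 1 / \<theta>) * d n + \<theta> * I" unfolding I_def d_def using intd intf by simp
    finally show ?thesis .
  qed
  have "(\<lambda>n. \<integral>x. (norm (F n x))\<^sup>2 \<partial>M) \<longlonglongrightarrow> I"
  proof (rule tendstoI)
    fix \<epsilon> :: real assume \<epsilon>: "\<epsilon> > 0"
    define \<theta> where "\<theta> = \<epsilon> / (2 * (I + 1))"
    have \<theta>: "\<theta> > 0" "\<theta> * I \<le> \<epsilon> / 2" using \<epsilon> I0 by (auto simp: \<theta>_def field_simps)
    have "(\<lambda>n. (1 + 1 / \<theta>) * d n) \<longlonglongrightarrow> (1 + 1 / \<theta>) * 0" by (intro tendsto_mult d0 tendsto_const)
    then have "eventually (\<lambda>n. (1 + 1 / \<theta>) * d n < \<epsilon> / 2) sequentially"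
      using \<epsilon> by (intro order_tendstoD(2)) auto
    then show "eventually (\<lambda>n. dist (\<integral>x. (norm (F n x))\<^sup>2 \<partial>M) I < \<epsilon>) sequentially"
    proof eventually_elim
      case (elim n)
      have "\<bar>(\<integral>x. (norm (F n x))\<^sup>2 \<partial>M) - I\<bar> \<le> (1 + 1 / \<theta>) * d n + \<theta> * I" by (rule bound[OF \<theta>(1)])
      also have "\<dots> < \<epsilon> / 2 + \<epsilon> / 2" using elim \<theta>(2) by (rule add_less_le_mono)
      finally show ?case by (simp add: dist_real_def)
    qed
  qed
  then show "(\<lambda>n. \<integral>x. (norm (F n x))\<^sup>2 \<partial>M) \<longlonglongrightarrow> (\<integral>x. (norm (f x))\<^sup>2 \<partial>M)"
    by (simp add: I_def)
qed

lemma integrable_scaleR_of_squares: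
  fixes u :: "'x \<Rightarrow> 'b::euclidean_space"
  assumes [measurable]: "\<psi> \<in> borel_measurable M" "u \<in> borel_measurable M"
    and int: "integrable M (\<lambda>x. (\<psi> x)\<^sup>2)" "integrable M (\<lambda>x. (norm (u x))\<^sup>2)"
  shows "integrable M (\<lambda>x. \<psi> x *\<^sub>R u x)"
proof (rule Bochner_Integration.integrable_bound)
  show "integrable M (\<lambda>x. (\<psi> x)\<^sup>2 + (norm (u x))\<^sup>2)" using int by simp
  show "AE x in M. norm (\<psi> x *\<^sub>R u x) \<le> norm ((\<psi> x)\<^sup>2 + (norm (u x))\<^sup>2)"
  proof (rule AE_I2)
    fix x
    have "2 * (\<bar>\<psi> x\<bar> * norm (u x)) \<le> (\<psi> x)\<^sup>2 + (norm (u x))\<^sup>2"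
      using sum_squares_bound[of "\<bar>\<psi> x\<bar>" "norm (u x)"] by simp
    moreover have "0 \<le> \<bar>\<psi> x\<bar> * norm (u x)" by simp
    ultimately show "norm (\<psi> x *\<^sub>R u x) \<le> norm ((\<psi> x)\<^sup>2 + (norm (u x))\<^sup>2)" by (simp only: norm_scaleR real_norm_def abs_of_nonneg[OF add_nonneg_nonneg[OF zero_le_power2 zero_le_power2]])
  qed
qed measurable

lemma integrable_compact_support:
  fixes g :: "'a::euclidean_space \<Rightarrow> 'b::euclidean_space"
  assumes "continuous_on UNIV g" "compact K" "supported_in K g"
  shows "integrable lborel g"
proof -
  obtain a b where "K \<subseteq> cbox a b"
    using compact_imp_bounded[OF assms(2)] bounded_subset_cbox_symmetric by blast
  then show ?thesis
    using assms by (intro integrable_continuous_cbox_support[of g a b]) (auto simp: supported_in_def)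
qed

lemma integrable_lebesgue_on:
  fixes g :: "'a::euclidean_space \<Rightarrow> 'b::euclidean_space"
  assumes "integrable lborel g" "open \<Omega>"
  shows "integrable (lebesgue_on \<Omega>) g"
proof -
  have "integrable lebesgue g" using assms(1) by (simp add: integrable_completion borel_measurable_integrable)
  then have "integrable lebesgue (\<lambda>x. indicator \<Omega> x *\<^sub>R g x)"
    using assms(2) by (intro integrable_mult_indicator) auto
  then show ?thesis using assms(2) by (subst integrable_restrict_space) auto
qed

lemma borel_measurable_lebesgue_on:
  "g \<in> borel_measurable borel \<Longrightarrow> g \<in> borel_measurable (lebesgue_on \<Omega>)"
  by (intro measurable_restrict_space1 measurable_completion) simp

lemma integral_lebesgue_on_supported:
  fixes g :: "'a::euclidean_space \<Rightarrow> 'b::euclidean_space"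
  assumes "g \<in> borel_measurable borel" "open \<Omega>" "supported_in \<Omega> g"
  shows "integral\<^sup>L (lebesgue_on \<Omega>) g = integral\<^sup>L lborel g"
proof -
  have "integral\<^sup>L (lebesgue_on \<Omega>) g = integral\<^sup>L lebesgue (\<lambda>x. indicator \<Omega> x *\<^sub>R g x)"
    using assms(2) by (subst integral_restrict_space) auto
  also have "(\<lambda>x. indicator \<Omega> x *\<^sub>R g x) = g"
    using assms(3) by (auto simp: supported_in_def indicator_def)
  also have "integral\<^sup>L lebesgue g = integral\<^sup>L lborel g"
    using assms(1) by (intro integral_completion) simp
  finally show ?thesis .
qed

lemma square_integrable_compact_support:
  fixes g :: "'a::euclidean_space \<Rightarrow> 'b::euclidean_space"
  assumes "continuous_on UNIV g" "compact K" "supported_in K g" "open \<Omega>"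
  shows "square_integrable \<Omega> g"
  unfolding square_integrable_def
proof
  show "g \<in> borel_measurable (lebesgue_on \<Omega>)"
    by (intro borel_measurable_lebesgue_on borel_measurable_continuous_onI assms)
  show "integrable (lebesgue_on \<Omega>) (\<lambda>x. (norm (g x))\<^sup>2)"
    using assms by (intro integrable_lebesgue_on integrable_compact_support[where K = K])
      (auto intro!: continuous_intros simp: supported_in_def)
qed

lemma square_integrable_diff:
  fixes f g :: "'a::euclidean_space \<Rightarrow> 'b::euclidean_space"
  shows "square_integrable \<Omega> f \<Longrightarrow> square_integrable \<Omega> g \<Longrightarrow> square_integrable \<Omega> (\<lambda>x. f x - g x)"
  by (auto simp: square_integrable_def intro!: integrable_norm_sq_diff)

lemma frechet_derivative_supported:
  fixes f :: "'a::euclidean_space \<Rightarrow> 'b::real_normed_vector"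
  assumes "closed K" "supported_in K f"
  shows "supported_in K (\<lambda>x. frechet_derivative f (at x) v)"
  unfolding supported_in_def
proof (intro allI impI)
  fix x assume "x \<notin> K"
  have "(f has_derivative (\<lambda>h. 0)) (at x)"
    by (rule has_derivative_transform_within_open[where f = "\<lambda>_. 0" and s = "- K"])
       (use assms \<open>x \<notin> K\<close> in \<open>auto simp: supported_in_def\<close>)
  then show "frechet_derivative f (at x) v = 0"
    by (simp add: frechet_derivative_eqI)
qed

lemma test_function_integrable:
  fixes u :: "real^'n \<Rightarrow> 'b::euclidean_space"
  assumes \<psi>: "test_function \<Omega> \<psi>" and \<Omega>: "open \<Omega>" and u: "square_integrable \<Omega> u"
  shows "integrable (lebesgue_on \<Omega>) (\<lambda>x. \<psi> x *\<^sub>R u x)"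
    "integrable (lebesgue_on \<Omega>) (\<lambda>x. frechet_derivative \<psi> (at x) (axis i 1) *\<^sub>R u x)"
proof -
  obtain K where K: "compact K" "supported_in K \<psi>" using \<psi> by (auto simp: test_function_def)
  have C: "Ck (Suc 0) \<psi>" using \<psi> unfolding test_function_def by blast
  have main: "integrable (lebesgue_on \<Omega>) (\<lambda>x. g x *\<^sub>R u x)"
    if "continuous_on UNIV g" "supported_in K g" for g
    using square_integrable_compact_support[OF that(1) K(1) that(2) \<Omega>] u
    by (intro integrable_scaleR_of_squares) (auto simp: square_integrable_def)
  show "integrable (lebesgue_on \<Omega>) (\<lambda>x. \<psi> x *\<^sub>R u x)"
    by (rule main[OF Ck_continuous[OF C] K(2)])
  show "integrable (lebesgue_on \<Omega>) (\<lambda>x. frechet_derivative \<psi> (at x) (axis i 1) *\<^sub>R u x)"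
    using C by (intro main frechet_derivative_supported K compact_imp_closed) (auto simp: axis_in_Basis_iff)
qed

text \<open>
  The bumps of the box are test functions, and they converge boundedly to its indicator.
\<close>

lemma box_integral_zero:
  fixes f :: "real^'n \<Rightarrow> 'b::euclidean_space"
  assumes \<Omega>: "open \<Omega>" and f: "square_integrable \<Omega> f"
    and zero: "\<And>\<psi>. test_function \<Omega> \<psi> \<Longrightarrow> (\<integral>x. \<psi> x *\<^sub>R f x \<partial>lebesgue_on \<Omega>) = 0"
    and sub: "cbox a b \<subseteq> \<Omega>"
  shows "(\<integral>x. indicator (box a b) x *\<^sub>R f x \<partial>lebesgue_on \<Omega>) = 0"
proof -
  have [measurable]: "f \<in> borel_measurable (lebesgue_on \<Omega>)" using f by (simp add: square_integrable_def)
  have bm[measurable]: "(\<lambda>x. box_bump n a b x) \<in> borel_measurable (lebesgue_on \<Omega>)" for n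
    by (intro borel_measurable_lebesgue_on borel_measurable_continuous_onI Ck_continuous[OF Ck_box_bump])
  have im[measurable]: "(\<lambda>x. indicator (box a b) x :: real) \<in> borel_measurable (lebesgue_on \<Omega>)"
    by (intro borel_measurable_lebesgue_on borel_measurable_indicator) auto
  have tf: "test_function \<Omega> (box_bump n a b)" for n
    unfolding test_function_def
  proof (intro conjI allI Ck_box_bump exI[of _ "cbox a b"])
    show "supported_in (cbox a b) (box_bump n a b)"
      using box_subset_cbox[of a b] by (auto simp: supported_in_def intro!: box_bump_outside)
  qed (use sub in auto)
  have "integrable lborel (\<lambda>x. indicator (box a b) x :: real)"
    by (intro integrable_real_indicator) (auto simp: emeasure_lborel_box_eq less_top[symmetric])
  then have i1: "integrable (lebesgue_on \<Omega>) (\<lambda>x. indicator (box a b) x :: real)"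
    by (rule integrable_lebesgue_on[OF _ \<Omega>])
  have "(\<lambda>x. (indicator (box a b) x :: real)\<^sup>2) = indicator (box a b)" by (auto simp: indicator_def)
  then have dom: "integrable (lebesgue_on \<Omega>) (\<lambda>x. norm (indicator (box a b) x *\<^sub>R f x))"
    using f i1 by (intro integrable_norm integrable_scaleR_of_squares) (auto simp: square_integrable_def)
  have "(\<lambda>n. \<integral>x. box_bump n a b x *\<^sub>R f x \<partial>lebesgue_on \<Omega>) \<longlonglongrightarrow> (\<integral>x. indicator (box a b) x *\<^sub>R f x \<partial>lebesgue_on \<Omega>)"
  proof (rule integral_dominated_convergence[OF _ _ dom])
    show "AE x in lebesgue_on \<Omega>. (\<lambda>n. box_bump n a b x *\<^sub>R f x) \<longlonglongrightarrow> indicator (box a b) x *\<^sub>R f x"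
      by (intro AE_I2 tendsto_scaleR box_bump_tendsto tendsto_const)
    show "AE x in lebesgue_on \<Omega>. norm (box_bump n a b x *\<^sub>R f x) \<le> norm (indicator (box a b) x *\<^sub>R f x)" for n
    proof (rule AE_I2)
      fix x
      show "norm (box_bump n a b x *\<^sub>R f x) \<le> norm (indicator (box a b) x *\<^sub>R f x)"
        using box_bump_bounds[of n a b x] box_bump_outside[of x a b n]
        by (cases "x \<in> box a b") (auto intro!: mult_left_le_one_le)
    qed
  qed measurable
  then show ?thesis using zero[OF tf] by (simp add: LIMSEQ_const_iff)
qed

text \<open>
  The sets over which \<open>F\<close> has integral 0 form a Dynkin system.  It contains the boxes, which are
  stable under intersection, hence all Borel sets and, up to null sets, all Lebesgue sets.
\<close>

lemma AE_zero_if_box_integrals_zero: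
  fixes F :: "'a::euclidean_space \<Rightarrow> 'b::euclidean_space"
  assumes F: "integrable lebesgue F" and total: "integral\<^sup>L lebesgue F = 0"
    and box: "\<And>a b. (\<integral>x. indicator (box a b) x *\<^sub>R F x \<partial>lebesgue) = 0"
  shows "AE x in lebesgue. F x = 0"
proof (rule sigma_finite_measure.density_zero[OF _ F])
  show "sigma_finite_measure (lebesgue :: 'a measure)"
  proof
    show "\<exists>A::'a set set. countable A \<and> A \<subseteq> sets lebesgue \<and> \<Union>A = space lebesgue \<and> (\<forall>a\<in>A. emeasure lebesgue a \<noteq> \<infinity>)"
    proof (intro exI[of _ "range (\<lambda>n. ball 0 (real n))"] conjI ballI)
      show "\<Union> (range (\<lambda>n. ball (0::'a) (real n))) = space lebesgue"
        by (auto intro: reals_Archimedean2)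
      fix a assume "a \<in> range (\<lambda>n. ball (0::'a) (real n))"
      then obtain n where "a = ball 0 (real n)" by auto
      then show "emeasure lebesgue a \<noteq> \<infinity>"
        using emeasure_bounded_finite[of "ball (0::'a) (real n)"] by simp
    qed auto
  qed
  have ind: "integrable lebesgue (\<lambda>x. indicator A x *\<^sub>R F x)" if "A \<in> sets borel" for A
    using that F by (intro integrable_mult_indicator) auto
  have borel: "(\<integral>x. indicator A x *\<^sub>R F x \<partial>lebesgue) = 0" if "A \<in> sets borel" for A
  proof -
    have "Int_stable (range (\<lambda>(a, b). box a b :: 'a set))"
      by (auto simp: Int_stable_def box_Int_box)
    moreover have "range (\<lambda>(a, b). box a b :: 'a set) \<subseteq> Pow UNIV" by simp
    moreover have "A \<in> sigma_sets UNIV (range (\<lambda>(a, b). box a b :: 'a set))"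
      using that by (simp add: borel_eq_box sets_measure_of)
    ultimately show ?thesis
    proof (induction rule: sigma_sets_induct_disjoint)
      case (basic A)
      then show ?case using box by auto
    next
      case (compl A)
      have "A \<in> sets borel" using compl by (simp add: borel_eq_box sets_measure_of)
      then have "(\<integral>x. F x - indicator A x *\<^sub>R F x \<partial>lebesgue) = 0"
        using compl total F ind by simp
      also have "(\<lambda>x. F x - indicator A x *\<^sub>R F x) = (\<lambda>x. indicator (UNIV - A) x *\<^sub>R F x)"
        by (auto simp: indicator_def)
      finally show ?case .
    next
      case (union A)
      have A: "A i \<in> sets lebesgue" for i
        using union(2) by (auto simp: borel_eq_box sets_measure_of image_subset_iff)
      have "(\<Union>i. A i) \<in> sets lebesgue" using A by auto
      then have "set_integrable lebesgue (\<Union>i. A i) F"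
        unfolding set_integrable_def using F by (intro integrable_mult_indicator)
      from lebesgue_integral_countable_add[OF A _ this] union
      have "set_lebesgue_integral lebesgue (\<Union>i. A i) F = (\<Sum>i. set_lebesgue_integral lebesgue (A i) F)"
        by (auto simp: disjoint_family_on_def)
      then show ?case using union(3) by (simp add: set_lebesgue_integral_def)
    qed simp
  qed
  fix A :: "'a set" assume "A \<in> sets lebesgue"
  then obtain S N N' where A: "A = S \<union> N" "N \<subseteq> N'" "N' \<in> null_sets lborel" "S \<in> sets lborel"
    by (rule sets_completionE)
  have "AE x in lebesgue. x \<notin> N'"
    using A(3) by (intro AE_not_in) (simp add: null_sets_completionI)
  then have "AE x in lebesgue. indicator A x *\<^sub>R F x = indicator S x *\<^sub>R F x"
    by eventually_elim (use A in \<open>auto simp: indicator_def\<close>)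
  then have "set_lebesgue_integral lebesgue A F = (\<integral>x. indicator S x *\<^sub>R F x \<partial>lebesgue)"
    unfolding set_lebesgue_integral_def using \<open>A \<in> sets lebesgue\<close> A(4) F
    by (intro integral_cong_AE) (auto intro!: borel_measurable_scaleR borel_measurable_indicator)
  then show "set_lebesgue_integral lebesgue A F = 0" using borel A(4) by simp
qed

text \<open>
  On a box whose closure lies in \<open>\<Omega>\<close> the function \<open>f\<close> is integrable and its integrals over subboxes
  vanish.  Countably many closed boxes exhaust \<open>\<Omega>\<close>, and their boundaries are null sets.
\<close>

lemma fundamental_lemma:
  fixes f :: "real^'n \<Rightarrow> 'b::euclidean_space"
  assumes \<Omega>: "open \<Omega>" and f: "square_integrable \<Omega> f"
    and zero: "\<And>\<psi>. test_function \<Omega> \<psi> \<Longrightarrow> (\<integral>x. \<psi> x *\<^sub>R f x \<partial>lebesgue_on \<Omega>) = 0"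
  shows "AE x in lebesgue_on \<Omega>. f x = 0"
proof -
  have \<Omega>L: "\<Omega> \<inter> space lebesgue \<in> sets lebesgue" using \<Omega> by auto
  have [measurable]: "f \<in> borel_measurable (lebesgue_on \<Omega>)" using f by (simp add: square_integrable_def)
  have onbox: "AE x in lebesgue. x \<in> cbox c d \<longrightarrow> f x = 0" if sub: "cbox c d \<subseteq> \<Omega>" for c d
  proof -
    define F where "F x = indicator (box c d) x *\<^sub>R f x" for x
    have sub': "box c d \<subseteq> \<Omega>" using sub box_subset_cbox by blast
    have toF: "(\<lambda>x. indicator \<Omega> x *\<^sub>R (indicator (box a b) x *\<^sub>R F x)) =
        (\<lambda>x. indicator (box a b) x *\<^sub>R F x)" for a b
      by (rule ext, rename_tac x, case_tac "x \<in> box c d") (use sub' in \<open>auto simp: F_def\<close>)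
    have toF': "(\<lambda>x. indicator \<Omega> x *\<^sub>R F x) = F"
      by (rule ext, rename_tac x, case_tac "x \<in> box c d") (use sub' in \<open>auto simp: F_def\<close>)
    have "integrable lborel (\<lambda>x. indicator (box c d) x :: real)"
      by (intro integrable_real_indicator) (auto simp: emeasure_lborel_box_eq less_top[symmetric])
    then have i1: "integrable (lebesgue_on \<Omega>) (\<lambda>x. indicator (box c d) x :: real)"
      by (rule integrable_lebesgue_on[OF _ \<Omega>])
    have "(\<lambda>x. (indicator (box c d) x :: real)\<^sup>2) = indicator (box c d)" by (auto simp: indicator_def)
    then have "integrable (lebesgue_on \<Omega>) F"
      unfolding F_def using f i1
      by (intro integrable_scaleR_of_squares) (auto simp: square_integrable_def intro: borel_measurable_lebesgue_on)
    then have F: "integrable lebesgue F"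
      by (subst (asm) integrable_restrict_space[OF \<Omega>L]) (simp add: toF')
    have boxes: "(\<integral>x. indicator (box a b) x *\<^sub>R F x \<partial>lebesgue) = 0" for a b
    proof -
      obtain a' b' where ab: "box a b \<inter> box c d = box a' b'" "cbox a' b' \<subseteq> \<Omega>"
      proof (cases "box a b \<inter> box c d = {}")
        case True
        have "box One 0 = ({} :: (real^'n) set)" "cbox One 0 = ({} :: (real^'n) set)"
          by (simp_all add: box_eq_empty ex_in_conv)
        then show ?thesis using that[of One 0] True by simp
      next
        case False
        then obtain a' b' where ab: "box a b \<inter> box c d = box a' b'" by (auto simp: box_Int_box)
        then have "cbox a' b' = closure (box a' b')" using False by (simp add: closure_box)
        also have "\<dots> \<subseteq> closure (cbox c d)" using ab box_subset_cbox by (intro closure_mono) blast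
        finally show ?thesis using that[OF ab] sub by simp
      qed
      have "(\<integral>x. indicator (box a b) x *\<^sub>R F x \<partial>lebesgue) = (\<integral>x. indicator (box a b) x *\<^sub>R F x \<partial>lebesgue_on \<Omega>)"
        by (subst integral_restrict_space[OF \<Omega>L]) (simp only: toF)
      also have "\<dots> = (\<integral>x. indicator (box a' b') x *\<^sub>R f x \<partial>lebesgue_on \<Omega>)"
        unfolding ab(1)[symmetric] by (intro Bochner_Integration.integral_cong) (auto simp: F_def indicator_def)
      also have "\<dots> = 0" by (rule box_integral_zero[OF \<Omega> f zero ab(2)])
      finally show ?thesis .
    qed
    have "integral\<^sup>L lebesgue F = (\<integral>x. indicator (box c d) x *\<^sub>R F x \<partial>lebesgue)"
      by (intro Bochner_Integration.integral_cong) (auto simp: F_def indicator_def)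
    then have "integral\<^sup>L lebesgue F = 0" using boxes by simp
    from AE_zero_if_box_integrals_zero[OF F this boxes]
    have "AE x in lebesgue. F x = 0" .
    moreover have "AE x in lebesgue. x \<notin> cbox c d - box c d"
      using negligible_frontier_interval[of c d] by (intro AE_not_in) (simp add: negligible_iff_null_sets)
    ultimately show ?thesis by eventually_elim (auto simp: F_def indicator_def split: if_splits)
  qed
  obtain \<D> where D: "countable \<D>" "\<D> \<subseteq> Pow \<Omega>" "\<And>X. X \<in> \<D> \<Longrightarrow> \<exists>a b. X = cbox a b" "\<Union>\<D> = \<Omega>"
    using open_countable_Union_open_cbox[OF \<Omega>] by metis
  have "AE x in lebesgue. \<forall>X\<in>\<D>. x \<in> X \<longrightarrow> f x = 0"
    using D onbox by (subst AE_ball_countable) (auto, metis Pow_iff subsetD)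
  then have "AE x in lebesgue. x \<in> \<Omega> \<longrightarrow> f x = 0"
    by eventually_elim (use D in auto)
  then show ?thesis by (subst AE_restrict_space_iff[OF \<Omega>L]) simp
qed


text \<open>
  By translation invariance the integral of \<open>x \<mapsto> F (x + t v)\<close> is the same for all \<open>t\<close>.  Its
  derivative at \<open>t = 0\<close>, taken under the integral, is the claimed integral.
\<close>

lemma integral_partial_derivative_zero:
  fixes F :: "'a::euclidean_space \<Rightarrow> 'b::euclidean_space"
  assumes F: "Ck 1 F" and K: "compact K" "supported_in K F" and v: "v \<in> Basis"
  shows "(\<integral>x. frechet_derivative F (at x) v \<partial>lborel) = 0"
proof -
  have F1: "Ck (Suc 0) F" using F by simp
  obtain a where a: "K \<subseteq> cbox (- a) a"
    using compact_imp_bounded[OF K(1)] bounded_subset_cbox_symmetric by blast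
  define C where "C = cbox (- a - v) (a + v)"
  have cF: "continuous_on UNIV F" using Ck_continuous[OF F] .
  have cD: "continuous_on UNIV (\<lambda>x. frechet_derivative F (at x) v)" using F v by simp
  have off: "F (x + t *\<^sub>R v) = 0" if t: "t \<in> ball 0 1" and x: "x \<notin> C" for t x
  proof -
    have "x + t *\<^sub>R v \<notin> cbox (- a) a"
    proof
      assume *: "x + t *\<^sub>R v \<in> cbox (- a) a"
      have "x \<in> C" unfolding C_def mem_box
      proof
        fix i :: 'a assume i: "i \<in> Basis"
        have "- (a \<bullet> i) \<le> x \<bullet> i + t * (v \<bullet> i)" "x \<bullet> i + t * (v \<bullet> i) \<le> a \<bullet> i"
          using * i by (auto simp: mem_box inner_add_left)
        moreover have "\<bar>t * (v \<bullet> i)\<bar> \<le> v \<bullet> i"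
          using t v i by (auto simp: inner_Basis dist_real_def)
        ultimately show "(- a - v) \<bullet> i \<le> x \<bullet> i \<and> x \<bullet> i \<le> (a + v) \<bullet> i"
          by (simp add: inner_diff_left inner_add_left) linarith
      qed
      with x show False ..
    qed
    then show ?thesis using a K(2) by (auto simp: supported_in_def)
  qed
  note [continuous_intros] = continuous_on_compose2[OF cF] continuous_on_compose2[OF cD]
  have const: "integral C (\<lambda>x. F (x + t *\<^sub>R v)) = integral\<^sup>L lborel F" if t: "t \<in> ball 0 1" for t
  proof -
    have int: "integrable lborel (\<lambda>x. F (x + t *\<^sub>R v))"
      by (rule integrable_continuous_cbox_support[of _ "- a - v" "a + v"])
         (use off[OF t] in \<open>auto simp: C_def intro!: continuous_intros\<close>)
    have [measurable]: "F \<in> borel_measurable borel" by (rule borel_measurable_continuous_onI[OF cF])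
    have "integral C (\<lambda>x. F (x + t *\<^sub>R v)) = integral UNIV (\<lambda>x. F (x + t *\<^sub>R v))"
      by (subst integral_restrict_UNIV[symmetric]) (use off[OF t] in \<open>auto intro!: arg_cong[where f = "integral UNIV"]\<close>)
    also have "\<dots> = (\<integral>x. F (t *\<^sub>R v + x) \<partial>lborel)" using integral_lborel[OF int] by (simp add: add.commute)
    also have "\<dots> = integral\<^sup>L (distr lborel borel ((+) (t *\<^sub>R v))) F" by (subst integral_distr) auto
    finally show ?thesis by (simp add: lborel_distr_plus)
  qed
  have "((\<lambda>t. integral C (\<lambda>x. F (x + t *\<^sub>R v))) has_vector_derivative
      integral C (\<lambda>x. frechet_derivative F (at (x + 0 *\<^sub>R v)) v)) (at 0 within ball (0::real) 1)"
    unfolding C_def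
  proof (rule leibniz_rule_vector_derivative)
    fix t x
    have 1: "((\<lambda>t. x + t *\<^sub>R v) has_derivative (\<lambda>h. h *\<^sub>R v)) (at t within ball 0 1)"
      by (auto intro!: derivative_eq_intros)
    interpret L: linear "frechet_derivative F (at (x + t *\<^sub>R v))"
      using Ck_has_derivative[OF F1] by (rule has_derivative_linear)
    from has_derivative_compose[OF 1 Ck_has_derivative[OF F1]]
    show "((\<lambda>t. F (x + t *\<^sub>R v)) has_vector_derivative frechet_derivative F (at (x + t *\<^sub>R v)) v) (at t within ball 0 1)"
      by (simp add: has_vector_derivative_def L.scale)
  next
    fix t show "(\<lambda>x. F (x + t *\<^sub>R v)) integrable_on cbox (- a - v) (a + v)"
      by (intro integrable_continuous continuous_intros) auto
  next
    show "continuous_on (ball 0 1 \<times> cbox (- a - v) (a + v)) (\<lambda>(t, x). frechet_derivative F (at (x + t *\<^sub>R v)) v)"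
      unfolding split_beta by (intro continuous_intros) auto
  qed auto
  moreover have "((\<lambda>t. integral C (\<lambda>x. F (x + t *\<^sub>R v))) has_vector_derivative 0) (at 0 within ball (0::real) 1)"
    by (rule has_vector_derivative_transform[where f = "\<lambda>_. integral\<^sup>L lborel F"]) (auto simp: const)
  ultimately have "integral C (\<lambda>x. frechet_derivative F (at x) v) = 0"
    by (simp add: at_within_open[of 0 "ball 0 1"] vector_derivative_unique_at)
  moreover have sub: "cbox (- a) a \<subseteq> C"
    unfolding C_def using v by (intro subset_box_imp) (auto simp: inner_diff_left inner_add_left inner_Basis)
  have "integral C (\<lambda>x. frechet_derivative F (at x) v) = integral UNIV (\<lambda>x. frechet_derivative F (at x) v)"
  proof (subst integral_restrict_UNIV[symmetric], rule arg_cong[where f = "integral UNIV"], rule ext)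
    fix x
    have "closed K" using K(1) by (rule compact_imp_closed)
    from frechet_derivative_supported[OF this K(2), of v]
    show "(if x \<in> C then frechet_derivative F (at x) v else 0) = frechet_derivative F (at x) v"
      using a sub by (auto simp: supported_in_def)
  qed
  moreover have "integrable lborel (\<lambda>x. frechet_derivative F (at x) v)"
    by (rule integrable_compact_support[OF cD K(1) frechet_derivative_supported[OF compact_imp_closed[OF K(1)] K(2)]])
  ultimately show ?thesis by (simp add: integral_lborel)
qed

definition classical_gradient :: "(real^'n \<Rightarrow> complex) \<Rightarrow> real^'n \<Rightarrow> complex^'n" where
  "classical_gradient \<phi> x = (\<chi> i. frechet_derivative \<phi> (at x) (axis i 1))"

lemma axis_Basis: "axis i (1::real) \<in> Basis"
  by (simp add: axis_in_Basis_iff)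

lemma continuous_on_classical_gradient: "Ck 1 \<phi> \<Longrightarrow> continuous_on UNIV (classical_gradient \<phi>)"
  unfolding classical_gradient_def by (auto intro!: continuous_on_vec_lambda simp: axis_Basis)

lemma classical_gradient_supported:
  "closed K \<Longrightarrow> supported_in K \<phi> \<Longrightarrow> supported_in K (classical_gradient \<phi>)"
  using frechet_derivative_supported[of K \<phi>]
  by (auto simp: supported_in_def classical_gradient_def vec_eq_iff)

text \<open>
  Integration by parts is the preceding lemma for the product of \<open>\<phi>\<close> with a test function.
\<close>

lemma has_weak_gradient_classical:
  fixes \<phi> :: "real^'n \<Rightarrow> complex"
  assumes \<phi>: "Ck 1 \<phi>" "compact K" "supported_in K \<phi>" and \<Omega>: "open \<Omega>"
  shows "has_weak_gradient \<Omega> \<phi> (classical_gradient \<phi>)"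
  unfolding has_weak_gradient_def
proof (intro conjI allI impI)
  have cl: "closed K" using \<phi>(2) by (rule compact_imp_closed)
  show sq: "square_integrable \<Omega> \<phi>"
    by (rule square_integrable_compact_support[OF Ck_continuous[OF \<phi>(1)] \<phi>(2,3) \<Omega>])
  show sqg: "square_integrable \<Omega> (classical_gradient \<phi>)"
    by (rule square_integrable_compact_support[OF continuous_on_classical_gradient[OF \<phi>(1)] \<phi>(2)
          classical_gradient_supported[OF cl \<phi>(3)] \<Omega>])
  fix \<psi> i assume \<psi>: "test_function \<Omega> \<psi>"
  have \<psi>1: "Ck 1 \<psi>" using \<psi> unfolding test_function_def by blast
  obtain K' where K': "compact K'" "K' \<subseteq> \<Omega>" "supported_in K' \<psi>" using \<psi> by (auto simp: test_function_def)
  define e :: "real^'n" where "e = axis i 1"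
  have e: "e \<in> Basis" by (simp add: e_def axis_Basis)
  define F where "F x = \<psi> x *\<^sub>R \<phi> x" for x
  have F: "Ck 1 F" unfolding F_def by (rule Ck_scaleR[OF \<psi>1 \<phi>(1)])
  have sF: "supported_in K' F" using K'(3) by (auto simp: supported_in_def F_def)
  have dF: "frechet_derivative F (at x) e = \<psi> x *\<^sub>R frechet_derivative \<phi> (at x) e + frechet_derivative \<psi> (at x) e *\<^sub>R \<phi> x" for x
  proof -
    have "(F has_derivative (\<lambda>h. \<psi> x *\<^sub>R frechet_derivative \<phi> (at x) h + frechet_derivative \<psi> (at x) h *\<^sub>R \<phi> x)) (at x)"
      unfolding F_def using \<psi>1 \<phi>(1) by (intro has_derivative_scaleR Ck_has_derivative[of 0]) auto
    then show ?thesis by (simp add: frechet_derivative_eqI)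
  qed
  have c: "continuous_on UNIV (\<lambda>x. \<psi> x *\<^sub>R frechet_derivative \<phi> (at x) e)"
      "continuous_on UNIV (\<lambda>x. frechet_derivative \<psi> (at x) e *\<^sub>R \<phi> x)"
    using \<psi>1 \<phi>(1) e Ck_continuous[OF \<psi>1] Ck_continuous[OF \<phi>(1)] by (auto intro!: continuous_intros)
  have s: "supported_in K' (\<lambda>x. \<psi> x *\<^sub>R frechet_derivative \<phi> (at x) e)"
      "supported_in K' (\<lambda>x. frechet_derivative \<psi> (at x) e *\<^sub>R \<phi> x)"
    using K'(3) frechet_derivative_supported[OF compact_imp_closed[OF K'(1)] K'(3), of e]
    by (auto simp: supported_in_def)
  have onO: "integral\<^sup>L (lebesgue_on \<Omega>) g = integral\<^sup>L lborel g" if "continuous_on UNIV g" "supported_in K' g" for g :: "real^'n \<Rightarrow> complex"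
    using that K' by (intro integral_lebesgue_on_supported \<Omega> borel_measurable_continuous_onI) (auto simp: supported_in_def)
  have "0 = (\<integral>x. frechet_derivative F (at x) e \<partial>lborel)"
    by (rule integral_partial_derivative_zero[OF F K'(1) sF e, symmetric])
  also have "\<dots> = (\<integral>x. \<psi> x *\<^sub>R frechet_derivative \<phi> (at x) e \<partial>lborel) + (\<integral>x. frechet_derivative \<psi> (at x) e *\<^sub>R \<phi> x \<partial>lborel)"
    unfolding dF by (intro Bochner_Integration.integral_add integrable_compact_support[OF _ K'(1)] c s)
  finally show "(\<integral>x. frechet_derivative \<psi> (at x) (axis i 1) *\<^sub>R \<phi> x \<partial>lebesgue_on \<Omega>) =
      - (\<integral>x. \<psi> x *\<^sub>R (classical_gradient \<phi> x $ i) \<partial>lebesgue_on \<Omega>)"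
    using onO[OF c(1) s(1)] onO[OF c(2) s(2)]
    by (simp add: classical_gradient_def e_def[symmetric] eq_neg_iff_add_eq_0 add.commute)
qed

lemma square_integrable_component:
  assumes "square_integrable \<Omega> G"
  shows "square_integrable \<Omega> (\<lambda>x. G x $ i :: complex)"
  unfolding square_integrable_def
proof
  have [measurable]: "G \<in> borel_measurable (lebesgue_on \<Omega>)" using assms by (simp add: square_integrable_def)
  show m: "(\<lambda>x. G x $ i) \<in> borel_measurable (lebesgue_on \<Omega>)"
    by (rule measurable_compose[of G _ borel "\<lambda>v. v $ i"]) (auto intro!: borel_measurable_continuous_onI continuous_intros)
  show "integrable (lebesgue_on \<Omega>) (\<lambda>x. (norm (G x $ i))\<^sup>2)"
  proof (rule Bochner_Integration.integrable_bound)
    show "integrable (lebesgue_on \<Omega>) (\<lambda>x. (norm (G x))\<^sup>2)" using assms by (simp add: square_integrable_def)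
    show "AE x in lebesgue_on \<Omega>. norm ((norm (G x $ i))\<^sup>2) \<le> norm ((norm (G x))\<^sup>2)"
      by (auto intro!: AE_I2 power_mono Finite_Cartesian_Product.norm_nth_le)
  qed (use m in measurable)
qed

lemma has_weak_gradient_diff:
  assumes \<Omega>: "open \<Omega>" and u: "has_weak_gradient \<Omega> u G" and v: "has_weak_gradient \<Omega> v H"
  shows "has_weak_gradient \<Omega> (\<lambda>x. u x - v x) (\<lambda>x. G x - H x)"
  unfolding has_weak_gradient_def
proof (intro conjI allI impI)
  have sq: "square_integrable \<Omega> u" "square_integrable \<Omega> v" "square_integrable \<Omega> G" "square_integrable \<Omega> H"
    using u v by (auto simp: has_weak_gradient_def)
  then show "square_integrable \<Omega> (\<lambda>x. u x - v x)" "square_integrable \<Omega> (\<lambda>x. G x - H x)"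
    by (auto intro: square_integrable_diff)
  fix \<psi> i assume \<psi>: "test_function \<Omega> \<psi>"
  note I = test_function_integrable[OF \<psi> \<Omega>]
  show "(\<integral>x. frechet_derivative \<psi> (at x) (axis i 1) *\<^sub>R (u x - v x) \<partial>lebesgue_on \<Omega>) =
      - (\<integral>x. \<psi> x *\<^sub>R ((G x - H x) $ i) \<partial>lebesgue_on \<Omega>)"
    using u v \<psi> I(2)[OF sq(1)] I(2)[OF sq(2)] I(1)[OF square_integrable_component[OF sq(3)]]
      I(1)[OF square_integrable_component[OF sq(4)]]
    by (simp add: scaleR_diff_right has_weak_gradient_def)
qed

lemma weak_gradient_unique:
  assumes \<Omega>: "open \<Omega>" and G: "has_weak_gradient \<Omega> u G" and H: "has_weak_gradient \<Omega> u H"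
  shows "AE x in lebesgue_on \<Omega>. G x = H x"
proof -
  have D: "has_weak_gradient \<Omega> (\<lambda>x. u x - u x) (\<lambda>x. G x - H x)"
    by (rule has_weak_gradient_diff[OF \<Omega> G H])
  have "AE x in lebesgue_on \<Omega>. (G x - H x) $ i = 0" for i
    by (rule fundamental_lemma[OF \<Omega> square_integrable_component])
       (use D in \<open>auto simp: has_weak_gradient_def\<close>)
  then have "AE x in lebesgue_on \<Omega>. \<forall>i. (G x - H x) $ i = 0"
    by (simp add: AE_all_countable)
  then show ?thesis by eventually_elim (simp add: vec_eq_iff)
qed

lemma weak_grad_eq_AE:
  assumes \<Omega>: "open \<Omega>" and G: "has_weak_gradient \<Omega> u G"
  shows "AE x in lebesgue_on \<Omega>. weak_grad \<Omega> u x = G x"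
proof -
  have "has_weak_gradient \<Omega> u (weak_grad \<Omega> u)"
    unfolding weak_grad_def by (rule someI[where P = "has_weak_gradient \<Omega> u", OF G])
  from weak_gradient_unique[OF \<Omega> this G] show ?thesis .
qed

text \<open>
  \<^const>\<open>weak_grad\<close> selects one weak gradient; as weak gradients agree almost everywhere, any of
  them computes the norm and the energy.
\<close>

lemma H1_norm_sq:
  assumes \<Omega>: "open \<Omega>" and G: "has_weak_gradient \<Omega> u G"
  shows "(H1_norm \<Omega> u)\<^sup>2 = (\<integral>x. (norm (G x))\<^sup>2 \<partial>lebesgue_on \<Omega>) + (\<integral>x. (norm (u x))\<^sup>2 \<partial>lebesgue_on \<Omega>)"
    and "energy k \<Omega> u = (\<integral>x. (norm (G x))\<^sup>2 \<partial>lebesgue_on \<Omega>) - k\<^sup>2 * (\<integral>x. (norm (u x))\<^sup>2 \<partial>lebesgue_on \<Omega>)"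
proof -
  have "has_weak_gradient \<Omega> u (weak_grad \<Omega> u)"
    unfolding weak_grad_def by (rule someI[where P = "has_weak_gradient \<Omega> u", OF G])
  then have [measurable]: "weak_grad \<Omega> u \<in> borel_measurable (lebesgue_on \<Omega>)" "u \<in> borel_measurable (lebesgue_on \<Omega>)"
    by (auto simp: has_weak_gradient_def square_integrable_def)
  have [measurable]: "G \<in> borel_measurable (lebesgue_on \<Omega>)"
    using G by (auto simp: has_weak_gradient_def square_integrable_def)
  have int: "integrable (lebesgue_on \<Omega>) (\<lambda>x. (norm (G x))\<^sup>2)" "integrable (lebesgue_on \<Omega>) (\<lambda>x. (norm (u x))\<^sup>2)"
    using G by (auto simp: has_weak_gradient_def square_integrable_def)
  note ae = weak_grad_eq_AE[OF \<Omega> G]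
  have "(\<integral>x. (norm (weak_grad \<Omega> u x))\<^sup>2 + (norm (u x))\<^sup>2 \<partial>lebesgue_on \<Omega>)
      = (\<integral>x. (norm (G x))\<^sup>2 + (norm (u x))\<^sup>2 \<partial>lebesgue_on \<Omega>)"
    by (rule integral_cong_AE) (measurable, use ae in eventually_elim, simp)
  then show "(H1_norm \<Omega> u)\<^sup>2 = (\<integral>x. (norm (G x))\<^sup>2 \<partial>lebesgue_on \<Omega>) + (\<integral>x. (norm (u x))\<^sup>2 \<partial>lebesgue_on \<Omega>)"
    using int by (simp add: H1_norm_def)
  have "energy k \<Omega> u = (\<integral>x. (norm (G x))\<^sup>2 - k\<^sup>2 * (norm (u x))\<^sup>2 \<partial>lebesgue_on \<Omega>)"
    unfolding energy_def by (rule integral_cong_AE) (measurable, use ae in eventually_elim, simp)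
  then show "energy k \<Omega> u = (\<integral>x. (norm (G x))\<^sup>2 \<partial>lebesgue_on \<Omega>) - k\<^sup>2 * (\<integral>x. (norm (u x))\<^sup>2 \<partial>lebesgue_on \<Omega>)"
    using int by simp
qed

section \<open>The Hausdorff measure\<close>

definition gauge_vol :: "nat \<Rightarrow> 'a::euclidean_space set \<Rightarrow> ennreal" where
  "gauge_vol m U = ennreal (unit_ball_vol (real m) * (diameter U / 2) ^ m)"

text \<open>
  The Hausdorff outer measure is the supremum of these contents over all \<open>\<delta> > 0\<close>.
\<close>

definition hausdorff_content :: "nat \<Rightarrow> real \<Rightarrow> 'a::euclidean_space set \<Rightarrow> ennreal" where
  "hausdorff_content m \<delta> A =
     (INF U\<in>{U :: nat \<Rightarrow> 'a set. A \<subseteq> (\<Union>i. U i) \<and> (\<forall>i. bounded (U i) \<and> diameter (U i) \<le> \<delta>)}.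
        (\<Sum>i. gauge_vol m (U i)))"

lemma hausdorff_outer_eq_SUP_content:
  "hausdorff_outer m A = (SUP \<delta>\<in>{0<..}. hausdorff_content m \<delta> A)"
  unfolding hausdorff_outer_def hausdorff_content_def gauge_vol_def ..

lemma gauge_vol_empty [simp]: "m \<ge> 1 \<Longrightarrow> gauge_vol m {} = 0"
  by (simp add: gauge_vol_def)

lemma hausdorff_content_le_outer: "\<delta> > 0 \<Longrightarrow> hausdorff_content m \<delta> A \<le> hausdorff_outer m A"
  unfolding hausdorff_outer_eq_SUP_content by (rule SUP_upper) simp

lemma hausdorff_outer_least:
  "(\<And>\<delta>. \<delta> > 0 \<Longrightarrow> hausdorff_content m \<delta> A \<le> c) \<Longrightarrow> hausdorff_outer m A \<le> c"
  unfolding hausdorff_outer_eq_SUP_content by (rule SUP_least) simp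

lemma hausdorff_content_le:
  assumes "A \<subseteq> (\<Union>i. U i)" "\<And>i. bounded (U i)" "\<And>i. diameter (U i) \<le> \<delta>"
  shows "hausdorff_content m \<delta> A \<le> (\<Sum>i. gauge_vol m (U i))"
  unfolding hausdorff_content_def using assms by (intro INF_lower) auto

lemma hausdorff_content_greatest:
  assumes "\<And>U. A \<subseteq> (\<Union>i. U i) \<Longrightarrow> (\<And>i. bounded (U i)) \<Longrightarrow> (\<And>i. diameter (U i) \<le> \<delta>) \<Longrightarrow>
    c \<le> (\<Sum>i. gauge_vol m (U i))"
  shows "c \<le> hausdorff_content m \<delta> A"
  unfolding hausdorff_content_def using assms by (intro INF_greatest) auto

lemma hausdorff_content_mono: "A \<subseteq> B \<Longrightarrow> hausdorff_content m \<delta> A \<le> hausdorff_content m \<delta> B"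
  by (rule hausdorff_content_greatest) (intro hausdorff_content_le, auto)

lemma hausdorff_content_antimono:
  "\<delta> \<le> \<delta>' \<Longrightarrow> hausdorff_content m \<delta>' A \<le> hausdorff_content m \<delta> A"
  by (rule hausdorff_content_greatest) (intro hausdorff_content_le, auto intro: order_trans)

lemma hausdorff_content_close:
  assumes "hausdorff_content m \<delta> A < e"
  obtains U where "A \<subseteq> (\<Union>i. U i)" "\<And>i. bounded (U i)" "\<And>i. diameter (U i) \<le> \<delta>"
    "(\<Sum>i. gauge_vol m (U i)) < e"
  using assms unfolding hausdorff_content_def INF_less_iff by auto

lemma hausdorff_content_UN_le:
  "hausdorff_content m \<delta> (\<Union>i. A i) \<le> (\<Sum>i::nat. hausdorff_content m \<delta> (A i))"
proof (rule ennreal_le_epsilon)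
  fix e :: real assume e: "0 < e" and fin: "(\<Sum>n. hausdorff_content m \<delta> (A n)) < top"
  have lt: "hausdorff_content m \<delta> (A n) < hausdorff_content m \<delta> (A n) + e * (1/2)^Suc n" for n
    using e fin by (auto simp add: less_top dest!: ennreal_suminf_lessD)
  have "\<forall>n. \<exists>U. A n \<subseteq> (\<Union>i. U i) \<and> (\<forall>i. bounded (U i)) \<and> (\<forall>i. diameter (U i) \<le> \<delta>) \<and>
      (\<Sum>i. gauge_vol m (U i)) < hausdorff_content m \<delta> (A n) + e * (1/2)^Suc n"
    using hausdorff_content_close[OF lt] by metis
  then obtain B where B: "\<And>n. A n \<subseteq> (\<Union>i. B n i)" "\<And>n i. bounded (B n i)"
      "\<And>n i. diameter (B n i) \<le> \<delta>"
      "\<And>n. (\<Sum>i. gauge_vol m (B n i)) < hausdorff_content m \<delta> (A n) + e * (1/2)^Suc n"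
    by metis
  define C where "C = case_prod B o prod_decode"
  have AC: "(\<Union>i. A i) \<subseteq> (\<Union>i. C i)"
    using B(1) by (auto simp add: C_def subset_eq) (metis prod.case prod_encode_inverse)
  have "hausdorff_content m \<delta> (\<Union>i. A i) \<le> (\<Sum>i. gauge_vol m (C i))"
    using B AC by (intro hausdorff_content_le) (auto simp: C_def split_def)
  also have "\<dots> = (\<Sum>n. \<Sum>i. gauge_vol m (B n i))"
    unfolding C_def comp_def
    using suminf_ennreal_2dimen[where f="\<lambda>(n, i). gauge_vol m (B n i)"
        and g="\<lambda>n. \<Sum>i. gauge_vol m (B n i)"] by (simp add: split_def)
  also have "\<dots> \<le> (\<Sum>n. hausdorff_content m \<delta> (A n) + e * (1/2) ^ Suc n)"
    using B(4) by (intro suminf_le) (auto intro: less_imp_le)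
  also have "... = (\<Sum>n. hausdorff_content m \<delta> (A n)) + (\<Sum>n. ennreal e * ennreal ((1/2) ^ Suc n))"
    using \<open>0 < e\<close> by (subst suminf_add[symmetric])
                     (auto simp del: ennreal_suminf_cmult simp add: ennreal_mult[symmetric])
  also have "\<dots> = (\<Sum>n. hausdorff_content m \<delta> (A n)) + e"
    unfolding ennreal_suminf_cmult
    by (subst suminf_ennreal_eq[OF zero_le_power power_half_series]) auto
  finally show "hausdorff_content m \<delta> (\<Union>i. A i) \<le> (\<Sum>n. hausdorff_content m \<delta> (A n)) + e" .
qed

lemma hausdorff_outer_mono: "A \<subseteq> B \<Longrightarrow> hausdorff_outer m A \<le> hausdorff_outer m B"
  by (rule hausdorff_outer_least)
     (meson hausdorff_content_mono hausdorff_content_le_outer order_trans)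

lemma hausdorff_outer_empty [simp]:
  assumes "m \<ge> 1" shows "hausdorff_outer m {} = 0"
proof -
  have "hausdorff_outer m ({} :: 'a set) \<le> 0"
  proof (rule hausdorff_outer_least)
    fix \<delta> :: real assume "\<delta> > 0"
    then have "hausdorff_content m \<delta> ({} :: 'a set) \<le> (\<Sum>i::nat. gauge_vol m ({}::'a set))"
      by (intro hausdorff_content_le) auto
    then show "hausdorff_content m \<delta> ({} :: 'a set) \<le> 0" using assms by simp
  qed
  then show ?thesis by simp
qed

lemma hausdorff_outer_UN_le: "hausdorff_outer m (\<Union>i. A i) \<le> (\<Sum>i::nat. hausdorff_outer m (A i))"
proof (rule hausdorff_outer_least)
  fix \<delta> :: real assume "\<delta> > 0"
  then show "hausdorff_content m \<delta> (\<Union>i. A i) \<le> (\<Sum>i::nat. hausdorff_outer m (A i))"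
    by (intro order_trans[OF hausdorff_content_UN_le] suminf_le hausdorff_content_le_outer) auto
qed

lemma outer_measure_space_hausdorff:
  "m \<ge> 1 \<Longrightarrow> outer_measure_space UNIV (hausdorff_outer m)"
  by (auto simp: outer_measure_space_def positive_def increasing_def countably_subadditive_def
      hausdorff_outer_mono hausdorff_outer_UN_le)

lemma hausdorff_outer_Un_le:
  assumes "m \<ge> 1" shows "hausdorff_outer m (A \<union> B) \<le> hausdorff_outer m A + hausdorff_outer m B"
proof -
  have "hausdorff_outer m (A \<union> B) \<le> (\<Sum>i::nat. hausdorff_outer m (if i = 0 then A else if i = 1 then B else {}))"
    by (rule order_trans[OF hausdorff_outer_mono hausdorff_outer_UN_le]) (auto split: if_splits)
  also have "\<dots> = (\<Sum>i\<in>{0,1::nat}. hausdorff_outer m (if i = 0 then A else if i = 1 then B else {}))"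
    using assms by (intro suminf_finite) auto
  finally show ?thesis by simp
qed

text \<open>
  A covering set of diameter at most \<open>\<delta>\<close> cannot meet both \<open>A\<close> and \<open>B\<close>, so a cover of the union
  splits into a cover of \<open>A\<close> and a cover of \<open>B\<close>.
\<close>

lemma hausdorff_content_Un_separated:
  assumes m: "m \<ge> 1" and sep: "\<And>x y. x \<in> A \<Longrightarrow> y \<in> B \<Longrightarrow> \<delta> < dist x y"
  shows "hausdorff_content m \<delta> A + hausdorff_content m \<delta> B \<le> hausdorff_content m \<delta> (A \<union> B)"
proof (rule hausdorff_content_greatest)
  fix U :: "nat \<Rightarrow> 'a set"
  assume U: "A \<union> B \<subseteq> (\<Union>i. U i)" "\<And>i. bounded (U i)" "\<And>i. diameter (U i) \<le> \<delta>"
  define V where "V i = (if U i \<inter> A = {} then {} else U i)" for i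
  define W where "W i = (if U i \<inter> A = {} then U i else {})" for i
  have \<delta>0: "0 \<le> \<delta>" using U(2,3)[of 0] diameter_ge_0 order_trans by blast
  have "hausdorff_content m \<delta> A \<le> (\<Sum>i. gauge_vol m (V i))"
  proof (rule hausdorff_content_le)
    show "A \<subseteq> (\<Union>i. V i)" using U(1) by (fastforce simp: V_def)
  qed (use U \<delta>0 in \<open>auto simp: V_def\<close>)
  moreover have "hausdorff_content m \<delta> B \<le> (\<Sum>i. gauge_vol m (W i))"
  proof (rule hausdorff_content_le)
    show "B \<subseteq> (\<Union>i. W i)"
    proof
      fix y assume y: "y \<in> B"
      then obtain i where i: "y \<in> U i" using U(1) by auto
      have "U i \<inter> A = {}"
      proof (rule ccontr)
        assume "U i \<inter> A \<noteq> {}"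
        then obtain x where x: "x \<in> U i" "x \<in> A" by auto
        have "dist x y \<le> diameter (U i)" using x i U(2) by (intro diameter_bounded_bound)
        then show False using sep[OF x(2) y] U(3)[of i] by simp
      qed
      then show "y \<in> (\<Union>i. W i)" using i by (auto simp: W_def)
    qed
  qed (use U \<delta>0 in \<open>auto simp: W_def\<close>)
  moreover have "(\<Sum>i. gauge_vol m (U i)) = (\<Sum>i. gauge_vol m (V i) + gauge_vol m (W i))"
    using m by (intro suminf_cong) (auto simp: V_def W_def)
  ultimately show "hausdorff_content m \<delta> A + hausdorff_content m \<delta> B \<le> (\<Sum>i. gauge_vol m (U i))"
    by (simp add: suminf_add[symmetric] add_mono)
qed

text \<open>
  Additivity on separated sets is what makes the outer measure metric, and so all Borel sets
  measurable.
\<close>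

lemma hausdorff_outer_Un_separated:
  assumes m: "m \<ge> 1" and e: "e > 0" and sep: "\<And>x y. x \<in> A \<Longrightarrow> y \<in> B \<Longrightarrow> e \<le> dist x y"
  shows "hausdorff_outer m A + hausdorff_outer m B \<le> hausdorff_outer m (A \<union> B)"
proof -
  have 1: "hausdorff_content m \<delta>1 A + hausdorff_content m \<delta>2 B \<le> hausdorff_outer m (A \<union> B)"
    if d: "\<delta>1 > 0" "\<delta>2 > 0" for \<delta>1 \<delta>2
  proof -
    define \<delta> where "\<delta> = min (e/2) (min \<delta>1 \<delta>2)"
    have "\<delta> > 0" "\<delta> < e" using d e by (auto simp: \<delta>_def)
    have "hausdorff_content m \<delta>1 A + hausdorff_content m \<delta>2 B
      \<le> hausdorff_content m \<delta> A + hausdorff_content m \<delta> B"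
      by (intro add_mono hausdorff_content_antimono) (auto simp: \<delta>_def)
    also have "\<dots> \<le> hausdorff_content m \<delta> (A \<union> B)"
      using sep \<open>\<delta> < e\<close> by (intro hausdorff_content_Un_separated m) force
    also have "\<dots> \<le> hausdorff_outer m (A \<union> B)"
      by (rule hausdorff_content_le_outer) fact
    finally show ?thesis .
  qed
  have ne: "{0::real<..} \<noteq> {}" using greaterThan_non_empty by blast
  have 2: "hausdorff_outer m A + hausdorff_content m \<delta>2 B \<le> hausdorff_outer m (A \<union> B)"
    if "\<delta>2 > 0" for \<delta>2
    unfolding hausdorff_outer_eq_SUP_content[of m A] ennreal_SUP_add_left[OF ne, symmetric]
    using 1 that by (intro SUP_least) auto
  show ?thesis
    unfolding hausdorff_outer_eq_SUP_content[of m B] add.commute[of "hausdorff_outer m A"]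
      ennreal_SUP_add_left[OF ne, symmetric]
    using 2 by (intro SUP_least) (auto simp: add.commute)
qed

lemma hausdorff_outer_sum_separated:
  fixes N :: nat
  assumes m: "m \<ge> 1"
    and sep: "\<And>k. k < N \<Longrightarrow> \<exists>e>0. \<forall>j<k. \<forall>x\<in>R j. \<forall>y\<in>R k. e \<le> dist x y"
  shows "(\<Sum>k<N. hausdorff_outer m (R k)) \<le> hausdorff_outer m (\<Union>k<N. R k)"
  using sep
proof (induction N)
  case (Suc N)
  obtain e where e: "e > 0" "\<And>j x y. j < N \<Longrightarrow> x \<in> R j \<Longrightarrow> y \<in> R N \<Longrightarrow> e \<le> dist x y"
    using Suc.prems[of N] by blast
  have "(\<Sum>k<Suc N. hausdorff_outer m (R k)) \<le> hausdorff_outer m (\<Union>k<N. R k) + hausdorff_outer m (R N)"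
    using Suc by (auto intro!: add_mono)
  also have "\<dots> \<le> hausdorff_outer m ((\<Union>k<N. R k) \<union> R N)"
    using e by (intro hausdorff_outer_Un_separated m) auto
  also have "(\<Union>k<N. R k) \<union> R N = (\<Union>k<Suc N. R k)" by (auto simp: less_Suc_eq)
  finally show ?case .
qed simp

text \<open>
  The part \<open>D n\<close> of \<open>X\<close> at distance at least \<open>1/(n+1)\<close> from \<open>C\<close> is separated from \<open>C\<close>, so the outer
  measure is additive on \<open>X \<inter> C\<close> and \<open>D n\<close>.  What \<open>D n\<close> misses of \<open>X - C\<close> is covered by
  the layers \<open>R k\<close> with \<open>k \<ge> n\<close>.  Two layers that are not neighbours are separated; splitting the layers
  by the parity of their index bounds the sum of all their measures by twice the measure of \<open>X\<close>.  This sum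
  converges, so its tails tend to 0.
\<close>

lemma closed_caratheodory:
  fixes C :: "'a::euclidean_space set"
  assumes m: "m \<ge> 1" and C: "closed C" "C \<noteq> {}"
  shows "hausdorff_outer m (X \<inter> C) + hausdorff_outer m (X - C) \<le> hausdorff_outer m X"
proof (cases "hausdorff_outer m X < top")
  case False
  then show ?thesis by (simp add: less_top[symmetric] not_less top_unique)
next
  case True
  define D where "D n = {x\<in>X. infdist x C \<ge> 1 / (real n + 1)}" for n
  define R where "R k = {x\<in>X. 1 / (real k + 2) \<le> infdist x C \<and> infdist x C < 1 / (real k + 1)}" for k
  have near: "infdist y C \<le> infdist x C + dist x y" for x y
    using infdist_triangle[of y C x] by (simp add: dist_commute)
  have R_sep: "\<exists>e>0. \<forall>j. j + 2 \<le> k \<longrightarrow> (\<forall>x\<in>R j. \<forall>y\<in>R k. e \<le> dist x y)" for k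
  proof (intro exI conjI allI impI ballI)
    show "(if k = 0 then 1 else 1 / real k - 1 / (real k + 1)) > 0" by (auto simp: field_simps intro!: add_pos_nonneg)
    fix j x y assume a: "j + 2 \<le> k" "x \<in> R j" "y \<in> R k"
    have "1 / real k \<le> 1 / (real j + 2)" using a(1) by (intro divide_left_mono) auto
    also have "\<dots> \<le> infdist x C" using a by (auto simp: R_def)
    also have "\<dots> \<le> infdist y C + dist x y" using near[of x y] by (simp add: dist_commute)
    also have "\<dots> \<le> 1 / (real k + 1) + dist x y" using a by (auto simp: R_def)
    finally show "(if k = 0 then 1 else 1 / real k - 1 / (real k + 1)) \<le> dist x y" using a by simp
  qed
  have half: "(\<Sum>k<N. hausdorff_outer m (R (2*k+i))) \<le> hausdorff_outer m X" for N i
  proof -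
    have "(\<Sum>k<N. hausdorff_outer m (R (2*k+i))) \<le> hausdorff_outer m (\<Union>k<N. R (2*k+i))"
    proof (intro hausdorff_outer_sum_separated m)
      fix k
      obtain e where e: "e > 0" "\<And>j x y. j + 2 \<le> 2*k+i \<Longrightarrow> x\<in>R j \<Longrightarrow> y\<in>R (2*k+i) \<Longrightarrow> e \<le> dist x y"
        using R_sep[of "2*k+i"] by blast
      show "\<exists>e>0. \<forall>j<k. \<forall>x\<in>R (2 * j + i). \<forall>y\<in>R (2 * k + i). e \<le> dist x y"
      proof (intro exI[of _ e] conjI allI impI ballI e(1))
        fix j x y assume "j < k" "x \<in> R (2 * j + i)" "y \<in> R (2 * k + i)"
        then show "e \<le> dist x y" by (intro e(2)[of "2 * j + i"]) auto
      qed
    qed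
    also have "\<dots> \<le> hausdorff_outer m X" by (intro hausdorff_outer_mono) (auto simp: R_def)
    finally show ?thesis .
  qed
  have sum_le: "(\<Sum>k<N. hausdorff_outer m (R k)) \<le> 2 * hausdorff_outer m X" for N
  proof -
    have "(\<Sum>k<N. hausdorff_outer m (R k)) \<le> (\<Sum>k<2*N. hausdorff_outer m (R k))"
      by (intro sum_mono2) auto
    also have "\<dots> = (\<Sum>k<N. hausdorff_outer m (R (2*k+0))) + (\<Sum>k<N. hausdorff_outer m (R (2*k+1)))"
      by (induction N) (auto simp: algebra_simps)
    also have "\<dots> \<le> hausdorff_outer m X + hausdorff_outer m X"
      by (intro add_mono half)
    finally show ?thesis by (simp add: mult_2)
  qed
  have tot: "(\<Sum>k. hausdorff_outer m (R k)) \<le> 2 * hausdorff_outer m X"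
    using sum_le by (intro suminf_le_const summableI)
  have tot': "(\<Sum>k. hausdorff_outer m (R k)) < top"
    using True by (intro le_less_trans[OF tot]) (auto simp: ennreal_mult_less_top)
  define r where "r k = enn2real (hausdorff_outer m (R k))" for k
  have r: "hausdorff_outer m (R k) = ennreal (r k)" for k
    unfolding r_def using ennreal_suminf_lessD[OF tot', of k] by simp
  have r0: "r k \<ge> 0" for k by (simp add: r_def)
  have sumr: "summable r"
    using tot' r0 unfolding r by (intro summable_suminf_not_top) auto
  have split: "X - C \<subseteq> D n \<union> (\<Union>k. R (k + n))" for n
  proof
    fix x assume x: "x \<in> X - C"
    have "infdist x C > 0" using x C infdist_pos_not_in_closed by auto
    show "x \<in> D n \<union> (\<Union>k. R (k + n))"
    proof (cases "x \<in> D n")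
      case False
      then have lt: "infdist x C < 1 / (real n + 1)" using x by (auto simp: D_def)
      define P where "P k \<longleftrightarrow> 1 / (real k + 2) \<le> infdist x C" for k
      obtain k0 where k0: "inverse (real (Suc k0)) < infdist x C"
        using reals_Archimedean \<open>infdist x C > 0\<close> by blast
      have "P k0" unfolding P_def
        by (rule order_trans[OF _ less_imp_le[OF k0]]) (auto simp: field_simps)
      define k where "k = (LEAST k. P k)"
      have Pk: "P k" using \<open>P k0\<close> unfolding k_def by (rule LeastI)
      have kn: "n \<le> k"
      proof (rule ccontr)
        assume "\<not> n \<le> k"
        then have "1 / (real n + 1) \<le> 1 / (real k + 2)" by (intro divide_left_mono) auto
        then show False using Pk lt by (simp add: P_def)
      qed
      have up: "infdist x C < 1 / (real k + 1)"
      proof (cases "k = n")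
        case False
        then have "k > 0" using kn by simp
        then have "\<not> P (k - 1)" using not_less_Least[of "k - 1" P] by (simp add: k_def)
        then show ?thesis using \<open>k > 0\<close> by (simp add: P_def of_nat_diff add.commute)
      qed (use lt in simp)
      have "x \<in> R ((k - n) + n)" using Pk up x kn by (simp add: R_def P_def)
      then show ?thesis by blast
    qed simp
  qed
  show ?thesis
  proof (rule ennreal_le_epsilon)
    fix e :: real assume e: "0 < e"
    \<comment> \<open>Choose \<open>n\<close> so large that the layers beyond \<open>D n\<close> have small total measure.\<close>
    obtain n where n: "norm (\<Sum>i. r (i + n)) < e"
      using suminf_exist_split[OF e sumr] by auto
    have "hausdorff_outer m (X - C) \<le> hausdorff_outer m (D n) + hausdorff_outer m (\<Union>k. R (k + n))"
      by (rule order_trans[OF hausdorff_outer_mono[OF split] hausdorff_outer_Un_le[OF m]])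
    also have "hausdorff_outer m (\<Union>k. R (k + n)) \<le> (\<Sum>k. hausdorff_outer m (R (k + n)))"
      by (rule hausdorff_outer_UN_le)
    also have "\<dots> = ennreal (\<Sum>k. r (k + n))"
      unfolding r using r0 sumr summable_iff_shift[of r n] by (intro suminf_ennreal2) auto
    also have "\<dots> \<le> ennreal e" using n by (intro ennreal_leI) simp
    finally have A: "hausdorff_outer m (X - C) \<le> hausdorff_outer m (D n) + ennreal e"
      by (simp add: add_left_mono)
    have "hausdorff_outer m (X \<inter> C) + hausdorff_outer m (D n) \<le> hausdorff_outer m (X \<inter> C \<union> D n)"
    proof (intro hausdorff_outer_Un_separated[where e = "1 / (real n + 1)"] m)
      fix x y assume xy: "x \<in> X \<inter> C" "y \<in> D n"
      have "1 / (real n + 1) \<le> infdist y C" using xy by (simp add: D_def)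
      also have "\<dots> \<le> dist y x" using xy by (intro infdist_le) auto
      finally show "1 / (real n + 1) \<le> dist x y" by (simp add: dist_commute)
    qed auto
    also have "\<dots> \<le> hausdorff_outer m X" by (intro hausdorff_outer_mono) (auto simp: D_def)
    finally have B: "hausdorff_outer m (X \<inter> C) + hausdorff_outer m (D n) \<le> hausdorff_outer m X" .
    have "hausdorff_outer m (X \<inter> C) + hausdorff_outer m (X - C)
        \<le> hausdorff_outer m (X \<inter> C) + hausdorff_outer m (D n) + ennreal e"
      using add_left_mono[OF A, of "hausdorff_outer m (X \<inter> C)"] by (simp add: add.assoc)
    also have "\<dots> \<le> hausdorff_outer m X + ennreal e" using B by (intro add_right_mono)
    finally show "hausdorff_outer m (X \<inter> C) + hausdorff_outer m (X - C) \<le> hausdorff_outer m X + e" .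
  qed
qed

lemma measure_space_hausdorff:
  assumes m: "m \<ge> 1"
  shows "measure_space UNIV (sets (borel :: 'a::euclidean_space measure)) (hausdorff_outer m)"
proof -
  define L where "L = lambda_system UNIV UNIV (hausdorff_outer m :: 'a set \<Rightarrow> ennreal)"
  interpret P: sigma_algebra "UNIV :: 'a set" "UNIV :: 'a set set"
    using sigma_algebra_Pow[of "UNIV :: 'a set"] by simp
  have ms: "measure_space UNIV L (hausdorff_outer m)"
    unfolding L_def by (rule P.caratheodory_lemma[OF outer_measure_space_hausdorff[OF m]])
  then interpret L: sigma_algebra UNIV L by (simp add: measure_space_def)
  have cl: "C \<in> L" if C: "closed C" for C :: "'a set"
  proof (cases "C = {}")
    case False
    have "hausdorff_outer m (X \<inter> C) + hausdorff_outer m (X - C) = hausdorff_outer m X" for X :: "'a set"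
    proof (rule antisym[OF closed_caratheodory[OF m C False]])
      have "X = (X \<inter> C) \<union> (X - C)" by auto
      then show "hausdorff_outer m X \<le> hausdorff_outer m (X \<inter> C) + hausdorff_outer m (X - C)"
        using hausdorff_outer_Un_le[OF m, of "X \<inter> C" "X - C"] by simp
    qed
    then show ?thesis by (simp add: L_def P.lambda_system_eq)
  qed simp
  have sub: "sets (borel :: 'a measure) \<subseteq> L"
    unfolding borel_eq_closed sets_measure_of[OF subset_UNIV[of "Collect closed", folded Pow_UNIV]]
    by (rule L.sigma_sets_subset) (auto simp: cl)
  show ?thesis
    using ms sub sets.sigma_algebra_axioms[of "borel :: 'a measure"]
    unfolding measure_space_def positive_def countably_additive_def
    by (auto simp: subset_iff image_subset_iff)
qed

lemma sets_hausdorff_measure [simp, measurable_cong]: "sets (hausdorff_measure m) = sets borel"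
  unfolding hausdorff_measure_def using sigma_algebra.sets_measure_of_eq[OF sets.sigma_algebra_axioms[of borel]] by simp

lemma space_hausdorff_measure [simp]: "space (hausdorff_measure m) = UNIV"
  using sets_eq_imp_space_eq[OF sets_hausdorff_measure] by simp

text \<open>
  \<^const>\<open>measure_of\<close> returns the null measure unless its argument is a measure, so this rests on
  the additivity just proved.
\<close>

lemma emeasure_hausdorff_measure:
  assumes "m \<ge> 1" "A \<in> sets borel"
  shows "emeasure (hausdorff_measure m) A = hausdorff_outer m A"
  using measure_space_hausdorff[OF assms(1)] assms(2)
  by (intro emeasure_measure_of[OF hausdorff_measure_def]) (auto simp: measure_space_def)

lemma hausdorff_content_le_finite:
  assumes m: "m \<ge> 1" and I: "finite I" and A: "A \<subseteq> (\<Union>i\<in>I. V i)"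
    and V: "\<And>i. i \<in> I \<Longrightarrow> bounded (V i)" "\<And>i. i \<in> I \<Longrightarrow> diameter (V i) \<le> \<delta>" and \<delta>: "\<delta> \<ge> 0"
  shows "hausdorff_content m \<delta> A \<le> (\<Sum>i\<in>I. gauge_vol m (V i))"
proof -
  obtain h where h: "bij_betw h {0..<card I} I" using ex_bij_betw_nat_finite[OF I] by blast
  define U where "U n = (if n < card I then V (h n) else {})" for n
  have hI: "h n \<in> I" if "n < card I" for n using h that by (auto simp: bij_betw_def)
  have "hausdorff_content m \<delta> A \<le> (\<Sum>n. gauge_vol m (U n))"
  proof (rule hausdorff_content_le)
    show "A \<subseteq> (\<Union>n. U n)"
    proof
      fix x assume "x \<in> A"
      then obtain i where i: "i \<in> I" "x \<in> V i" using A by auto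
      then obtain n where "n < card I" "h n = i" using h by (force simp: bij_betw_def)
      then show "x \<in> (\<Union>n. U n)" using i by (auto simp: U_def)
    qed
  qed (use V \<delta> hI in \<open>auto simp: U_def\<close>)
  also have "\<dots> = (\<Sum>n\<in>{0..<card I}. gauge_vol m (U n))"
    using m by (intro suminf_finite) (auto simp: U_def)
  also have "\<dots> = (\<Sum>n\<in>{0..<card I}. gauge_vol m (V (h n)))" by (intro sum.cong) (auto simp: U_def)
  also have "\<dots> = (\<Sum>i\<in>I. gauge_vol m (V i))" by (rule sum.reindex_bij_betw[OF h])
  finally show ?thesis .
qed

text \<open>
  If \<open>f\<close> does not decrease distances, the preimage of a covering set \<open>U\<close> lies in a ball of radius
  \<open>diameter U\<close>, whose volume is \<open>2\<^sup>m\<close> times the volume that the Hausdorff measure assigns to \<open>U\<close>.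
\<close>

lemma lborel_le_hausdorff_outer:
  fixes f :: "'b::euclidean_space \<Rightarrow> 'a::euclidean_space"
  assumes exp: "\<And>x y. dist x y \<le> dist (f x) (f y)" and D: "D \<in> sets borel" "f ` D \<subseteq> B"
  shows "emeasure lborel D \<le> 2 ^ DIM('b) * hausdorff_outer DIM('b) B"
proof -
  have key: "emeasure lborel D \<le> 2 ^ DIM('b) * (\<Sum>i. gauge_vol DIM('b) (U i))"
    if U: "B \<subseteq> (\<Union>i. U i)" "\<And>i. bounded (U i)" for U :: "nat \<Rightarrow> 'a set"
  proof -
    define y where "y i = (SOME y. f y \<in> U i)" for i
    have sub: "D \<subseteq> (\<Union>i. cball (y i) (diameter (U i)))"
    proof
      fix x assume x: "x \<in> D"
      then obtain i where i: "f x \<in> U i" using U(1) D by blast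
      then have "f (y i) \<in> U i" unfolding y_def by (rule someI)
      then have "dist (y i) x \<le> diameter (U i)"
        using exp[of "y i" x] diameter_bounded_bound[OF U(2) _ i] order_trans by blast
      then show "x \<in> (\<Union>i. cball (y i) (diameter (U i)))" by auto
    qed
    have "emeasure lborel D \<le> emeasure lborel (\<Union>i. cball (y i) (diameter (U i)))"
      using sub by (intro emeasure_mono) auto
    also have "\<dots> \<le> (\<Sum>i. emeasure lborel (cball (y i) (diameter (U i))))"
      by (intro emeasure_subadditive_countably) auto
    also have "\<dots> = (\<Sum>i. 2 ^ DIM('b) * gauge_vol DIM('b) (U i))"
    proof (intro suminf_cong)
      fix i
      have "2 ^ DIM('b) = ennreal (2 ^ DIM('b))" by (simp add: ennreal_power[symmetric])
      then show "emeasure lborel (cball (y i) (diameter (U i))) = 2 ^ DIM('b) * gauge_vol DIM('b) (U i)"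
        using diameter_ge_0[OF U(2)]
        by (simp add: emeasure_cball gauge_vol_def ennreal_mult[symmetric] power_divide)
    qed
    finally show ?thesis by simp
  qed
  have "emeasure lborel D / 2 ^ DIM('b) \<le> hausdorff_content DIM('b) 1 B"
  proof (rule hausdorff_content_greatest)
    fix U :: "nat \<Rightarrow> 'a set"
    assume U: "B \<subseteq> (\<Union>i. U i)" "\<And>i. bounded (U i)"
    have "emeasure lborel D / 2 ^ DIM('b) \<le> 2 ^ DIM('b) * (\<Sum>i. gauge_vol DIM('b) (U i)) / 2 ^ DIM('b)"
      by (intro divide_right_mono_ennreal key U)
    then show "emeasure lborel D / 2 ^ DIM('b) \<le> (\<Sum>i. gauge_vol DIM('b) (U i))"
      by (simp add: ennreal_mult_divide_eq mult.commute[of "2 ^ DIM('b)"] power_eq_top_ennreal)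
  qed
  also have "\<dots> \<le> hausdorff_outer DIM('b) B" by (rule hausdorff_content_le_outer) simp
  finally have "2 ^ DIM('b) * (emeasure lborel D / 2 ^ DIM('b)) \<le> 2 ^ DIM('b) * hausdorff_outer DIM('b) B"
    by (intro mult_left_mono) auto
  then show ?thesis
    by (simp add: ennreal_times_divide ennreal_mult_divide_eq mult.commute[of "2 ^ DIM('b)"] power_eq_top_ennreal)
qed


text \<open>
  Cut the cube by a grid of mesh \<open>2 a / n\<close>.  There are of the order of \<open>n\<^sup>m\<close> cells, and their images have
  diameters of the order of \<open>1/n\<close>, so the sum of the \<open>m\<close>-th powers stays bounded when \<open>n\<close> grows.
\<close>

lemma hausdorff_outer_lipschitz_image_finite:
  fixes f :: "'b::euclidean_space \<Rightarrow> 'a::euclidean_space"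
  assumes lip: "\<And>x y. dist (f x) (f y) \<le> L * dist x y" and a: "a > 0"
  shows "hausdorff_outer DIM('b) (f ` {y. \<forall>b\<in>Basis. \<bar>y \<bullet> b\<bar> \<le> a}) < top"
proof -
  let ?m = "DIM('b)"
  define Q where "Q = {y::'b. \<forall>b\<in>Basis. \<bar>y \<bullet> b\<bar> \<le> a}"
  obtain b0 :: 'b where b0: "b0 \<in> Basis" using nonempty_Basis by blast
  have L0: "L \<ge> 0" using order_trans[OF zero_le_dist lip[of b0 0]] b0 by simp
  define M where "M = unit_ball_vol ?m * (2 * L * ?m * a) ^ ?m"
  have "hausdorff_outer ?m (f ` Q) \<le> ennreal M"
  proof (rule hausdorff_outer_least)
    fix \<delta> :: real assume \<delta>: "\<delta> > 0"
    obtain n0 :: nat where n0: "2 * L * ?m * a / \<delta> < real n0" using reals_Archimedean2 by blast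
    define n where "n = Suc n0"
    have n: "n \<ge> 1" "2 * L * ?m * a / n \<le> \<delta>"
      using n0 \<delta> by (auto simp: n_def field_simps)
    \<comment> \<open>\<open>ix y b\<close> is the number of the grid interval that contains the coordinate \<open>y \<bullet> b\<close>.\<close>
    define ix where "ix y b = nat \<lfloor>(y \<bullet> b + a) * n / (2 * a)\<rfloor>" for y b :: 'b
    define I where "I = PiE (Basis :: 'b set) (\<lambda>_. {..n})"
    define V where "V k = f ` {y\<in>Q. \<forall>b\<in>Basis. ix y b = k b}" for k
    have fI: "finite I" by (simp add: I_def finite_PiE)
    have cI: "card I = (n + 1) ^ ?m" by (simp add: I_def card_PiE)
    have cov: "f ` Q \<subseteq> (\<Union>k\<in>I. V k)"
    proof
      fix x assume "x \<in> f ` Q"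
      then obtain y where y: "y \<in> Q" "x = f y" by auto
      have "ix y b \<le> n" if b: "b \<in> Basis" for b
      proof -
        have "\<bar>y \<bullet> b\<bar> \<le> a" using y b by (auto simp: Q_def)
        then have "(y \<bullet> b + a) * n \<le> (2 * a) * n" by (intro mult_right_mono) auto
        then have "(y \<bullet> b + a) * n / (2 * a) \<le> real n" using a by (simp add: field_simps)
        then show ?thesis unfolding ix_def by linarith
      qed
      then have "restrict (ix y) Basis \<in> I" by (auto simp: I_def)
      moreover have "x \<in> V (restrict (ix y) Basis)" using y by (auto simp: V_def)
      ultimately show "x \<in> (\<Union>k\<in>I. V k)" by blast
    qed
    have diamV: "norm (x - x') \<le> 2 * L * ?m * a / n" if x: "x \<in> V k" "x' \<in> V k" for x x' k
    proof -
      obtain y y' where y: "y \<in> Q" "y' \<in> Q" "x = f y" "x' = f y'"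
        "\<And>b. b \<in> Basis \<Longrightarrow> ix y b = ix y' b" using x by (auto simp: V_def)
      have "\<bar>(y - y') \<bullet> b\<bar> \<le> 2 * a / n" if b: "b \<in> Basis" for b
      proof -
        define t where "t = (y \<bullet> b + a) * n / (2 * a)"
        define t' where "t' = (y' \<bullet> b + a) * n / (2 * a)"
        have "\<bar>y \<bullet> b\<bar> \<le> a" "\<bar>y' \<bullet> b\<bar> \<le> a" using y b by (auto simp: Q_def)
        then have "t \<ge> 0" "t' \<ge> 0" using a by (auto simp: t_def t'_def)
        moreover have "nat \<lfloor>t\<rfloor> = nat \<lfloor>t'\<rfloor>" using y(5)[OF b] by (simp add: ix_def t_def t'_def)
        ultimately have "\<bar>t - t'\<bar> \<le> 1" by linarith
        moreover have "t - t' = (y - y') \<bullet> b * n / (2 * a)"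
          by (simp add: t_def t'_def inner_diff_left diff_divide_distrib[symmetric] algebra_simps)
        ultimately have "\<bar>(y - y') \<bullet> b\<bar> * n / (2 * a) \<le> 1" using a by (simp add: abs_mult)
        then show ?thesis using a n by (simp add: field_simps)
      qed
      then have "(\<Sum>b\<in>Basis. \<bar>(y - y') \<bullet> b\<bar>) \<le> real ?m * (2 * a / n)" by (rule sum_bounded_above)
      then have "dist y y' \<le> real ?m * (2 * a / n)" using norm_le_l1[of "y - y'"] by (simp add: dist_norm)
      then have "L * dist y y' \<le> L * (real ?m * (2 * a / n))" using L0 by (rule mult_left_mono)
      then show ?thesis using lip[of y y'] y by (simp add: dist_norm algebra_simps)
    qed
    have d0: "0 \<le> 2 * L * ?m * a / n" using L0 a by simp
    have dV: "diameter (V k) \<le> 2 * L * ?m * a / n" for k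
      using diamV d0 by (intro diameter_le) auto
    have bV: "bounded (V k)" for k
    proof (cases "V k = {}")
      case False
      then obtain x where x: "x \<in> V k" by auto
      show ?thesis by (rule boundedI[where B = "norm x + 2 * L * ?m * a / n"])
          (use diamV[OF _ x] norm_triangle_sub[of _ x] in \<open>meson add_left_mono order_trans\<close>)
    qed simp
    have "hausdorff_content ?m \<delta> (f ` Q) \<le> (\<Sum>k\<in>I. gauge_vol ?m (V k))"
      using \<delta> n(2) by (intro hausdorff_content_le_finite fI cov bV order_trans[OF dV]) (auto simp: DIM_positive Suc_le_eq)
    also have "\<dots> \<le> (\<Sum>k\<in>I. ennreal (unit_ball_vol ?m * (L * ?m * a / n) ^ ?m))"
    proof (intro sum_mono)
      fix k
      have "diameter (V k) / 2 \<le> L * ?m * a / n" using dV[of k] by (simp add: mult_ac)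
      then show "gauge_vol ?m (V k) \<le> ennreal (unit_ball_vol ?m * (L * ?m * a / n) ^ ?m)"
        unfolding gauge_vol_def using diameter_ge_0[OF bV]
        by (intro ennreal_leI mult_left_mono power_mono) auto
    qed
    also have "\<dots> = ennreal ((n + 1) ^ ?m * (unit_ball_vol ?m * (L * ?m * a / n) ^ ?m))"
      using cI L0 a by (simp add: ennreal_mult ennreal_of_nat_eq_real_of_nat)
    also have "\<dots> \<le> ennreal M"
    proof (rule ennreal_leI)
      have "(real n + 1) * (L * ?m * a / n) \<le> 2 * L * ?m * a"
        using L0 a n by (simp add: field_simps mult_left_mono)
      then have "((real n + 1) * (L * ?m * a / n)) ^ ?m \<le> (2 * L * ?m * a) ^ ?m"
        using L0 a by (intro power_mono) auto
      then have "unit_ball_vol ?m * ((real n + 1) * (L * ?m * a / n)) ^ ?m \<le> M"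
        unfolding M_def by (intro mult_left_mono) auto
      then show "real ((n + 1) ^ ?m) * (unit_ball_vol ?m * (L * ?m * a / n) ^ ?m) \<le> M"
        unfolding power_mult_distrib by (simp add: mult_ac add.commute)
    qed
    finally show "hausdorff_content ?m \<delta> (f ` Q) \<le> ennreal M" .
  qed
  then show ?thesis by (auto simp: Q_def intro: le_less_trans)
qed

lemma sets_surface_measure: "sets (surface_measure \<Omega>) = sets (restrict_space borel (frontier \<Omega>))"
  unfolding surface_measure_def by (intro sets_restrict_space_cong) simp

lemma space_surface_measure [simp]: "space (surface_measure \<Omega>) = frontier \<Omega>"
  by (simp add: surface_measure_def space_restrict_space)

lemma borel_measurable_surface_measure:
  "f \<in> borel_measurable borel \<Longrightarrow> f \<in> borel_measurable (surface_measure \<Omega>)"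
  unfolding measurable_cong_sets[OF sets_surface_measure refl] by (rule measurable_restrict_space1)

lemma emeasure_surface_measure:
  fixes \<Omega> :: "'a::euclidean_space set"
  assumes "DIM('a) \<ge> 2" "A \<in> sets borel" "A \<subseteq> frontier \<Omega>"
  shows "emeasure (surface_measure \<Omega>) A = hausdorff_outer (DIM('a) - 1) A"
  unfolding surface_measure_def using assms
  by (subst emeasure_restrict_space) (auto intro!: emeasure_hausdorff_measure)

section \<open>Hardy's inequality above a Lipschitz graph\<close>

text \<open>
  The derivative of \<open>- |f(t)|\<^sup>2 / (t + s)\<close> is \<open>|f(t)|\<^sup>2 / (t + s)\<^sup>2 - 2 f(t) \<bullet> f'(t) / (t + s)\<close>.  Integrate
  it over \<open>[0, b]\<close>: the contribution of the end point \<open>b\<close> has a favourable sign, the one of 0 is the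
  boundary term, and half of the left-hand side absorbs the mixed term.
\<close>

lemma hardy_interval:
  fixes f f' :: "real \<Rightarrow> 'b::euclidean_space"
  assumes s: "s > 0" and b: "b > 0"
    and f: "\<And>t. (f has_vector_derivative f' t) (at t)" and f': "continuous_on UNIV f'"
  shows "(\<integral>\<^sup>+t. ennreal ((norm (f t) / (t + s))\<^sup>2) * indicator {0<..<b} t \<partial>lborel)
     \<le> ennreal (2 / s * (norm (f 0))\<^sup>2) + 4 * (\<integral>\<^sup>+t. ennreal ((norm (f' t))\<^sup>2) * indicator {0<..<b} t \<partial>lborel)"
proof -
  have cf: "continuous_on UNIV f"
    using f by (intro continuous_at_imp_continuous_on) (auto intro: has_vector_derivative_continuous)
  note [continuous_intros] = continuous_on_subset[OF cf] continuous_on_subset[OF f']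
  define A where "A = integral {0..b} (\<lambda>t. (norm (f t) / (t + s))\<^sup>2)"
  define B where "B = integral {0..b} (\<lambda>t. (norm (f' t))\<^sup>2)"
  have ne: "t + s \<noteq> 0" if "t \<in> {0..b}" for t using that s by auto
  have iA: "(\<lambda>t. (norm (f t) / (t + s))\<^sup>2) integrable_on {0..b}"
    using ne by (intro integrable_continuous_real continuous_intros) auto
  have iB: "(\<lambda>t. (norm (f' t))\<^sup>2) integrable_on {0..b}"
    by (intro integrable_continuous_real continuous_intros) auto
  have ftc: "((\<lambda>t. (norm (f t) / (t + s))\<^sup>2 - 2 * (f t \<bullet> f' t) / (t + s)) has_integral
      (- (f b \<bullet> f b) / (b + s)) - (- (f 0 \<bullet> f 0) / (0 + s))) {0..b}"
  proof (rule fundamental_theorem_of_calculus)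
    fix t assume t: "t \<in> {0..b}"
    have fd: "(f has_derivative (\<lambda>h. h *\<^sub>R f' t)) (at t within {0..b})"
      using f[of t] by (simp add: has_vector_derivative_def has_derivative_at_withinI)
    have "((\<lambda>t. f t \<bullet> f t) has_derivative (\<lambda>h. f t \<bullet> (h *\<^sub>R f' t) + (h *\<^sub>R f' t) \<bullet> f t)) (at t within {0..b})"
      by (rule has_derivative_inner[OF fd fd])
    moreover have "(\<lambda>h. f t \<bullet> (h *\<^sub>R f' t) + (h *\<^sub>R f' t) \<bullet> f t) = (*) (2 * (f t \<bullet> f' t))"
      by (auto simp: inner_commute algebra_simps)
    ultimately have 1: "((\<lambda>t. f t \<bullet> f t) has_field_derivative 2 * (f t \<bullet> f' t)) (at t within {0..b})"
      by (simp add: has_field_derivative_def)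
    have 2: "((\<lambda>t. t + s) has_field_derivative 1) (at t within {0..b})"
      by (auto intro!: derivative_eq_intros)
    have "((\<lambda>t. - (f t \<bullet> f t) / (t + s)) has_field_derivative
       (- (2 * (f t \<bullet> f' t)) * (t + s) - (- (f t \<bullet> f t)) * 1) / ((t + s) * (t + s))) (at t within {0..b})"
      by (rule DERIV_divide[OF DERIV_minus[OF 1] 2 ne[OF t]])
    also have "(- (2 * (f t \<bullet> f' t)) * (t + s) - (- (f t \<bullet> f t)) * 1) / ((t + s) * (t + s)) =
       (norm (f t) / (t + s))\<^sup>2 - 2 * (f t \<bullet> f' t) / (t + s)"
      using ne[OF t] by (simp add: norm_eq_sqrt_inner power_divide power2_eq_square add_divide_distrib diff_divide_distrib)
    finally show "((\<lambda>t. - (f t \<bullet> f t) / (t + s)) has_vector_derivative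
       (norm (f t) / (t + s))\<^sup>2 - 2 * (f t \<bullet> f' t) / (t + s)) (at t within {0..b})"
      by (simp add: has_real_derivative_iff_has_vector_derivative)
  qed (use b in simp)
  have "A / 2 - 2 * B \<le> (- (f b \<bullet> f b) / (b + s)) - (- (f 0 \<bullet> f 0) / (0 + s))"
  proof (rule has_integral_le[OF _ ftc])
    show "((\<lambda>t. (norm (f t) / (t + s))\<^sup>2 / 2 - 2 * (norm (f' t))\<^sup>2) has_integral A / 2 - 2 * B) {0..b}"
      unfolding A_def B_def
      by (intro has_integral_diff has_integral_divide has_integral_mult_right integrable_integral iA iB)
    fix t assume t: "t \<in> {0..b}"
    define x where "x = norm (f t) / (t + s)"
    have ts: "t + s > 0" using t s by auto
    have "f t \<bullet> f' t / (t + s) \<le> x * norm (f' t)"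
      using norm_cauchy_schwarz[of "f t" "f' t"] ts by (simp add: x_def divide_right_mono)
    moreover have "0 \<le> (x / 2 - norm (f' t))\<^sup>2" by simp
    then have "x * norm (f' t) \<le> x\<^sup>2 / 4 + (norm (f' t))\<^sup>2"
      by (simp add: power2_eq_square algebra_simps)
    ultimately show "(norm (f t) / (t + s))\<^sup>2 / 2 - 2 * (norm (f' t))\<^sup>2
        \<le> (norm (f t) / (t + s))\<^sup>2 - 2 * (f t \<bullet> f' t) / (t + s)"
      unfolding x_def[symmetric] by linarith
  qed
  also have "\<dots> \<le> (norm (f 0))\<^sup>2 / s"
    using b s by (simp add: power2_norm_eq_inner)
  finally have AB: "A \<le> 2 / s * (norm (f 0))\<^sup>2 + 4 * B" by simp
  have A: "(\<integral>\<^sup>+t. ennreal ((norm (f t) / (t + s))\<^sup>2) * indicator {0<..<b} t \<partial>lborel) = ennreal A"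
    using integrable_integral[OF iA] unfolding A_def
    by (intro nn_integral_has_integral_lebesgue') (auto simp: has_integral_Icc_iff_Ioo)
  have B: "(\<integral>\<^sup>+t. ennreal ((norm (f' t))\<^sup>2) * indicator {0<..<b} t \<partial>lborel) = ennreal B"
    using integrable_integral[OF iB] unfolding B_def
    by (intro nn_integral_has_integral_lebesgue') (auto simp: has_integral_Icc_iff_Ioo)
  have B0: "B \<ge> 0" unfolding B_def by (intro integral_nonneg iB) auto
  have "ennreal A \<le> ennreal (2 / s * (norm (f 0))\<^sup>2 + 4 * B)" using AB by (rule ennreal_leI)
  also have "\<dots> = ennreal (2 / s * (norm (f 0))\<^sup>2) + 4 * ennreal B"
    using s B0 by (subst ennreal_plus) (auto simp: ennreal_mult)
  finally show ?thesis unfolding A B .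
qed

lemma nn_integral_lborel_translate:
  fixes g :: "'a::euclidean_space \<Rightarrow> ennreal"
  assumes [measurable]: "g \<in> borel_measurable borel"
  shows "(\<integral>\<^sup>+y. g (a + y) \<partial>lborel) = (\<integral>\<^sup>+y. g y \<partial>lborel)"
  using nn_integral_distr[of "(+) a" lborel borel g] lborel_distr_plus[of a] by simp

lemma nn_integral_lborel_reflect:
  fixes g :: "'a::euclidean_space \<Rightarrow> ennreal"
  assumes [measurable]: "g \<in> borel_measurable borel"
  shows "(\<integral>\<^sup>+y. g (a - y) \<partial>lborel) = (\<integral>\<^sup>+y. g y \<partial>lborel)"
proof -
  have "lborel = distr lborel borel (\<lambda>y. a + (-1) *\<^sub>R y)"
    using lborel_affine[of "-1" a] by (simp add: density_1)
  then have "(\<integral>\<^sup>+y. g y \<partial>lborel) = (\<integral>\<^sup>+y. g y \<partial>distr lborel borel (\<lambda>y. a - y))" by simp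
  also have "\<dots> = (\<integral>\<^sup>+y. g (a - y) \<partial>lborel)" by (rule nn_integral_distr) measurable
  finally show ?thesis ..
qed

text \<open>
  Uniqueness of Haar measure for the additive group: evaluate the double integral of
  \<open>f x * h (x + y)\<close> in both orders, and use the invariance of each measure under translations.
\<close>

lemma translation_invariant_measure_unique:
  fixes M :: "'a::euclidean_space measure" and f h :: "'a \<Rightarrow> ennreal"
  assumes sets[measurable_cong]: "sets M = sets borel" and sf: "sigma_finite_measure M"
    and trans: "\<And>a g. g \<in> borel_measurable borel \<Longrightarrow> (\<integral>\<^sup>+x. g (x + a) \<partial>M) = (\<integral>\<^sup>+x. g x \<partial>M)"
    and [measurable]: "f \<in> borel_measurable borel" "h \<in> borel_measurable borel"
  shows "(\<integral>\<^sup>+x. f x \<partial>M) * (\<integral>\<^sup>+y. h y \<partial>lborel) = (\<integral>\<^sup>+x. h x \<partial>M) * (\<integral>\<^sup>+y. f y \<partial>lborel)"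
proof -
  interpret pair_sigma_finite M "lborel :: 'a measure"
    using sf by (intro pair_sigma_finite.intro sigma_finite_lborel)
  have "(\<integral>\<^sup>+x. f x \<partial>M) * (\<integral>\<^sup>+y. h y \<partial>lborel) = (\<integral>\<^sup>+x. f x * (\<integral>\<^sup>+y. h y \<partial>lborel) \<partial>M)"
    by (simp add: nn_integral_multc)
  also have "\<dots> = (\<integral>\<^sup>+x. f x * (\<integral>\<^sup>+y. h (x + y) \<partial>lborel) \<partial>M)"
    by (simp add: nn_integral_lborel_translate)
  also have "\<dots> = (\<integral>\<^sup>+x. (\<integral>\<^sup>+y. f x * h (x + y) \<partial>lborel) \<partial>M)"
    by (intro nn_integral_cong nn_integral_cmult[symmetric]) measurable
  also have "\<dots> = (\<integral>\<^sup>+y. (\<integral>\<^sup>+x. f x * h (x + y) \<partial>M) \<partial>lborel)"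
    by (rule Fubini'[symmetric]) measurable
  also have "\<dots> = (\<integral>\<^sup>+y. (\<integral>\<^sup>+x. f (x - y) * h x \<partial>M) \<partial>lborel)"
  proof (rule nn_integral_cong)
    fix y
    have "(\<integral>\<^sup>+x. (\<lambda>x. f (x - y) * h x) (x + y) \<partial>M) = (\<integral>\<^sup>+x. f (x - y) * h x \<partial>M)"
      by (rule trans) measurable
    then show "(\<integral>\<^sup>+x. f x * h (x + y) \<partial>M) = (\<integral>\<^sup>+x. f (x - y) * h x \<partial>M)" by simp
  qed
  also have "\<dots> = (\<integral>\<^sup>+x. (\<integral>\<^sup>+y. f (x - y) * h x \<partial>lborel) \<partial>M)"
    by (rule Fubini') measurable
  also have "\<dots> = (\<integral>\<^sup>+x. (\<integral>\<^sup>+y. f (x - y) \<partial>lborel) * h x \<partial>M)"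
    by (intro nn_integral_cong nn_integral_multc) measurable
  also have "\<dots> = (\<integral>\<^sup>+x. h x * (\<integral>\<^sup>+y. f y \<partial>lborel) \<partial>M)"
    by (simp add: nn_integral_lborel_reflect mult.commute)
  also have "\<dots> = (\<integral>\<^sup>+x. h x \<partial>M) * (\<integral>\<^sup>+y. f y \<partial>lborel)"
    by (rule nn_integral_multc) measurable
  finally show ?thesis .
qed

lemma linear_isometry_surj:
  fixes S :: "'c::euclidean_space \<Rightarrow> 'a::euclidean_space"
  assumes S: "linear S" "\<And>p. norm (S p) = norm p" and d: "DIM('c) = DIM('a)"
  shows "surj S"
proof -
  have "inj S" using S by (metis linear_injective_0 norm_eq_zero)
  then have "dim (S ` UNIV) = DIM('a)" using d dim_image_eq[OF S(1)] by (simp add: inj_on_subset)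
  then have "span (range S) = UNIV" by (simp add: dim_eq_full)
  then show ?thesis using linear_subspace_image[OF S(1) subspace_UNIV] by (metis span_eq_iff)
qed

text \<open>
  The image of Lebesgue measure under \<open>S\<close> is invariant under translations, hence a multiple of Lebesgue
  measure.  The factor is 1, because \<open>S\<close> maps the unit ball onto the unit ball.
\<close>

lemma nn_integral_linear_isometry:
  fixes S :: "'c::euclidean_space \<Rightarrow> 'a::euclidean_space"
  assumes S: "linear S" "\<And>p. norm (S p) = norm p" and d: "DIM('c) = DIM('a)"
    and g[measurable]: "g \<in> borel_measurable borel"
  shows "(\<integral>\<^sup>+p. g (S p) \<partial>lborel) = (\<integral>\<^sup>+x. g x \<partial>lborel)"
proof -
  interpret linear S by fact
  have [measurable]: "S \<in> borel_measurable borel"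
    using linear_continuous_on[OF linear_conv_bounded_linear[THEN iffD1, OF S(1)]]
    by (intro borel_measurable_continuous_onI)
  define M where "M = distr lborel borel S"
  have M: "sets M = sets borel" by (simp add: M_def)
  have nnM: "(\<integral>\<^sup>+x. f x \<partial>M) = (\<integral>\<^sup>+p. f (S p) \<partial>lborel)" if "f \<in> borel_measurable borel" for f
    unfolding M_def using that by (intro nn_integral_distr) measurable
  have ball: "emeasure M (ball 0 r) = emeasure lborel (ball 0 r :: 'c set)" for r
  proof -
    have "S -` ball 0 r \<inter> space lborel = ball 0 r" using S(2) by auto
    then show ?thesis unfolding M_def by (subst emeasure_distr) auto
  qed
  have sf: "sigma_finite_measure M"
  proof
    show "\<exists>A. countable A \<and> A \<subseteq> sets M \<and> \<Union>A = space M \<and> (\<forall>a\<in>A. emeasure M a \<noteq> \<infinity>)"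
    proof (intro exI[of _ "range (\<lambda>n. ball 0 (real n))"] conjI ballI)
      show "\<Union> (range (\<lambda>n. ball 0 (real n))) = space M"
        by (auto simp: M_def intro: reals_Archimedean2)
      fix a assume "a \<in> range (\<lambda>n. ball (0::'a) (real n))"
      then obtain n where "a = ball 0 (real n)" by auto
      then show "emeasure M a \<noteq> \<infinity>"
        using emeasure_bounded_finite[of "ball (0::'c) (real n)"] by (simp add: ball)
    qed (auto simp: M)
  qed
  have tr: "(\<integral>\<^sup>+x. f (x + a) \<partial>M) = (\<integral>\<^sup>+x. f x \<partial>M)" if [measurable]: "f \<in> borel_measurable borel" for f a
  proof -
    obtain p where p: "a = S p" using linear_isometry_surj[OF S d] by blast
    have "(\<integral>\<^sup>+x. f (x + a) \<partial>M) = (\<integral>\<^sup>+q. f (S (p + q)) \<partial>lborel)"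
      by (subst nnM) (auto simp: p add add.commute)
    also have "\<dots> = (\<integral>\<^sup>+q. f (S q) \<partial>lborel)"
      by (rule nn_integral_lborel_translate) measurable
    finally show ?thesis by (simp add: nnM)
  qed
  define v where "v = emeasure lborel (ball (0::'a) 1)"
  have v: "v = ennreal (unit_ball_vol (real DIM('a)))" by (simp add: v_def emeasure_ball)
  have v': "emeasure M (ball 0 1) = v" by (simp add: ball v emeasure_ball d)
  have ind: "(indicator (ball 0 1) :: 'a \<Rightarrow> ennreal) \<in> borel_measurable borel" by (intro borel_measurable_indicator) auto
  have "(\<integral>\<^sup>+x. g x \<partial>M) * v = v * (\<integral>\<^sup>+x. g x \<partial>lborel)"
    using translation_invariant_measure_unique[OF M sf tr g ind]
    by (simp add: v'[symmetric] nn_integral_indicator M) (simp add: v_def v')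
  moreover have "unit_ball_vol (real DIM('a)) > 0" by (rule unit_ball_vol_pos) simp
  then have "v \<noteq> 0" "v \<noteq> top" unfolding v by (simp_all add: ennreal_eq_0_iff del: unit_ball_vol_pos)
  ultimately show ?thesis by (simp add: nnM mult.commute[of _ v] ennreal_mult_cancel_left)
qed

text \<open>
  \<open>h\<close> measures, in the direction \<open>\<nu>\<close>, the height above the Lipschitz graph \<open>h = 0\<close>.  The graph of a
  function \<open>g\<close> over the hyperplane orthogonal to \<open>\<nu>\<close> has the height function
  \<open>x \<mapsto> x \<bullet> \<nu> - g (x - (x \<bullet> \<nu>) \<nu>)\<close>; in the form chosen here the notion passes to the product of
  a cross-section with a line by composition with a projection.
\<close>

definition height_function :: "'a::euclidean_space \<Rightarrow> real \<Rightarrow> ('a \<Rightarrow> real) \<Rightarrow> bool" where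
  "height_function \<nu> L h \<longleftrightarrow> norm \<nu> = 1 \<and> (\<forall>x t. h (x + t *\<^sub>R \<nu>) = h x + t) \<and>
     (\<forall>x y. \<bar>h x - h y\<bar> \<le> L * dist x y)"

lemma height_functionD:
  assumes "height_function \<nu> L h"
  shows "norm \<nu> = 1" "h (x + t *\<^sub>R \<nu>) = h x + t" "\<bar>h x - h y\<bar> \<le> L * dist x y" "L \<ge> 1"
    "continuous_on X h"
proof -
  show 1: "norm \<nu> = 1" "h (x + t *\<^sub>R \<nu>) = h x + t" "\<bar>h x - h y\<bar> \<le> L * dist x y" for x y t
    using assms by (auto simp: height_function_def)
  show 2: "L \<ge> 1" using 1(3)[of "0 + 1 *\<^sub>R \<nu>" 0] 1(1) 1(2)[of 0 1] by (simp add: dist_norm)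
  have "L-lipschitz_on X h" using 1 2 by (intro lipschitz_onI) (auto simp: dist_real_def)
  then show "continuous_on X h" by (rule lipschitz_on_continuous_on)
qed

text \<open>
  Cartesian coordinates \<open>(y, t)\<close> with last axis \<open>\<nu>\<close>, where \<open>J\<close> identifies the model space with the
  hyperplane orthogonal to \<open>\<nu>\<close>.
\<close>

lemma hyperplane_coordinates:
  fixes \<nu> :: "'a::euclidean_space"
  assumes nu: "norm \<nu> = 1" and d: "DIM('b::euclidean_space) + 1 = DIM('a)"
  obtains J :: "'b::euclidean_space \<Rightarrow> 'a" where "linear J" "\<And>y. norm (J y) = norm y" "\<And>y. J y \<bullet> \<nu> = 0"
    "linear (\<lambda>(y, t). J y + t *\<^sub>R \<nu>)" "\<And>p. norm ((\<lambda>(y, t). J y + t *\<^sub>R \<nu>) p) = norm p"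
    "\<And>y t. (norm (J y + t *\<^sub>R \<nu>))\<^sup>2 = (norm y)\<^sup>2 + t\<^sup>2"
proof -
  have "\<nu> \<noteq> 0" using nu by auto
  then have "dim (UNIV :: 'b set) \<le> dim {x. \<nu> \<bullet> x = 0}"
    using d by (simp add: dim_hyperplane)
  then obtain J :: "'b \<Rightarrow> 'a" where J: "linear J" "J \<in> UNIV \<rightarrow> {x. \<nu> \<bullet> x = 0}"
      "\<And>x. norm (J x) = norm x"
    using isometry_subset_subspace[OF subspace_UNIV subspace_hyperplane] by (metis UNIV_I)
  have orth: "J y \<bullet> \<nu> = 0" for y using J(2) by (auto simp: inner_commute)
  have nsq: "(norm (J y + t *\<^sub>R \<nu>))\<^sup>2 = (norm y)\<^sup>2 + t\<^sup>2" for y t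
  proof -
    have "(norm (J y + t *\<^sub>R \<nu>))\<^sup>2 = (norm (J y))\<^sup>2 + (norm (t *\<^sub>R \<nu>))\<^sup>2"
      by (rule norm_add_Pythagorean) (simp add: orthogonal_def orth)
    then show ?thesis using J(3) nu by simp
  qed
  show ?thesis
  proof (rule that[OF J(1,3) orth _ _ nsq])
    interpret linear J by fact
    show "linear (\<lambda>(y, t). J y + t *\<^sub>R \<nu>)"
      by (intro linearI) (auto simp: add scale algebra_simps)
    fix p :: "'b \<times> real"
    obtain y t where p: "p = (y, t)" by (cases p)
    have "(norm (J y + t *\<^sub>R \<nu>))\<^sup>2 = (norm (y, t))\<^sup>2" by (simp add: nsq norm_Pair)
    then show "norm ((\<lambda>(y, t). J y + t *\<^sub>R \<nu>) p) = norm p" by (simp add: p)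
  qed
qed

text \<open>
  In the coordinates \<open>(y, t)\<close> the level set \<open>h = 0\<close> is parametrised by \<open>y \<mapsto> J y - h (J y) \<nu>\<close>, which is
  Lipschitz and does not decrease distances.
\<close>

context
  fixes \<nu> :: "'a::euclidean_space" and L h and J :: "'b::euclidean_space \<Rightarrow> 'a"
  assumes h: "height_function \<nu> L h"
    and J: "linear J" "\<And>y. norm (J y) = norm y" "\<And>y. J y \<bullet> \<nu> = 0"
    and nsq: "\<And>y t. (norm (J y + t *\<^sub>R \<nu>))\<^sup>2 = (norm y)\<^sup>2 + t\<^sup>2"
begin

lemma graph_expands: "dist x y \<le> dist (J x - h (J x) *\<^sub>R \<nu>) (J y - h (J y) *\<^sub>R \<nu>)"
proof -
  interpret linear J by fact
  have "(J x - h (J x) *\<^sub>R \<nu>) - (J y - h (J y) *\<^sub>R \<nu>) = J (x - y) + (h (J y) - h (J x)) *\<^sub>R \<nu>"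
    by (simp add: diff algebra_simps)
  then have "(dist (J x - h (J x) *\<^sub>R \<nu>) (J y - h (J y) *\<^sub>R \<nu>))\<^sup>2 = (norm (x - y))\<^sup>2 + (h (J y) - h (J x))\<^sup>2"
    by (simp only: dist_norm nsq)
  then have "(dist x y)\<^sup>2 \<le> (dist (J x - h (J x) *\<^sub>R \<nu>) (J y - h (J y) *\<^sub>R \<nu>))\<^sup>2"
    by (simp add: dist_norm)
  then show ?thesis by (rule power2_le_imp_le) simp
qed

lemma graph_lipschitz: "dist (J x - h (J x) *\<^sub>R \<nu>) (J y - h (J y) *\<^sub>R \<nu>) \<le> (1 + L) * dist x y"
proof -
  interpret linear J by fact
  have nJ: "norm (J x - J y) = norm (x - y)" using J(2) by (simp add: diff[symmetric])
  have "(J x - h (J x) *\<^sub>R \<nu>) - (J y - h (J y) *\<^sub>R \<nu>) = (J x - J y) - (h (J x) - h (J y)) *\<^sub>R \<nu>"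
    by (simp add: algebra_simps)
  then have "dist (J x - h (J x) *\<^sub>R \<nu>) (J y - h (J y) *\<^sub>R \<nu>) \<le> norm (J x - J y) + \<bar>h (J x) - h (J y)\<bar>"
    unfolding dist_norm by (metis (no_types) norm_triangle_ineq4 norm_scaleR height_functionD(1)[OF h] mult.right_neutral)
  also have "\<dots> \<le> norm (x - y) + L * norm (x - y)"
    using height_functionD(3)[OF h, of "J x" "J y"] nJ by (simp add: dist_norm)
  finally show ?thesis by (simp add: dist_norm algebra_simps)
qed

end


text \<open>
  In the coordinates \<open>(y, t)\<close> the level set is the graph of a Lipschitz function, and a bounded part of it
  is the image of a cube.
\<close>

lemma hausdorff_outer_level_set_finite:
  fixes \<nu> :: "'a::euclidean_space"
  assumes h: "height_function \<nu> L h" and d: "DIM('b::euclidean_space) + 1 = DIM('a)"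
  shows "hausdorff_outer DIM('b) ({x. h x = 0} \<inter> cball 0 r) < top"
proof -
  obtain J :: "'b::euclidean_space \<Rightarrow> 'a" where J: "linear J" "\<And>y. norm (J y) = norm y" "\<And>y. J y \<bullet> \<nu> = 0"
    "linear (\<lambda>(y, t). J y + t *\<^sub>R \<nu>)" "\<And>p. norm ((\<lambda>(y, t). J y + t *\<^sub>R \<nu>) p) = norm p"
    and nsq: "\<And>y t. (norm (J y + t *\<^sub>R \<nu>))\<^sup>2 = (norm y)\<^sup>2 + t\<^sup>2"
    by (rule hyperplane_coordinates[OF height_functionD(1)[OF h] d]) (rule that)
  define \<gamma> where "\<gamma> y = J y - h (J y) *\<^sub>R \<nu>" for y
  define a where "a = \<bar>r\<bar> + 1"
  have sur: "surj (\<lambda>(y, t). J y + t *\<^sub>R \<nu>)"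
    using d by (intro linear_isometry_surj J) simp
  have "{x. h x = 0} \<inter> cball 0 r \<subseteq> \<gamma> ` {y. \<forall>b\<in>Basis. \<bar>y \<bullet> b\<bar> \<le> a}"
  proof
    fix x assume x: "x \<in> {x. h x = 0} \<inter> cball 0 r"
    obtain p where "x = (\<lambda>(y, t). J y + t *\<^sub>R \<nu>) p" using sur by blast
    then obtain y t where yt: "x = J y + t *\<^sub>R \<nu>" by (cases p) auto
    then have "h (J y) + t = 0" using x height_functionD(2)[OF h] by auto
    then have "x = \<gamma> y" using yt by (simp add: \<gamma>_def eq_neg_iff_add_eq_0[symmetric] add.commute)
    moreover have "\<bar>y \<bullet> b\<bar> \<le> a" if "b \<in> Basis" for b
    proof -
      have "(norm y)\<^sup>2 \<le> (norm x)\<^sup>2" by (simp add: yt nsq)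
      then have "norm y \<le> norm x" by (rule power2_le_imp_le) simp
      moreover have "norm x \<le> r" using x by simp
      ultimately show ?thesis using Basis_le_norm[OF that, of y] by (simp add: a_def)
    qed
    ultimately show "x \<in> \<gamma> ` {y. \<forall>b\<in>Basis. \<bar>y \<bullet> b\<bar> \<le> a}" by blast
  qed
  then have "hausdorff_outer DIM('b) ({x. h x = 0} \<inter> cball 0 r) \<le> hausdorff_outer DIM('b) (\<gamma> ` {y. \<forall>b\<in>Basis. \<bar>y \<bullet> b\<bar> \<le> a})"
    by (rule hausdorff_outer_mono)
  also have "\<dots> < top"
    unfolding \<gamma>_def
    by (rule hausdorff_outer_lipschitz_image_finite[OF graph_lipschitz[OF h J(1-3) nsq]]) (simp add: a_def)
  finally show ?thesis .
qed

text \<open>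
  The image under \<open>\<gamma>\<close> of Lebesgue measure on \<open>D\<close> is at most \<open>2\<^sup>m\<close> times the surface measure, since \<open>\<gamma>\<close>
  does not decrease distances; the inequality of measures passes to integrals.
\<close>

lemma graph_integral_le_surface_integral:
  fixes \<Omega> :: "'a::euclidean_space set" and \<gamma> :: "'b::euclidean_space \<Rightarrow> 'a" and g :: "'a \<Rightarrow> ennreal"
  assumes d: "DIM('b) + 1 = DIM('a)" and exp: "\<And>x y. dist x y \<le> dist (\<gamma> x) (\<gamma> y)"
    and \<gamma>[measurable]: "\<gamma> \<in> borel_measurable borel" and D[measurable]: "D \<in> sets borel"
    and sub: "\<gamma> ` D \<subseteq> frontier \<Omega>" and g[measurable]: "g \<in> borel_measurable borel"
  shows "(\<integral>\<^sup>+y. g (\<gamma> y) * indicator D y \<partial>lborel) \<le> 2 ^ DIM('b) * (\<integral>\<^sup>+x. g x \<partial>surface_measure \<Omega>)"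
proof -
  have d1: "DIM('a) - 1 = DIM('b)" "DIM('a) \<ge> 2" using d DIM_positive[where 'a='b] by linarith+
  have id[measurable]: "(\<lambda>x. x) \<in> measurable (surface_measure \<Omega>) borel"
    by (rule borel_measurable_surface_measure) simp
  define N where "N = distr (density lborel (indicator D)) borel \<gamma>"
  define H where "H = scale_measure (2 ^ DIM('b)) (distr (surface_measure \<Omega>) borel (\<lambda>x. x))"
  have "N \<le> H"
  proof (subst le_measure)
    show "sets N = sets H" by (simp add: N_def H_def)
    show "\<forall>B\<in>sets N. emeasure N B \<le> emeasure H B"
    proof
      fix B assume "B \<in> sets N"
      then have B[measurable]: "B \<in> sets borel" by (simp add: N_def)
      have DB: "\<gamma> -` B \<inter> D \<in> sets borel"
        using measurable_sets[OF \<gamma> B] by auto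
      have "emeasure N B = emeasure lborel (\<gamma> -` B \<inter> D)"
        unfolding N_def using measurable_sets[OF \<gamma> B] DB
        by (subst emeasure_distr, simp_all, subst emeasure_density)
           (auto simp: indicator_inter_arith[symmetric] Int_commute nn_integral_indicator mult.commute)
      also have "\<dots> \<le> 2 ^ DIM('b) * hausdorff_outer DIM('b) (B \<inter> frontier \<Omega>)"
        by (rule lborel_le_hausdorff_outer[OF exp DB]) (use sub in auto)
      also have "hausdorff_outer DIM('b) (B \<inter> frontier \<Omega>) = emeasure (surface_measure \<Omega>) (B \<inter> frontier \<Omega>)"
        by (subst emeasure_surface_measure) (auto simp: d1[unfolded One_nat_def] intro!: sets.Int borel_closed)
      also have "2 ^ DIM('b) * \<dots> = emeasure H B"
        unfolding H_def by (simp add: emeasure_scale_measure emeasure_distr Int_commute vimage_def)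
      finally show "emeasure N B \<le> emeasure H B" .
    qed
  qed
  then have "nn_integral N g \<le> nn_integral H g"
    by (intro nn_integral_mono_measure) (simp_all add: N_def H_def)
  moreover have "nn_integral N g = (\<integral>\<^sup>+y. g (\<gamma> y) * indicator D y \<partial>lborel)"
    unfolding N_def by (subst nn_integral_distr, simp, simp, subst nn_integral_density) (auto simp: mult.commute)
  moreover have "nn_integral H g = 2 ^ DIM('b) * (\<integral>\<^sup>+x. g x \<partial>surface_measure \<Omega>)"
    unfolding H_def by (subst nn_integral_scale_measure) (auto simp: nn_integral_distr)
  ultimately show ?thesis by simp
qed

text \<open>
  In the coordinates \<open>(y, t)\<close>, shifted so that \<open>t\<close> is the height above the graph, the set
  \<open>{x \<in> A. 0 < h x < b}\<close> is a product of a base \<open>D\<close> with an interval.  The inequality on the interval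
  is integrated over the base, and the boundary term is compared with the surface integral.
\<close>

lemma hardy_patch:
  fixes \<Omega> :: "'a::euclidean_space set" and \<phi> \<phi>' :: "'a \<Rightarrow> 'c::euclidean_space"
  assumes h: "height_function \<nu> L h" and d: "DIM('b::euclidean_space) + 1 = DIM('a)"
    and A: "open A" "\<And>x t. x + t *\<^sub>R \<nu> \<in> A \<longleftrightarrow> x \<in> A"
    and sub: "{x\<in>A. h x = 0} \<subseteq> frontier \<Omega>" and b: "b > 0" and s: "s > 0"
    and \<phi>: "continuous_on UNIV \<phi>" "continuous_on UNIV \<phi>'"
      "\<And>x. ((\<lambda>t. \<phi> (x + t *\<^sub>R \<nu>)) has_vector_derivative \<phi>' x) (at 0)"
  shows "(\<integral>\<^sup>+x. ennreal ((norm (\<phi> x) / (h x + s))\<^sup>2) * indicator {x\<in>A. 0 < h x \<and> h x < b} x \<partial>lborel)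
    \<le> ennreal (2 / s) * (2 ^ DIM('b) * (\<integral>\<^sup>+x. ennreal ((norm (\<phi> x))\<^sup>2) \<partial>surface_measure \<Omega>))
      + 4 * (\<integral>\<^sup>+x. ennreal ((norm (\<phi>' x))\<^sup>2) * indicator {x\<in>A. 0 < h x \<and> h x < b} x \<partial>lborel)"
proof -
  obtain J :: "'b::euclidean_space \<Rightarrow> 'a" where J: "linear J" "\<And>y. norm (J y) = norm y" "\<And>y. J y \<bullet> \<nu> = 0"
    "linear (\<lambda>(y, t). J y + t *\<^sub>R \<nu>)" "\<And>p. norm ((\<lambda>(y, t). J y + t *\<^sub>R \<nu>) p) = norm p"
    and nsq: "\<And>y t. (norm (J y + t *\<^sub>R \<nu>))\<^sup>2 = (norm y)\<^sup>2 + t\<^sup>2"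
    by (rule hyperplane_coordinates[OF height_functionD(1)[OF h] d]) (rule that)
  define \<gamma> where "\<gamma> y = J y - h (J y) *\<^sub>R \<nu>" for y
  define P where "P = {x\<in>A. 0 < h x \<and> h x < b}"
  define D where "D = {y. J y \<in> A}"
  have cJ: "continuous_on UNIV J" by (rule linear_continuous_on[OF linear_conv_bounded_linear[THEN iffD1, OF J(1)]])
  have ch: "continuous_on UNIV h" by (rule height_functionD(5)[OF h])
  have c\<gamma>: "continuous_on UNIV \<gamma>"
    unfolding \<gamma>_def by (intro continuous_intros cJ continuous_on_compose2[OF ch cJ]) auto
  have [measurable]: "J \<in> borel_measurable borel" "h \<in> borel_measurable borel" "\<gamma> \<in> borel_measurable borel"
     "\<phi> \<in> borel_measurable borel" "\<phi>' \<in> borel_measurable borel"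
    using cJ ch c\<gamma> \<phi> by (auto intro: borel_measurable_continuous_onI)
  have [measurable]: "A \<in> sets borel" using A(1) by simp
  have P[measurable]: "P \<in> sets borel" unfolding P_def by measurable
  have D[measurable]: "D \<in> sets borel" unfolding D_def by measurable
  have h\<gamma>: "h (\<gamma> y + t *\<^sub>R \<nu>) = t" for y t
    using height_functionD(2)[OF h, of "J y" "t - h (J y)"] by (simp add: \<gamma>_def algebra_simps)
  have A\<gamma>: "\<gamma> y + t *\<^sub>R \<nu> \<in> A \<longleftrightarrow> y \<in> D" for y t
    using A(2)[of "J y" "t - h (J y)"] by (simp add: \<gamma>_def D_def algebra_simps)
  have fubini: "(\<integral>\<^sup>+x. G x * indicator P x \<partial>lborel) =
      (\<integral>\<^sup>+y. (\<integral>\<^sup>+t. G (\<gamma> y + t *\<^sub>R \<nu>) * indicator {0<..<b} t \<partial>lborel) * indicator D y \<partial>lborel)"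
    if [measurable]: "G \<in> borel_measurable borel" for G :: "'a \<Rightarrow> ennreal"
  proof -
    have "(\<integral>\<^sup>+x. G x * indicator P x \<partial>lborel) =
        (\<integral>\<^sup>+p. (\<lambda>x. G x * indicator P x) ((\<lambda>(y, t). J y + t *\<^sub>R \<nu>) p) \<partial>lborel)"
      using d by (intro nn_integral_linear_isometry[symmetric] J) (simp, measurable)
    also have "\<dots> = (\<integral>\<^sup>+p. (\<lambda>x. G x * indicator P x) ((\<lambda>(y, t). J y + t *\<^sub>R \<nu>) p) \<partial>(lborel \<Otimes>\<^sub>M lborel))"
      by (simp only: lborel_prod)
    also have "\<dots> = (\<integral>\<^sup>+y. \<integral>\<^sup>+t. G (J y + t *\<^sub>R \<nu>) * indicator P (J y + t *\<^sub>R \<nu>) \<partial>lborel \<partial>lborel)"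
      by (subst lborel.nn_integral_fst[symmetric]) (auto simp: split_beta)
    also have "\<dots> = (\<integral>\<^sup>+y. (\<integral>\<^sup>+t. G (\<gamma> y + t *\<^sub>R \<nu>) * indicator {0<..<b} t \<partial>lborel) * indicator D y \<partial>lborel)"
    proof (rule nn_integral_cong)
      fix y
      have "(\<integral>\<^sup>+t. G (J y + t *\<^sub>R \<nu>) * indicator P (J y + t *\<^sub>R \<nu>) \<partial>lborel) =
         (\<integral>\<^sup>+t. (\<lambda>t. G (J y + t *\<^sub>R \<nu>) * indicator P (J y + t *\<^sub>R \<nu>)) (- h (J y) + t) \<partial>lborel)"
        by (rule nn_integral_lborel_translate[symmetric]) measurable
      also have "\<dots> = (\<integral>\<^sup>+t. G (\<gamma> y + t *\<^sub>R \<nu>) * indicator P (\<gamma> y + t *\<^sub>R \<nu>) \<partial>lborel)"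
        by (simp add: \<gamma>_def algebra_simps)
      also have "\<dots> = (\<integral>\<^sup>+t. G (\<gamma> y + t *\<^sub>R \<nu>) * indicator {0<..<b} t * indicator D y \<partial>lborel)"
        by (intro nn_integral_cong) (auto simp: indicator_def P_def h\<gamma> A\<gamma>)
      also have "\<dots> = (\<integral>\<^sup>+t. G (\<gamma> y + t *\<^sub>R \<nu>) * indicator {0<..<b} t \<partial>lborel) * indicator D y"
        by (rule nn_integral_multc) measurable
      finally show "(\<integral>\<^sup>+t. G (J y + t *\<^sub>R \<nu>) * indicator P (J y + t *\<^sub>R \<nu>) \<partial>lborel) = \<dots>" .
    qed
    finally show ?thesis .
  qed
  have vd: "((\<lambda>t. \<phi> (\<gamma> y + t *\<^sub>R \<nu>)) has_vector_derivative \<phi>' (\<gamma> y + t *\<^sub>R \<nu>)) (at t)" for y t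
  proof -
    have "((\<lambda>r. \<phi> ((\<gamma> y + t *\<^sub>R \<nu>) + r *\<^sub>R \<nu>)) has_vector_derivative \<phi>' (\<gamma> y + t *\<^sub>R \<nu>)) (at (t - t))"
      using \<phi>(3) by simp
    then have "((\<lambda>r. \<phi> ((\<gamma> y + t *\<^sub>R \<nu>) + r *\<^sub>R \<nu>)) \<circ> (\<lambda>r. r - t) has_vector_derivative 1 *\<^sub>R \<phi>' (\<gamma> y + t *\<^sub>R \<nu>)) (at t)"
      by (intro vector_diff_chain_at) (auto intro!: derivative_eq_intros)
    then show ?thesis by (simp add: o_def algebra_simps)
  qed
  have "(\<integral>\<^sup>+x. ennreal ((norm (\<phi> x) / (h x + s))\<^sup>2) * indicator P x \<partial>lborel)
     = (\<integral>\<^sup>+y. (\<integral>\<^sup>+t. ennreal ((norm (\<phi> (\<gamma> y + t *\<^sub>R \<nu>)) / (t + s))\<^sup>2) * indicator {0<..<b} t \<partial>lborel) * indicator D y \<partial>lborel)"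
    by (subst fubini) (simp_all add: h\<gamma>)
  also have "\<dots> \<le> (\<integral>\<^sup>+y. (ennreal (2 / s) * ennreal ((norm (\<phi> (\<gamma> y)))\<^sup>2)
       + 4 * (\<integral>\<^sup>+t. ennreal ((norm (\<phi>' (\<gamma> y + t *\<^sub>R \<nu>)))\<^sup>2) * indicator {0<..<b} t \<partial>lborel)) * indicator D y \<partial>lborel)"
  proof (intro nn_integral_mono mult_right_mono)
    fix y
    have "continuous_on UNIV (\<lambda>t. \<phi>' (\<gamma> y + t *\<^sub>R \<nu>))"
      by (intro continuous_on_compose2[OF \<phi>(2)] continuous_intros) auto
    from hardy_interval[OF s b vd this]
    show "(\<integral>\<^sup>+t. ennreal ((norm (\<phi> (\<gamma> y + t *\<^sub>R \<nu>)) / (t + s))\<^sup>2) * indicator {0<..<b} t \<partial>lborel)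
      \<le> ennreal (2 / s) * ennreal ((norm (\<phi> (\<gamma> y)))\<^sup>2)
       + 4 * (\<integral>\<^sup>+t. ennreal ((norm (\<phi>' (\<gamma> y + t *\<^sub>R \<nu>)))\<^sup>2) * indicator {0<..<b} t \<partial>lborel)"
      using s by (simp add: ennreal_mult[symmetric])
  qed simp
  also have "\<dots> = ennreal (2 / s) * (\<integral>\<^sup>+y. ennreal ((norm (\<phi> (\<gamma> y)))\<^sup>2) * indicator D y \<partial>lborel)
     + 4 * (\<integral>\<^sup>+y. (\<integral>\<^sup>+t. ennreal ((norm (\<phi>' (\<gamma> y + t *\<^sub>R \<nu>)))\<^sup>2) * indicator {0<..<b} t \<partial>lborel) * indicator D y \<partial>lborel)"
    by (simp add: distrib_right nn_integral_add nn_integral_cmult mult.assoc)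
  also have "\<dots> \<le> ennreal (2 / s) * (2 ^ DIM('b) * (\<integral>\<^sup>+x. ennreal ((norm (\<phi> x))\<^sup>2) \<partial>surface_measure \<Omega>))
     + 4 * (\<integral>\<^sup>+x. ennreal ((norm (\<phi>' x))\<^sup>2) * indicator P x \<partial>lborel)"
  proof (intro add_mono mult_left_mono)
    show "(\<integral>\<^sup>+y. ennreal ((norm (\<phi> (\<gamma> y)))\<^sup>2) * indicator D y \<partial>lborel)
       \<le> 2 ^ DIM('b) * (\<integral>\<^sup>+x. ennreal ((norm (\<phi> x))\<^sup>2) \<partial>surface_measure \<Omega>)"
    proof (rule graph_integral_le_surface_integral[OF d])
      show "dist x y \<le> dist (\<gamma> x) (\<gamma> y)" for x y
        unfolding \<gamma>_def by (rule graph_expands[OF h J(1-3) nsq])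
      show "\<gamma> ` D \<subseteq> frontier \<Omega>" using h\<gamma>[of _ 0] A\<gamma>[of _ 0] sub by auto
    qed measurable
  qed (simp_all add: fubini)
  finally show ?thesis unfolding P_def .
qed

section \<open>A uniform collar of the boundary\<close>

definition off_axis :: "'a::real_inner \<Rightarrow> 'a \<Rightarrow> 'a" where
  "off_axis \<nu> x = x - (x \<bullet> \<nu>) *\<^sub>R \<nu>"

lemma off_axis_add: "norm \<nu> = 1 \<Longrightarrow> off_axis \<nu> (x + t *\<^sub>R \<nu>) = off_axis \<nu> x"
  by (simp add: off_axis_def inner_add_left dot_square_norm algebra_simps)

lemma off_axis_diff: "off_axis \<nu> (x - y) = off_axis \<nu> x - off_axis \<nu> y"
  by (simp add: off_axis_def inner_diff_left algebra_simps)

lemma norm_off_axis_le: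
  assumes "norm \<nu> = 1" shows "norm (off_axis \<nu> x) \<le> norm x"
proof (rule power2_le_imp_le)
  have "(norm (off_axis \<nu> x))\<^sup>2 = (norm x)\<^sup>2 - (x \<bullet> \<nu>)\<^sup>2"
  proof -
    have "\<nu> \<bullet> \<nu> = 1" using assms by (simp add: dot_square_norm)
    then show ?thesis unfolding off_axis_def power2_norm_eq_inner
      by (simp add: inner_diff_left inner_diff_right inner_commute power2_eq_square)
  qed
  then show "(norm (off_axis \<nu> x))\<^sup>2 \<le> (norm x)\<^sup>2" by simp
qed simp

lemma dist_off_axis_le: "norm \<nu> = 1 \<Longrightarrow> dist (off_axis \<nu> x) (off_axis \<nu> y) \<le> dist x y"
  using norm_off_axis_le[of \<nu> "x - y"] by (simp add: dist_norm off_axis_diff)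

lemma Ck_1_lipschitz_on_cball:
  fixes g :: "'a::euclidean_space \<Rightarrow> real"
  assumes g: "Ck 1 g"
  obtains B where "B \<ge> 0" "\<And>x y. x \<in> cball p r \<Longrightarrow> y \<in> cball p r \<Longrightarrow> \<bar>g x - g y\<bar> \<le> B * dist x y"
proof -
  have "bounded (grad g ` cball p r)"
    by (intro compact_imp_bounded compact_continuous_image compact_cball
        continuous_on_subset[OF continuous_on_grad[OF g]]) auto
  then obtain B where B: "B > 0" "\<And>x. x \<in> cball p r \<Longrightarrow> norm (grad g x) \<le> B"
    by (auto simp: bounded_pos)
  have "\<bar>g x - g y\<bar> \<le> B * dist x y" if "x \<in> cball p r" "y \<in> cball p r" for x y
  proof -
    have "norm (g x - g y) \<le> B * norm (x - y)"
    proof (rule differentiable_bound[OF convex_cball[of p r] _ _ that])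
      fix z assume z: "z \<in> cball p r"
      show "(g has_derivative (\<lambda>h. grad g z \<bullet> h)) (at z within cball p r)"
        by (rule has_derivative_at_withinI[OF has_derivative_grad[OF g]])
      show "onorm (\<lambda>h. grad g z \<bullet> h) \<le> B"
      proof (rule onorm_le)
        fix h
        have "norm (grad g z \<bullet> h) \<le> norm (grad g z) * norm h" by (simp add: Cauchy_Schwarz_ineq2)
        also have "\<dots> \<le> B * norm h" using B(2)[OF z] by (rule mult_right_mono) simp
        finally show "norm (grad g z \<bullet> h) \<le> B * norm h" .
      qed
    qed
    then show ?thesis by (simp add: dist_norm)
  qed
  with B show ?thesis using that[of B] by force
qed

text \<open>
  \<open>g\<close> is Lipschitz on balls only.  Composing it with the nearest-point projection to a ball makes it
  globally Lipschitz and does not change it near \<open>p\<close>.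
\<close>

lemma C2_boundary_local_height:
  fixes \<Omega> :: "'a::euclidean_space set"
  assumes C2: "C2_boundary \<Omega>" and p: "p \<in> frontier \<Omega>"
  obtains r \<nu> L h where "r > 0" "height_function \<nu> L h" "\<And>x. x \<in> ball p r \<Longrightarrow> x \<in> \<Omega> \<longleftrightarrow> 0 < h x"
proof -
  obtain r \<nu> g where r: "r > 0" and nu: "norm \<nu> = 1" and g: "Ck 2 (g :: 'a \<Rightarrow> real)"
    and loc: "\<And>x. x \<in> ball p r \<Longrightarrow> x \<in> \<Omega> \<longleftrightarrow> g (off_axis \<nu> x) < x \<bullet> \<nu>"
    using C2 p unfolding C2_boundary_def off_axis_def by metis
  have "Ck (Suc 1) g" using g by (simp add: numeral_2_eq_2)
  then have g1: "Ck 1 g" by (rule Ck_Suc_imp_Ck)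
  define p' where "p' = off_axis \<nu> p"
  define q where "q = closest_point (cball p' r)"
  have q_in: "q x \<in> cball p' r" for x
    unfolding q_def using r by (intro closest_point_in_set) auto
  obtain B where B: "B \<ge> 0" "\<And>x y. x \<in> cball p' r \<Longrightarrow> y \<in> cball p' r \<Longrightarrow> \<bar>g x - g y\<bar> \<le> B * dist x y"
    using Ck_1_lipschitz_on_cball[OF g1] by blast
  define h where "h x = x \<bullet> \<nu> - g (q (off_axis \<nu> x))" for x
  show ?thesis
  proof (rule that[OF r])
    show "height_function \<nu> (1 + B) h"
      unfolding height_function_def
    proof (intro conjI allI nu)
      fix x t show "h (x + t *\<^sub>R \<nu>) = h x + t"
        using nu by (simp add: h_def off_axis_add inner_add_left dot_square_norm)
    next
      fix x y
      have "\<bar>g (q (off_axis \<nu> x)) - g (q (off_axis \<nu> y))\<bar> \<le> B * dist (q (off_axis \<nu> x)) (q (off_axis \<nu> y))"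
        by (intro B q_in)
      also have "\<dots> \<le> B * dist (off_axis \<nu> x) (off_axis \<nu> y)"
        unfolding q_def using r by (intro mult_left_mono B(1) closest_point_lipschitz) auto
      also have "\<dots> \<le> B * dist x y"
        by (intro mult_left_mono B(1) dist_off_axis_le nu)
      finally have "\<bar>g (q (off_axis \<nu> x)) - g (q (off_axis \<nu> y))\<bar> \<le> B * dist x y" .
      moreover have "\<bar>(x - y) \<bullet> \<nu>\<bar> \<le> dist x y"
        using Cauchy_Schwarz_ineq2[of "x - y" \<nu>] nu by (simp add: dist_norm)
      ultimately show "\<bar>h x - h y\<bar> \<le> (1 + B) * dist x y"
        by (simp add: h_def inner_diff_left algebra_simps)
    qed
  next
    fix x assume x: "x \<in> ball p r"
    have "dist p' (off_axis \<nu> x) \<le> dist p x" unfolding p'_def by (rule dist_off_axis_le[OF nu])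
    then have "q (off_axis \<nu> x) = off_axis \<nu> x"
      unfolding q_def using x by (intro closest_point_self) simp
    then show "x \<in> \<Omega> \<longleftrightarrow> 0 < h x" using loc[OF x] by (simp add: h_def)
  qed
qed

lemma frontier_eq_level_set:
  fixes \<Omega> :: "'a::euclidean_space set"
  assumes \<Omega>: "open \<Omega>" and h: "height_function \<nu> L h"
    and loc: "\<And>x. x \<in> ball p r \<Longrightarrow> x \<in> \<Omega> \<longleftrightarrow> 0 < h x" and x: "x \<in> ball p r"
  shows "x \<in> frontier \<Omega> \<longleftrightarrow> h x = 0"
proof
  assume "x \<in> frontier \<Omega>"
  then have cl: "x \<in> closure \<Omega>" and "x \<notin> \<Omega>"
    using \<Omega> by (auto simp: frontier_def interior_open)
  then have "h x \<le> 0" using loc[OF x] by simp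
  moreover have "\<not> h x < 0"
  proof
    assume neg: "h x < 0"
    have "open ({y. h y < 0} \<inter> ball p r)"
      by (intro open_Int open_ball open_Collect_less height_functionD(5)[OF h] continuous_on_const)
    then have "({y. h y < 0} \<inter> ball p r) \<inter> \<Omega> \<noteq> {}"
      using open_Int_closure_eq_empty[of "{y. h y < 0} \<inter> ball p r" \<Omega>] cl neg x by auto
    then show False using loc by force
  qed
  ultimately show "h x = 0" by simp
next
  assume hx: "h x = 0"
  then have "x \<notin> \<Omega>" using loc[OF x] by simp
  moreover have "x \<in> closure \<Omega>"
    unfolding closure_approachable
  proof (intro allI impI)
    fix e :: real assume e: "e > 0"
    define t where "t = min (e / 2) ((r - dist p x) / 2)"
    have "t \<le> e / 2" "t \<le> (r - dist p x) / 2" "t > 0" unfolding t_def using e x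
      by (simp_all only: min.cobounded1 min.cobounded2 min_less_iff_conj) auto
    then have t: "t > 0" "t < e" "t < r - dist p x" using e x by auto
    have "dist p (x + t *\<^sub>R \<nu>) \<le> dist p x + dist x (x + t *\<^sub>R \<nu>)" by (rule dist_triangle)
    also have "dist x (x + t *\<^sub>R \<nu>) = t" using t height_functionD(1)[OF h] by (simp add: dist_norm)
    finally have "x + t *\<^sub>R \<nu> \<in> ball p r" using t by simp
    then have "x + t *\<^sub>R \<nu> \<in> \<Omega>" using loc height_functionD(2)[OF h] hx t by simp
    moreover have "dist (x + t *\<^sub>R \<nu>) x < e" using t height_functionD(1)[OF h] by (simp add: dist_norm)
    ultimately show "\<exists>y\<in>\<Omega>. dist y x < e" by blast
  qed
  ultimately show "x \<in> frontier \<Omega>" using \<Omega> by (simp add: frontier_def interior_open)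
qed

text \<open>
  \<open>A\<close> is a union of lines parallel to \<open>\<nu>\<close>, so that the collar \<open>{x \<in> A. 0 < h x < b}\<close> is a product in
  coordinates with last axis \<open>\<nu>\<close>.  The last clause asserts that \<open>\<Omega>\<close> is described by the sign of \<open>h\<close> also in a
  ball around each point of the collar; it bounds the distance from the point to the complement
  of \<open>\<Omega>\<close> from below by a multiple of the height.
\<close>

definition collar_chart :: "'a::euclidean_space set \<Rightarrow> 'a \<Rightarrow> real \<Rightarrow> ('a \<Rightarrow> real) \<Rightarrow> 'a set \<Rightarrow> real \<Rightarrow> bool" where
  "collar_chart \<Omega> \<nu> L h A b \<longleftrightarrow> height_function \<nu> L h \<and> open A \<and> (\<forall>x t. x + t *\<^sub>R \<nu> \<in> A \<longleftrightarrow> x \<in> A) \<and> b > 0 \<and>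
     {x\<in>A. h x = 0} \<subseteq> frontier \<Omega> \<and>
     (\<forall>x y. x \<in> A \<longrightarrow> 0 < h x \<longrightarrow> h x < b \<longrightarrow> dist x y < h x \<longrightarrow> 0 < h y \<longrightarrow> y \<in> \<Omega>)"

definition collar_patch :: "'a::euclidean_space set \<Rightarrow> 'a set \<Rightarrow> bool" where
  "collar_patch \<Omega> P \<longleftrightarrow> (\<exists>\<nu> L h A b. collar_chart \<Omega> \<nu> L h A b \<and> P = {x\<in>A. 0 < h x \<and> h x < b})"

lemma local_collar_patch:
  fixes \<Omega> :: "'a::euclidean_space set"
  assumes \<Omega>: "open \<Omega>" and C2: "C2_boundary \<Omega>" and p: "p \<in> frontier \<Omega>"
  obtains P r where "collar_patch \<Omega> P" "r > 0" "\<Omega> \<inter> ball p r \<subseteq> P"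
proof -
  obtain r \<nu> L h where r: "r > 0" and h: "height_function \<nu> L h"
    and loc: "\<And>x. x \<in> ball p r \<Longrightarrow> x \<in> \<Omega> \<longleftrightarrow> 0 < h x"
    using C2_boundary_local_height[OF C2 p] by metis
  note H = height_functionD[OF h]
  have hp: "h p = 0" using frontier_eq_level_set[OF \<Omega> h loc] p r by simp
  \<comment> \<open>With this radius all points over the base with height below \<open>\<rho>\<close> stay within \<open>r / 2\<close> of \<open>p\<close>.\<close>
  define \<rho> where "\<rho> = r / (2 * (2 + L))"
  have \<rho>: "\<rho> > 0" "(2 + L) * \<rho> = r / 2" "\<rho> \<le> r / 2" using r H(4) by (auto simp: \<rho>_def field_simps)
  define A where "A = {x. norm (off_axis \<nu> (x - p)) < \<rho>}"
  have near: "dist p x < r / 2" if x: "x \<in> A" "0 \<le> h x" "h x < \<rho>" for x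
  proof -
    define t where "t = (x - p) \<bullet> \<nu>"
    have xeq: "x = (p + off_axis \<nu> (x - p)) + t *\<^sub>R \<nu>" by (simp add: off_axis_def t_def)
    then have hx: "h x = h (p + off_axis \<nu> (x - p)) + t" using H(2) by metis
    have "\<bar>h (p + off_axis \<nu> (x - p)) - h p\<bar> \<le> L * norm (off_axis \<nu> (x - p))"
      using H(3)[of "p + off_axis \<nu> (x - p)" p] by (simp add: dist_norm)
    also have "\<dots> \<le> L * \<rho>" using x H(4) by (intro mult_left_mono) (auto simp: A_def)
    finally have "\<bar>t\<bar> < \<rho> + L * \<rho>" using hx hp x by linarith
    moreover have "norm (x - p) \<le> norm (off_axis \<nu> (x - p)) + norm (t *\<^sub>R \<nu>)"
      using norm_triangle_ineq[of "off_axis \<nu> (x - p)" "t *\<^sub>R \<nu>"] by (simp add: off_axis_def t_def)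
    ultimately have "norm (x - p) < \<rho> + (\<rho> + L * \<rho>)" using x H(1) by (simp add: A_def)
    also have "\<dots> = r / 2" using \<rho>(2) by (simp add: algebra_simps)
    finally show ?thesis by (simp add: dist_norm norm_minus_commute)
  qed
  have "collar_chart \<Omega> \<nu> L h A \<rho>"
    unfolding collar_chart_def
  proof (intro conjI allI impI h \<rho>(1) subsetI)
    show "open A" unfolding A_def off_axis_def
      by (intro open_Collect_less continuous_intros)
    fix x t show "x + t *\<^sub>R \<nu> \<in> A \<longleftrightarrow> x \<in> A"
      using off_axis_add[OF H(1), of "x - p" t] by (simp add: A_def algebra_simps)
  next
    fix x assume x: "x \<in> {x \<in> A. h x = 0}"
    then have "dist p x < r / 2" using \<rho> by (intro near) auto
    then have "x \<in> ball p r" using r by simp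
    then show "x \<in> frontier \<Omega>" using frontier_eq_level_set[OF \<Omega> h loc] x by simp
  next
    fix x y assume a: "x \<in> A" "0 < h x" "h x < \<rho>" "dist x y < h x" "0 < h y"
    have "dist p y \<le> dist p x + dist x y" by (rule dist_triangle)
    also have "\<dots> < r / 2 + r / 2" using near[of x] a \<rho> by (intro add_strict_mono) auto
    finally show "y \<in> \<Omega>" using loc a by simp
  qed
  then have "collar_patch \<Omega> {x\<in>A. 0 < h x \<and> h x < \<rho>}" unfolding collar_patch_def by blast
  moreover have "\<rho> / L > 0" using \<rho> H(4) by simp
  moreover have "\<Omega> \<inter> ball p (\<rho> / L) \<subseteq> {x\<in>A. 0 < h x \<and> h x < \<rho>}"
  proof
    fix x assume x: "x \<in> \<Omega> \<inter> ball p (\<rho> / L)"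
    have "\<rho> / L \<le> \<rho>" using \<rho> H(4) by (simp add: field_simps)
    then have d: "dist p x < \<rho>" using x by simp
    then have "0 < h x" using loc[of x] x \<rho> r by simp
    moreover have "norm (off_axis \<nu> (x - p)) < \<rho>"
      using norm_off_axis_le[OF H(1), of "x - p"] d by (simp add: dist_norm norm_minus_commute)
    moreover have "h x \<le> L * dist p x" using H(3)[of x p] hp by (simp add: dist_commute)
    then have "h x < \<rho>" using x H(4) by (auto simp: field_simps)
    ultimately show "x \<in> {x\<in>A. 0 < h x \<and> h x < \<rho>}" by (simp add: A_def)
  qed
  ultimately show ?thesis by (rule that)
qed

text \<open>
  A finite cover of the compact set by balls also covers a neighbourhood of it.
\<close>

lemma compact_collar_cover:
  fixes \<Omega> :: "'a::euclidean_space set"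
  assumes \<Omega>: "open \<Omega>" and C2: "C2_boundary \<Omega>" and K: "compact K" "K \<subseteq> frontier \<Omega>"
  obtains \<P> \<eta> where "finite \<P>" "\<And>P. P \<in> \<P> \<Longrightarrow> collar_patch \<Omega> P" "\<eta> > 0"
    "\<And>x p. x \<in> \<Omega> \<Longrightarrow> p \<in> K \<Longrightarrow> dist x p < \<eta> \<Longrightarrow> x \<in> \<Union>\<P>"
proof -
  have "\<forall>p\<in>K. \<exists>P r. collar_patch \<Omega> P \<and> r > 0 \<and> \<Omega> \<inter> ball p r \<subseteq> P"
    using local_collar_patch[OF \<Omega> C2] K(2) by (metis subsetD)
  then obtain P r where Pr: "\<And>p. p \<in> K \<Longrightarrow> collar_patch \<Omega> (P p)" "\<And>p. p \<in> K \<Longrightarrow> r p > 0"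
      "\<And>p. p \<in> K \<Longrightarrow> \<Omega> \<inter> ball p (r p) \<subseteq> P p" by metis
  have "K \<subseteq> (\<Union>p\<in>K. ball p (r p))" using Pr(2) by force
  then obtain C where C: "C \<subseteq> K" "finite C" "K \<subseteq> (\<Union>p\<in>C. ball p (r p))"
    using compactE_image[OF K(1), of K "\<lambda>p. ball p (r p)"] by auto
  have "open (\<Union>p\<in>C. ball p (r p))" by auto
  from compact_subset_open_imp_ball_epsilon_subset[OF K(1) this C(3)]
  obtain \<eta> where \<eta>: "\<eta> > 0" "(\<Union>p\<in>K. ball p \<eta>) \<subseteq> (\<Union>p\<in>C. ball p (r p))" by blast
  show ?thesis
  proof (rule that[of "P ` C" \<eta>])
    fix x p assume x: "x \<in> \<Omega>" "p \<in> K" "dist x p < \<eta>"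
    then have "x \<in> ball p \<eta>" by (simp add: dist_commute)
    then have "x \<in> (\<Union>p\<in>C. ball p (r p))" using \<eta>(2) x(2) by blast
    then show "x \<in> \<Union> (P ` C)" using x(1) Pr(3) C(1) by blast
  qed (use C Pr \<eta> in auto)
qed

text \<open>
  After a translation the map fixes 0 and preserves inner products, and then the square of its deviation
  from linearity expands to 0.
\<close>

lemma isometry_affine:
  fixes \<Phi> :: "'b::real_inner \<Rightarrow> 'a::real_inner"
  assumes iso: "\<And>p q. dist (\<Phi> p) (\<Phi> q) = dist p q"
  shows "\<Phi> (x + t *\<^sub>R v) = \<Phi> x + t *\<^sub>R (\<Phi> v - \<Phi> 0)"
proof -
  define F where "F p = \<Phi> p - \<Phi> 0" for p
  have n: "norm (F p - F q) = norm (p - q)" for p q using iso[of p q] by (simp add: F_def dist_norm)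
  have n0: "norm (F p) = norm p" for p using n[of p 0] by (simp add: F_def)
  have ip: "F p \<bullet> F q = p \<bullet> q" for p q
    using n[of p q] n0[of p] n0[of q] by (simp add: dot_norm_neg)
  have "(F (x + t *\<^sub>R v) - F x - t *\<^sub>R F v) \<bullet> (F (x + t *\<^sub>R v) - F x - t *\<^sub>R F v) = 0"
    by (simp add: inner_diff_left inner_diff_right ip inner_add_left inner_add_right algebra_simps inner_commute)
  then have "F (x + t *\<^sub>R v) - F x - t *\<^sub>R F v = 0" by (rule inner_eq_zero_iff[THEN iffD1])
  then show ?thesis by (simp add: F_def algebra_simps)
qed

text \<open>
  A chart of a cross-section, multiplied by the far part \<open>|z| > Z\<close> of the axis, is a chart of \<open>\<Omega>\<close> with the
  same constants.  This is what makes the collar uniform up to infinity.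
\<close>

lemma outlet_collar_patch:
  fixes \<Omega> :: "'a::euclidean_space set" and \<Phi> :: "'b::euclidean_space \<times> real \<Rightarrow> 'a"
  assumes \<Phi>: "bij \<Phi>" and iso: "\<And>p q. dist (\<Phi> p) (\<Phi> q) = dist p q"
    and fr: "\<And>y z. y \<in> frontier \<omega> \<Longrightarrow> norm (\<Phi> (y, z)) > R \<Longrightarrow> \<Phi> (y, z) \<in> frontier \<Omega>"
    and inn: "\<And>y z. y \<in> \<omega> \<Longrightarrow> norm (\<Phi> (y, z)) > R \<Longrightarrow> \<Phi> (y, z) \<in> \<Omega>"
    and P': "collar_patch \<omega> P'"
  obtains P Z where "collar_patch \<Omega> P" "\<And>y z. y \<in> P' \<Longrightarrow> \<bar>z\<bar> > Z \<Longrightarrow> \<Phi> (y, z) \<in> P"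
proof -
  obtain \<nu>' L h' A' b where ch: "collar_chart \<omega> \<nu>' L h' A' b" and P'_eq: "P' = {x\<in>A'. 0 < h' x \<and> h' x < b}"
    using P' unfolding collar_patch_def by blast
  have h': "height_function \<nu>' L h'" and A': "open A'" "\<And>x t. x + t *\<^sub>R \<nu>' \<in> A' \<longleftrightarrow> x \<in> A'" and b: "b > 0"
    and fr': "\<And>x. x \<in> A' \<Longrightarrow> h' x = 0 \<Longrightarrow> x \<in> frontier \<omega>"
    and in': "\<And>x y. x \<in> A' \<Longrightarrow> 0 < h' x \<Longrightarrow> h' x < b \<Longrightarrow> dist x y < h' x \<Longrightarrow> 0 < h' y \<Longrightarrow> y \<in> \<omega>"
    using ch unfolding collar_chart_def by blast+
  define \<Psi> where "\<Psi> = inv \<Phi>"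
  have \<Psi>\<Phi>: "\<Psi> (\<Phi> p) = p" for p unfolding \<Psi>_def using \<Phi> by (simp add: bij_is_inj)
  have \<Phi>\<Psi>: "\<Phi> (\<Psi> x) = x" for x unfolding \<Psi>_def using \<Phi> by (simp add: bij_is_surj surj_f_inv_f)
  have iso\<Psi>: "dist (\<Psi> x) (\<Psi> y) = dist x y" for x y using iso[of "\<Psi> x" "\<Psi> y"] by (simp add: \<Phi>\<Psi>)
  have cont\<Psi>: "continuous_on UNIV \<Psi>"
    by (rule continuous_onI) (use iso\<Psi> in force)
  define c where "c = norm (\<Phi> 0)"
  have big: "norm (\<Phi> (y, z)) \<ge> \<bar>z\<bar> - c" for y z
  proof -
    have "\<bar>z\<bar> \<le> norm (y, z)" using norm_snd_le[of z y] by simp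
    also have "\<dots> = dist (\<Phi> (y, z)) (\<Phi> 0)" by (simp add: iso)
    also have "\<dots> \<le> norm (\<Phi> (y, z)) + c" unfolding dist_norm c_def by (rule norm_triangle_ineq4)
    finally show ?thesis by simp
  qed
  \<comment> \<open>Points within \<open>b\<close> of the far part \<open>|z| > Z\<close> still have norm larger than \<open>R\<close>.\<close>
  define Z where "Z = \<bar>R\<bar> + c + b + 1"
  define \<nu> where "\<nu> = \<Phi> (\<nu>', 0) - \<Phi> 0"
  have nu: "norm \<nu> = 1"
    using iso[of "(\<nu>', 0)" 0] height_functionD(1)[OF h'] by (simp add: \<nu>_def dist_norm norm_Pair)
  have shift: "\<Psi> (x + t *\<^sub>R \<nu>) = \<Psi> x + t *\<^sub>R (\<nu>', 0)" for x t
  proof -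
    have "\<Phi> (\<Psi> x + t *\<^sub>R (\<nu>', 0)) = x + t *\<^sub>R \<nu>"
      unfolding \<nu>_def by (subst isometry_affine[OF iso]) (simp add: \<Phi>\<Psi>)
    then show ?thesis by (metis \<Psi>\<Phi>)
  qed
  define h where "h x = h' (fst (\<Psi> x))" for x
  define A where "A = {x. fst (\<Psi> x) \<in> A' \<and> Z < \<bar>snd (\<Psi> x)\<bar>}"
  have fstd: "dist (fst (\<Psi> x)) (fst (\<Psi> y)) \<le> dist x y" for x y
    using dist_fst_le[of "\<Psi> x" "\<Psi> y"] by (simp add: iso\<Psi>)
  have sndd: "\<bar>snd (\<Psi> x) - snd (\<Psi> y)\<bar> \<le> dist x y" for x y
    using dist_snd_le[of "\<Psi> x" "\<Psi> y"] by (simp add: iso\<Psi> dist_real_def)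
  have "collar_chart \<Omega> \<nu> L h A b"
    unfolding collar_chart_def
  proof (intro conjI allI impI b subsetI)
    show "height_function \<nu> L h"
      unfolding height_function_def
    proof (intro conjI allI nu)
      show "h (x + t *\<^sub>R \<nu>) = h x + t" for x t
        using height_functionD(2)[OF h'] by (simp add: h_def shift)
      show "\<bar>h x - h y\<bar> \<le> L * dist x y" for x y
        unfolding h_def
        by (rule order_trans[OF height_functionD(3)[OF h'] mult_left_mono[OF fstd]])
           (use height_functionD(4)[OF h'] in simp)
    qed
    have "A = (\<lambda>x. fst (\<Psi> x)) -` A' \<inter> {x. Z < \<bar>snd (\<Psi> x)\<bar>}" by (auto simp: A_def)
    moreover have "open ((\<lambda>x. fst (\<Psi> x)) -` A')"
      by (intro open_vimage A' continuous_intros cont\<Psi>)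
    moreover have "open {x. Z < \<bar>snd (\<Psi> x)\<bar>}"
      by (intro open_Collect_less continuous_intros cont\<Psi>)
    ultimately show "open A" by auto
    show "x + t *\<^sub>R \<nu> \<in> A \<longleftrightarrow> x \<in> A" for x t
      using A'(2) by (simp add: A_def shift)
  next
    fix x assume x: "x \<in> {x \<in> A. h x = 0}"
    obtain y z where yz: "\<Psi> x = (y, z)" by fastforce
    have xeq: "x = \<Phi> (y, z)" using \<Phi>\<Psi>[of x] yz by simp
    have "\<bar>z\<bar> > Z" using x yz by (simp add: A_def)
    then have "norm (\<Phi> (y, z)) > R" using big[of z y] b unfolding Z_def by linarith
    moreover have "y \<in> frontier \<omega>" using x yz fr' by (simp add: A_def h_def)
    ultimately show "x \<in> frontier \<Omega>" using fr xeq by simp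
  next
    fix x y assume a: "x \<in> A" "0 < h x" "h x < b" "dist x y < h x" "0 < h y"
    obtain y' z' where yz: "\<Psi> y = (y', z')" by fastforce
    have xeq: "y = \<Phi> (y', z')" using \<Phi>\<Psi>[of y] yz by simp
    have "\<bar>snd (\<Psi> x) - z'\<bar> < b" using sndd[of x y] a(3,4) yz by simp
    moreover have "Z < \<bar>snd (\<Psi> x)\<bar>" using a(1) by (simp add: A_def)
    ultimately have "\<bar>z'\<bar> > Z - b" by linarith
    then have "norm (\<Phi> (y', z')) > R" using big[of z' y'] unfolding Z_def by linarith
    moreover have "y' \<in> \<omega>"
      by (rule in'[of "fst (\<Psi> x)"]) (use a fstd[of x y] yz in \<open>auto simp: A_def h_def\<close>)
    ultimately show "y \<in> \<Omega>" using inn xeq by simp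
  qed
  then have "collar_patch \<Omega> {x\<in>A. 0 < h x \<and> h x < b}" unfolding collar_patch_def by blast
  moreover have "\<Phi> (y, z) \<in> {x\<in>A. 0 < h x \<and> h x < b}" if "y \<in> P'" "\<bar>z\<bar> > Z" for y z
    using that by (simp add: P'_eq A_def h_def \<Psi>\<Phi>)
  ultimately show ?thesis by (rule that)
qed


lemma exists_frontier_between:
  fixes \<Omega> :: "'a::euclidean_space set"
  assumes "x \<in> \<Omega>" "q \<notin> \<Omega>"
  obtains p where "p \<in> frontier \<Omega>" "dist x p \<le> dist x q"
proof -
  have "closed_segment x q \<inter> frontier \<Omega> \<noteq> {}"
    using assms by (intro connected_Int_frontier connected_segment) auto
  then obtain p where "p \<in> closed_segment x q" "p \<in> frontier \<Omega>" by blast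
  then show ?thesis using that segment_bound1[of p x q] by (simp add: dist_norm norm_minus_commute)
qed

text \<open>
  The boundary inside a large ball is compact.  A point \<open>x\<close> of \<open>\<Omega>\<close> near a boundary point outside this
  ball lies in one of the cylinders, and its cross-section coordinate is near the boundary of the
  cross-section, which is compact too.
\<close>

lemma finite_collar_cover:
  fixes \<Omega> :: "'a::euclidean_space set" and \<omega> :: "nat \<Rightarrow> 'b::euclidean_space set"
  assumes \<Omega>: "open \<Omega>" and C2: "C2_boundary \<Omega>" and out: "cylindrical_outlets \<Omega> N \<omega> \<Phi>"
  obtains \<P> \<eta> where "finite \<P>" "\<And>P. P \<in> \<P> \<Longrightarrow> collar_patch \<Omega> P" "\<eta> > 0"
    "\<And>x p. x \<in> \<Omega> \<Longrightarrow> p \<in> frontier \<Omega> \<Longrightarrow> dist x p < \<eta> \<Longrightarrow> x \<in> \<Union>\<P>"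
proof -
  define J where "J = {1..N}"
  have bij: "\<And>j. j \<in> J \<Longrightarrow> bij (\<Phi> j)" and iso: "\<And>j p q. j \<in> J \<Longrightarrow> dist (\<Phi> j p) (\<Phi> j q) = dist p q"
    and dom: "\<And>j. j \<in> J \<Longrightarrow> open (\<omega> j)" and bd: "\<And>j. j \<in> J \<Longrightarrow> bounded (\<omega> j)"
    and C2\<omega>: "\<And>j. j \<in> J \<Longrightarrow> C2_boundary (\<omega> j)"
    and disj: "disjoint_family_on (\<lambda>j. cylinder (\<Phi> j) (\<omega> j)) J"
    using out unfolding cylindrical_outlets_def cartesian_coords_def domain_def J_def by auto
  obtain R where R: "\<And>x. norm x > R \<Longrightarrow> x \<in> \<Omega> \<longleftrightarrow> x \<in> (\<Union>j\<in>J. cylinder (\<Phi> j) (\<omega> j))"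
    using out unfolding cylindrical_outlets_def J_def by blast
  have fJ: "finite J" by (simp add: J_def)
  have cyl_iff: "\<Phi> j (y, z) \<in> cylinder (\<Phi> j) (\<omega> j) \<longleftrightarrow> y \<in> \<omega> j" if "j \<in> J" for j y z
  proof -
    have "inj (\<Phi> j)" using bij[OF that] by (rule bij_is_inj)
    then show ?thesis unfolding cylinder_def by (auto dest: injD)
  qed
  have inn: "\<Phi> j (y, z) \<in> \<Omega>" if "j \<in> J" "y \<in> \<omega> j" "norm (\<Phi> j (y, z)) > R" for j y z
    using R[OF that(3)] cyl_iff[OF that(1), of y z] that by blast
  have cyl_open: "open (cylinder (\<Phi> j) (\<omega> j))" if j: "j \<in> J" for j
    unfolding open_dist
  proof
    fix x assume "x \<in> cylinder (\<Phi> j) (\<omega> j)"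
    then obtain y z where yz: "x = \<Phi> j (y, z)" "y \<in> \<omega> j" by (auto simp: cylinder_def)
    then obtain e where e: "e > 0" "\<And>y'. dist y' y < e \<Longrightarrow> y' \<in> \<omega> j"
      using dom[OF j] by (auto simp: open_dist)
    have "x' \<in> cylinder (\<Phi> j) (\<omega> j)" if "dist x' x < e" for x'
    proof -
      obtain y' z' where x': "x' = \<Phi> j (y', z')" using bij_is_surj[OF bij[OF j]] by (metis surjD surj_pair)
      have "dist y' y \<le> dist x' x"
        using dist_fst_le[of "(y', z')" "(y, z)"] by (simp add: x' yz iso[OF j])
      then show ?thesis using that e(2) cyl_iff[OF j] x' by auto
    qed
    with e(1) show "\<exists>e>0. \<forall>x'. dist x' x < e \<longrightarrow> x' \<in> cylinder (\<Phi> j) (\<omega> j)" by blast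
  qed
  have fr: "\<Phi> j (y, z) \<in> frontier \<Omega>" if j: "j \<in> J" and y: "y \<in> frontier (\<omega> j)" and big: "norm (\<Phi> j (y, z)) > R" for j y z
  proof -
    have yn: "y \<notin> \<omega> j" "y \<in> closure (\<omega> j)"
      using y dom[OF j] by (auto simp: frontier_def interior_open)
    have approx: "\<exists>y'\<in>\<omega> j. dist (\<Phi> j (y', z)) (\<Phi> j (y, z)) < e" if "e > 0" for e
    proof -
      obtain y' where "y' \<in> \<omega> j" "dist y' y < e" using yn(2) \<open>e > 0\<close> unfolding closure_approachable by blast
      then show ?thesis by (intro bexI[of _ y']) (simp_all add: iso[OF j] dist_Pair_Pair)
    qed
    \<comment> \<open>The point lies in the closure of its own cylinder, so an open cylinder around it would meet that one.\<close>
    have "\<Phi> j (y, z) \<notin> cylinder (\<Phi> i) (\<omega> i)" if i: "i \<in> J" for i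
    proof (cases "i = j")
      case True
      then show ?thesis using cyl_iff[OF j] yn by simp
    next
      case False
      show ?thesis
      proof
        assume "\<Phi> j (y, z) \<in> cylinder (\<Phi> i) (\<omega> i)"
        then obtain e where e: "e > 0" "\<And>x'. dist x' (\<Phi> j (y, z)) < e \<Longrightarrow> x' \<in> cylinder (\<Phi> i) (\<omega> i)"
          using cyl_open[OF i] by (auto simp: open_dist)
        obtain y' where "y' \<in> \<omega> j" "dist (\<Phi> j (y', z)) (\<Phi> j (y, z)) < e" using approx[OF e(1)] by blast
        then have "\<Phi> j (y', z) \<in> cylinder (\<Phi> i) (\<omega> i) \<inter> cylinder (\<Phi> j) (\<omega> j)"
          using e(2) cyl_iff[OF j] by blast
        then show False using disj i j False by (auto simp: disjoint_family_on_def)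
      qed
    qed
    then have "\<Phi> j (y, z) \<notin> \<Omega>" using R[OF big] by blast
    moreover have "\<Phi> j (y, z) \<in> closure \<Omega>"
      unfolding closure_approachable
    proof (intro allI impI)
      fix e :: real assume e: "e > 0"
      have "min e (norm (\<Phi> j (y, z)) - R) > 0" using e big by simp
      from approx[OF this] obtain y' where y': "y' \<in> \<omega> j"
        "dist (\<Phi> j (y', z)) (\<Phi> j (y, z)) < e" "dist (\<Phi> j (y', z)) (\<Phi> j (y, z)) < norm (\<Phi> j (y, z)) - R" by auto
      have "norm (\<Phi> j (y, z)) \<le> norm (\<Phi> j (y', z)) + dist (\<Phi> j (y', z)) (\<Phi> j (y, z))"
        using norm_triangle_sub[of "\<Phi> j (y, z)" "\<Phi> j (y', z)"] by (simp add: dist_norm norm_minus_commute)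
      then have "norm (\<Phi> j (y', z)) > R" using y'(3) by linarith
      then show "\<exists>x\<in>\<Omega>. dist x (\<Phi> j (y, z)) < e" using inn[OF j y'(1)] y'(2) by blast
    qed
    ultimately show ?thesis using \<Omega> by (simp add: frontier_def interior_open)
  qed
  have outlets: "\<exists>\<Q> \<eta> Z. finite \<Q> \<and> (\<forall>P\<in>\<Q>. collar_patch \<Omega> P) \<and> \<eta> > 0 \<and>
     (\<forall>y q z. y \<in> \<omega> j \<longrightarrow> q \<in> frontier (\<omega> j) \<longrightarrow> dist y q < \<eta> \<longrightarrow> \<bar>z\<bar> > Z \<longrightarrow> \<Phi> j (y, z) \<in> \<Union>\<Q>)"
    if j: "j \<in> J" for j
  proof -
    have "compact (frontier (\<omega> j))" by (rule compact_frontier_bounded[OF bd[OF j]])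
    from compact_collar_cover[OF dom[OF j] C2\<omega>[OF j] this subset_refl]
    obtain \<P>' \<eta> where P': "finite \<P>'" "\<And>P. P \<in> \<P>' \<Longrightarrow> collar_patch (\<omega> j) P" "\<eta> > 0"
      "\<And>y q. y \<in> \<omega> j \<Longrightarrow> q \<in> frontier (\<omega> j) \<Longrightarrow> dist y q < \<eta> \<Longrightarrow> y \<in> \<Union>\<P>'" by metis
    have "\<forall>P'\<in>\<P>'. \<exists>P Z. collar_patch \<Omega> P \<and> (\<forall>y z. y \<in> P' \<longrightarrow> \<bar>z\<bar> > Z \<longrightarrow> \<Phi> j (y, z) \<in> P)"
    proof
      fix P' assume m: "P' \<in> \<P>'"
      have fr': "\<And>y z. y \<in> frontier (\<omega> j) \<Longrightarrow> norm (\<Phi> j (y, z)) > R \<Longrightarrow> \<Phi> j (y, z) \<in> frontier \<Omega>"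
        and inn': "\<And>y z. y \<in> \<omega> j \<Longrightarrow> norm (\<Phi> j (y, z)) > R \<Longrightarrow> \<Phi> j (y, z) \<in> \<Omega>"
        using fr[OF j] inn[OF j] by blast+
      show "\<exists>P Z. collar_patch \<Omega> P \<and> (\<forall>y z. y \<in> P' \<longrightarrow> \<bar>z\<bar> > Z \<longrightarrow> \<Phi> j (y, z) \<in> P)"
        by (rule outlet_collar_patch[where R = R, OF bij[OF j] iso[OF j] _ _ P'(2)[OF m]])
           (use fr' inn' in blast)+
    qed
    then obtain P Z where PZ: "\<And>P'. P' \<in> \<P>' \<Longrightarrow> collar_patch \<Omega> (P P')"
      "\<And>P' y z. P' \<in> \<P>' \<Longrightarrow> y \<in> P' \<Longrightarrow> \<bar>z\<bar> > Z P' \<Longrightarrow> \<Phi> j (y, z) \<in> P P'" by metis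
    \<comment> \<open>An upper bound of all \<open>Z P\<close>.\<close>
    define Z0 where "Z0 = (\<Sum>P'\<in>\<P>'. \<bar>Z P'\<bar>)"
    have Z0: "Z P' \<le> Z0" if "P' \<in> \<P>'" for P'
      unfolding Z0_def using member_le_sum[OF that _ P'(1), of "\<lambda>P'. \<bar>Z P'\<bar>"] by simp
    show ?thesis
    proof (rule exI[of _ "P ` \<P>'"], rule exI[of _ \<eta>], rule exI[of _ Z0], intro conjI allI impI)
      fix y q and z :: real assume a: "y \<in> \<omega> j" "q \<in> frontier (\<omega> j)" "dist y q < \<eta>" "\<bar>z\<bar> > Z0"
      obtain P' where "P' \<in> \<P>'" "y \<in> P'" using P'(4)[OF a(1-3)] by blast
      then show "\<Phi> j (y, z) \<in> \<Union> (P ` \<P>')" using PZ(2)[of P' y z] Z0[of P'] a(4) by fastforce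
    qed (use P' PZ in auto)
  qed
  define W where "W j \<Q> \<eta> Z \<longleftrightarrow> finite \<Q> \<and> (\<forall>P\<in>\<Q>. collar_patch \<Omega> P) \<and> \<eta> > 0 \<and>
     (\<forall>y q z. y \<in> \<omega> j \<longrightarrow> q \<in> frontier (\<omega> j) \<longrightarrow> dist y q < \<eta> \<longrightarrow> \<bar>z\<bar> > Z \<longrightarrow> \<Phi> j (y, z) \<in> \<Union>\<Q>)"
    for j \<Q> and \<eta> Z :: real
  have "\<forall>j\<in>J. \<exists>\<Q> \<eta> Z. W j \<Q> \<eta> Z" using outlets unfolding W_def by blast
  then obtain \<Q> e Z where W: "\<And>j. j \<in> J \<Longrightarrow> W j (\<Q> j) (e j) (Z j)" by metis
  have Q: "\<And>j. j \<in> J \<Longrightarrow> finite (\<Q> j)" "\<And>j P. j \<in> J \<Longrightarrow> P \<in> \<Q> j \<Longrightarrow> collar_patch \<Omega> P"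
    "\<And>j. j \<in> J \<Longrightarrow> e j > 0"
    "\<And>j y q z. j \<in> J \<Longrightarrow> y \<in> \<omega> j \<Longrightarrow> q \<in> frontier (\<omega> j) \<Longrightarrow> dist y q < e j \<Longrightarrow> \<bar>z\<bar> > Z j \<Longrightarrow> \<Phi> j (y, z) \<in> \<Union>(\<Q> j)"
    using W unfolding W_def by blast+
  have "\<forall>j\<in>J. \<exists>B. \<forall>y\<in>\<omega> j. norm y \<le> B" using bd by (auto simp: bounded_iff)
  then obtain B where B: "\<And>j y. j \<in> J \<Longrightarrow> y \<in> \<omega> j \<Longrightarrow> norm y \<le> B j" by metis
  define Rj where "Rj j = norm (\<Phi> j 0) + B j + \<bar>Z j\<bar>" for j
  define R1 where "R1 = \<bar>R\<bar> + (\<Sum>j\<in>J. \<bar>Rj j\<bar>)"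
  have R1: "R \<le> R1" "\<And>j. j \<in> J \<Longrightarrow> Rj j \<le> R1"
  proof -
    have "0 \<le> (\<Sum>j\<in>J. \<bar>Rj j\<bar>)" by (intro sum_nonneg) simp
    then show "R \<le> R1" unfolding R1_def by linarith
    fix j assume "j \<in> J"
    then have "\<bar>Rj j\<bar> \<le> (\<Sum>j\<in>J. \<bar>Rj j\<bar>)" using fJ by (intro member_le_sum) auto
    then show "Rj j \<le> R1" by (simp add: R1_def)
  qed
  define K where "K = frontier \<Omega> \<inter> cball 0 (R1 + 1)"
  have K: "compact K" "K \<subseteq> frontier \<Omega>"
    unfolding K_def by (auto intro: closed_Int_compact)
  obtain \<P>0 \<eta>0 where P0: "finite \<P>0" "\<And>P. P \<in> \<P>0 \<Longrightarrow> collar_patch \<Omega> P" "\<eta>0 > 0"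
    "\<And>x p. x \<in> \<Omega> \<Longrightarrow> p \<in> K \<Longrightarrow> dist x p < \<eta>0 \<Longrightarrow> x \<in> \<Union>\<P>0"
    using compact_collar_cover[OF \<Omega> C2 K] by metis
  define \<eta> where "\<eta> = Min (insert 1 (insert \<eta>0 (e ` J)))"
  have \<eta>: "\<eta> > 0" "\<eta> \<le> 1" "\<eta> \<le> \<eta>0" "\<And>j. j \<in> J \<Longrightarrow> \<eta> \<le> e j"
  proof -
    have fin: "finite (insert 1 (insert \<eta>0 (e ` J)))" using fJ by simp
    show "\<eta> > 0" unfolding \<eta>_def using fin P0(3) Q(3) by (subst Min_gr_iff) auto
    show "\<eta> \<le> 1" "\<eta> \<le> \<eta>0" "\<And>j. j \<in> J \<Longrightarrow> \<eta> \<le> e j"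
      unfolding \<eta>_def by (intro Min_le fin; simp)+
  qed
  show ?thesis
  proof (rule that[of "\<P>0 \<union> (\<Union>j\<in>J. \<Q> j)" \<eta>])
    fix x p assume x: "x \<in> \<Omega>" "p \<in> frontier \<Omega>" "dist x p < \<eta>"
    show "x \<in> \<Union> (\<P>0 \<union> (\<Union>j\<in>J. \<Q> j))"
    proof (cases "norm p \<le> R1 + 1")
      case True
      then have "p \<in> K" using x by (simp add: K_def)
      then show ?thesis using P0(4)[OF x(1)] x(3) \<eta>(3) by fastforce
    next
      case False
      have "norm p \<le> norm x + dist x p"
        using norm_triangle_sub[of p x] by (simp add: dist_norm norm_minus_commute)
      then have nx: "norm x > R1" using False x(3) \<eta>(2) by linarith
      then obtain j where j: "j \<in> J" "x \<in> cylinder (\<Phi> j) (\<omega> j)" using R[of x] R1(1) x(1) by auto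
      then obtain y z where yz: "x = \<Phi> j (y, z)" "y \<in> \<omega> j" by (auto simp: cylinder_def)
      obtain y' z' where p: "p = \<Phi> j (y', z')" using bij_is_surj[OF bij[OF j(1)]] by (metis surjD surj_pair)
      have "p \<notin> \<Omega>" using x(2) \<Omega> by (auto simp: frontier_def interior_open)
      then have "y' \<notin> \<omega> j" using inn[OF j(1), of y' z'] p False R1(1) by auto
      then obtain q where q: "q \<in> frontier (\<omega> j)" "dist y q \<le> dist y y'"
        using exists_frontier_between[OF yz(2)] by blast
      have "dist y y' \<le> dist x p"
        using dist_fst_le[of "(y, z)" "(y', z')"] by (simp add: yz p iso[OF j(1)])
      then have "dist y q < e j" using q(2) x(3) \<eta>(4)[OF j(1)] by linarith
      moreover have "\<bar>z\<bar> > Z j"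
      proof -
        have "norm x \<le> norm (\<Phi> j 0) + dist (\<Phi> j (y, z)) (\<Phi> j 0)"
          using norm_triangle_sub[of x "\<Phi> j 0"] by (simp add: yz dist_norm)
        also have "dist (\<Phi> j (y, z)) (\<Phi> j 0) = norm (y, z)" by (simp add: iso[OF j(1)])
        also have "\<dots> \<le> norm y + norm z" by (rule norm_Pair_le)
        finally have "norm x \<le> norm (\<Phi> j 0) + (B j + \<bar>z\<bar>)" using B[OF j(1) yz(2)] by simp
        then show ?thesis using nx R1(2)[OF j(1)] by (simp add: Rj_def)
      qed
      ultimately have "x \<in> \<Union>(\<Q> j)" unfolding yz(1) by (rule Q(4)[OF j(1) yz(2) q(1)])
      then show ?thesis using j(1) by blast
    qed
  qed (use fJ P0 Q \<eta> in auto)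
qed

lemma surface_locally_finite:
  fixes \<Omega> :: "'a::euclidean_space set"
  assumes \<Omega>: "open \<Omega>" and C2: "C2_boundary \<Omega>" and d: "DIM('b::euclidean_space) + 1 = DIM('a)"
  shows "hausdorff_outer DIM('b) (frontier \<Omega> \<inter> cball 0 R) < top"
proof -
  have m: "DIM('b) \<ge> 1" using DIM_positive[where 'a='b] by linarith
  define K where "K = frontier \<Omega> \<inter> cball 0 R"
  have K: "compact K" unfolding K_def by (auto intro: closed_Int_compact)
  have "\<forall>p\<in>K. \<exists>r>0. hausdorff_outer DIM('b) (frontier \<Omega> \<inter> ball p r) < top"
  proof
    fix p assume "p \<in> K"
    then have "p \<in> frontier \<Omega>" by (simp add: K_def)
    then obtain r \<nu> L h where r: "r > 0" and h: "height_function \<nu> L h"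
      and loc: "\<And>x. x \<in> ball p r \<Longrightarrow> x \<in> \<Omega> \<longleftrightarrow> 0 < h x"
      using C2_boundary_local_height[OF C2] by metis
    have "frontier \<Omega> \<inter> ball p r \<subseteq> {x. h x = 0} \<inter> cball 0 (norm p + r)"
    proof
      fix x assume x: "x \<in> frontier \<Omega> \<inter> ball p r"
      have "norm x \<le> norm p + dist p x"
        using norm_triangle_sub[of x p] by (simp add: dist_norm norm_minus_commute)
      then show "x \<in> {x. h x = 0} \<inter> cball 0 (norm p + r)"
        using frontier_eq_level_set[where p = p and r = r, OF \<Omega> h loc, of x] x by simp
    qed
    from le_less_trans[OF hausdorff_outer_mono[OF this] hausdorff_outer_level_set_finite[OF h d]] r
    show "\<exists>r>0. hausdorff_outer DIM('b) (frontier \<Omega> \<inter> ball p r) < top" by blast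
  qed
  then obtain r where r: "\<And>p. p \<in> K \<Longrightarrow> r p > 0"
    "\<And>p. p \<in> K \<Longrightarrow> hausdorff_outer DIM('b) (frontier \<Omega> \<inter> ball p (r p)) < top" by metis
  have "K \<subseteq> (\<Union>p\<in>K. ball p (r p))" using r(1) by force
  then obtain C where C: "C \<subseteq> K" "finite C" "K \<subseteq> (\<Union>p\<in>C. ball p (r p))"
    using compactE_image[OF K, of K "\<lambda>p. ball p (r p)"] by auto
  have fin: "hausdorff_outer DIM('b) (frontier \<Omega> \<inter> (\<Union>p\<in>D. ball p (r p))) < top" if "finite D" "D \<subseteq> K" for D
    using that
  proof (induction D rule: finite_induct)
    case empty
    then show ?case using m by simp
  next
    case (insert p D)
    have "frontier \<Omega> \<inter> (\<Union>p\<in>insert p D. ball p (r p)) =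
      frontier \<Omega> \<inter> ball p (r p) \<union> frontier \<Omega> \<inter> (\<Union>p\<in>D. ball p (r p))" by auto
    then have "hausdorff_outer DIM('b) (frontier \<Omega> \<inter> (\<Union>p\<in>insert p D. ball p (r p))) \<le>
      hausdorff_outer DIM('b) (frontier \<Omega> \<inter> ball p (r p)) + hausdorff_outer DIM('b) (frontier \<Omega> \<inter> (\<Union>p\<in>D. ball p (r p)))"
      using hausdorff_outer_Un_le[OF m] by simp
    also have "\<dots> < top" using insert r(2) by simp
    finally show ?case .
  qed
  have "K \<subseteq> frontier \<Omega> \<inter> (\<Union>p\<in>C. ball p (r p))" using C(3) by (auto simp: K_def)
  from le_less_trans[OF hausdorff_outer_mono[OF this] fin[OF C(2,1)]] show ?thesis
    by (simp add: K_def)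
qed

section \<open>Hardy's inequality in the domain and the logarithmic cutoff\<close>

lemma nn_integral_lebesgue_on:
  fixes g :: "'a::euclidean_space \<Rightarrow> ennreal"
  assumes [measurable]: "g \<in> borel_measurable borel" and \<Omega>: "open \<Omega>"
  shows "(\<integral>\<^sup>+x. g x \<partial>lebesgue_on \<Omega>) = (\<integral>\<^sup>+x. g x * indicator \<Omega> x \<partial>lborel)"
proof -
  have "(\<integral>\<^sup>+x. g x \<partial>lebesgue_on \<Omega>) = (\<integral>\<^sup>+x. g x * indicator \<Omega> x \<partial>lebesgue)"
    using \<Omega> by (intro nn_integral_restrict_space) auto
  then show ?thesis by (simp add: nn_integral_completion)
qed

lemma ennreal_integral_norm_sq:
  fixes g :: "'a::euclidean_space \<Rightarrow> 'b::euclidean_space"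
  assumes g: "continuous_on UNIV g" "compact K" "supported_in K g" and \<Omega>: "open \<Omega>"
  shows "ennreal (\<integral>x. (norm (g x))\<^sup>2 \<partial>lebesgue_on \<Omega>) = (\<integral>\<^sup>+x. ennreal ((norm (g x))\<^sup>2) * indicator \<Omega> x \<partial>lborel)"
proof -
  have "integrable (lebesgue_on \<Omega>) (\<lambda>x. (norm (g x))\<^sup>2)"
    using square_integrable_compact_support[OF g \<Omega>] by (simp add: square_integrable_def)
  then have "ennreal (\<integral>x. (norm (g x))\<^sup>2 \<partial>lebesgue_on \<Omega>) = (\<integral>\<^sup>+x. ennreal ((norm (g x))\<^sup>2) \<partial>lebesgue_on \<Omega>)"
    by (intro nn_integral_eq_integral[symmetric]) auto
  also have "\<dots> = (\<integral>\<^sup>+x. ennreal ((norm (g x))\<^sup>2) * indicator \<Omega> x \<partial>lborel)"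
    using borel_measurable_continuous_onI[OF g(1)] by (intro nn_integral_lebesgue_on \<Omega>) measurable
  finally show ?thesis .
qed

lemma norm_directional_derivative_le:
  fixes \<phi> :: "real^'n \<Rightarrow> complex"
  assumes \<phi>: "Ck 1 \<phi>"
  shows "norm (frechet_derivative \<phi> (at x) v) \<le> norm v * norm (classical_gradient \<phi> x)"
proof -
  interpret L: linear "frechet_derivative \<phi> (at x)"
    using Ck_has_derivative[of 0 \<phi> x] \<phi> by (intro has_derivative_linear) auto
  have "v = (\<Sum>i\<in>UNIV. (v $ i) *\<^sub>R axis i 1)"
    using basis_expansion[of v] by (simp add: scalar_mult_eq_scaleR)
  then have "frechet_derivative \<phi> (at x) v = (\<Sum>i\<in>UNIV. (v $ i) *\<^sub>R frechet_derivative \<phi> (at x) (axis i 1))"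
    by (metis (no_types, lifting) L.sum L.scale sum.cong)
  also have "norm \<dots> \<le> (\<Sum>i\<in>UNIV. \<bar>v $ i\<bar> * \<bar>norm (classical_gradient \<phi> x $ i)\<bar>)"
    by (rule order_trans[OF norm_sum]) (simp add: classical_gradient_def)
  also have "\<dots> \<le> L2_set (\<lambda>i. v $ i) UNIV * L2_set (\<lambda>i. norm (classical_gradient \<phi> x $ i)) UNIV"
    by (rule L2_set_mult_ineq)
  also have "\<dots> = norm v * norm (classical_gradient \<phi> x)"
    by (simp add: norm_vec_def L2_set_def)
  finally show ?thesis .
qed

definition depth :: "'a::metric_space set \<Rightarrow> 'a \<Rightarrow> real" where
  "depth \<Omega> x = infdist x (- \<Omega>)"

lemma depth_nonneg: "depth \<Omega> x \<ge> 0"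
  by (simp add: depth_def infdist_nonneg)

lemma depth_lipschitz: "\<bar>depth \<Omega> x - depth \<Omega> y\<bar> \<le> dist x y"
  unfolding depth_def by (rule infdist_triangle_abs)

lemma continuous_on_depth: "continuous_on X (depth \<Omega>)"
  unfolding depth_def by (intro continuous_intros)

text \<open>
  In the patch the depth is at least the height divided by its Lipschitz constant, so the weight may be
  expressed by the height.
\<close>

lemma collar_patch_hardy:
  fixes \<Omega> :: "(real^'n) set"
  assumes P: "collar_patch \<Omega> P" and d: "CARD('m::finite) + 1 = CARD('n)" and ne: "- \<Omega> \<noteq> {}"
  shows "\<exists>C\<ge>0. \<forall>s>0. \<forall>\<phi>::real^'n \<Rightarrow> complex. Ck 1 \<phi> \<longrightarrow>
    (\<integral>\<^sup>+x. ennreal ((norm (\<phi> x) / (depth \<Omega> x + s))\<^sup>2) * indicator P x \<partial>lborel)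
     \<le> ennreal C * ((\<integral>\<^sup>+x. ennreal ((norm (classical_gradient \<phi> x))\<^sup>2) * indicator \<Omega> x \<partial>lborel)
        + ennreal (1 / s) * (\<integral>\<^sup>+x. ennreal ((norm (\<phi> x))\<^sup>2) \<partial>surface_measure \<Omega>))"
proof -
  obtain \<nu> L h A b where ch: "collar_chart \<Omega> \<nu> L h A b" and P_eq: "P = {x\<in>A. 0 < h x \<and> h x < b}"
    using P unfolding collar_patch_def by blast
  have h: "height_function \<nu> L h" and A: "open A" "\<And>x t. x + t *\<^sub>R \<nu> \<in> A \<longleftrightarrow> x \<in> A" and b: "b > 0"
    and fr: "{x\<in>A. h x = 0} \<subseteq> frontier \<Omega>"
    and inn: "\<And>x y. x \<in> A \<Longrightarrow> 0 < h x \<Longrightarrow> h x < b \<Longrightarrow> dist x y < h x \<Longrightarrow> 0 < h y \<Longrightarrow> y \<in> \<Omega>"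
    using ch unfolding collar_chart_def by blast+
  note H = height_functionD[OF h]
  have d': "DIM(real^'m) + 1 = DIM(real^'n)" using d by simp
  have depth: "h x \<le> L * depth \<Omega> x" if x: "x \<in> P" for x
  proof -
    have "h x / L \<le> depth \<Omega> x"
      unfolding depth_def infdist_notempty[OF ne]
    proof (rule cINF_greatest[OF ne])
      fix y assume y: "y \<in> - \<Omega>"
      show "h x / L \<le> dist x y"
      proof (rule ccontr)
        assume "\<not> h x / L \<le> dist x y"
        then have lt: "L * dist x y < h x" using H(4) by (simp add: field_simps not_le)
        have "1 * dist x y \<le> L * dist x y" using H(4) by (intro mult_right_mono) auto
        then have "dist x y < h x" using lt by simp
        moreover have "0 < h y" using H(3)[of x y] lt by linarith
        ultimately show False using inn x y by (auto simp: P_eq)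
      qed
    qed
    then show ?thesis using H(4) by (simp add: field_simps)
  qed
  have meas_h[measurable]: "h \<in> borel_measurable borel" using H(5)[of UNIV] by (rule borel_measurable_continuous_onI)
  have meas_P[measurable]: "P \<in> sets borel"
  proof -
    have [measurable]: "A \<in> sets borel" using A(1) by simp
    show ?thesis unfolding P_eq by measurable
  qed
  have P\<Omega>: "P \<subseteq> \<Omega>" using inn unfolding P_eq by force
  define C where "C = L\<^sup>2 * (4 + 2 * 2 ^ CARD('m))"
  have C0: "C \<ge> 0" by (simp add: C_def)
  show ?thesis
  proof (intro exI[of _ C] conjI C0 allI impI)
    fix s :: real and \<phi> :: "real^'n \<Rightarrow> complex"
    assume s: "s > 0" and \<phi>: "Ck 1 \<phi>"
    define \<phi>' where "\<phi>' x = frechet_derivative \<phi> (at x) \<nu>" for x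
    define G where "G = (\<integral>\<^sup>+x. ennreal ((norm (classical_gradient \<phi> x))\<^sup>2) * indicator \<Omega> x \<partial>lborel)"
    define S where "S = (\<integral>\<^sup>+x. ennreal ((norm (\<phi> x))\<^sup>2) \<partial>surface_measure \<Omega>)"
    have c\<phi>: "continuous_on UNIV \<phi>" using Ck_continuous[OF \<phi>] .
    have c\<phi>': "continuous_on UNIV \<phi>'"
    proof -
      have "\<phi>' = (\<lambda>x. \<Sum>i\<in>UNIV. (\<nu> $ i) *\<^sub>R (classical_gradient \<phi> x $ i))"
      proof
        fix x
        interpret L: linear "frechet_derivative \<phi> (at x)"
          using Ck_has_derivative[of 0 \<phi> x] \<phi> by (intro has_derivative_linear) auto
        have "\<nu> = (\<Sum>i\<in>UNIV. (\<nu> $ i) *\<^sub>R axis i 1)"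
          using basis_expansion[of \<nu>] by (simp add: scalar_mult_eq_scaleR)
        then show "\<phi>' x = (\<Sum>i\<in>UNIV. (\<nu> $ i) *\<^sub>R (classical_gradient \<phi> x $ i))"
          unfolding \<phi>'_def by (metis (no_types, lifting) L.sum L.scale sum.cong classical_gradient_def vec_lambda_beta)
      qed
      then show ?thesis
        using continuous_on_classical_gradient[OF \<phi>] by (auto intro!: continuous_intros)
    qed
    have vd: "((\<lambda>t. \<phi> (x + t *\<^sub>R \<nu>)) has_vector_derivative \<phi>' x) (at 0)" for x
    proof -
      have 1: "((\<lambda>t. x + t *\<^sub>R \<nu>) has_derivative (\<lambda>h. h *\<^sub>R \<nu>)) (at 0)"
        by (auto intro!: derivative_eq_intros)
      have 2: "(\<phi> has_derivative frechet_derivative \<phi> (at x)) (at (x + 0 *\<^sub>R \<nu>))"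
        using Ck_has_derivative[of 0 \<phi> x] \<phi> by simp
      interpret L: linear "frechet_derivative \<phi> (at x)" using 2 by (rule has_derivative_linear)
      from has_derivative_compose[OF 1 2] show ?thesis
        by (simp add: has_vector_derivative_def L.scale \<phi>'_def)
    qed
    have "(\<integral>\<^sup>+x. ennreal ((norm (\<phi> x) / (depth \<Omega> x + s))\<^sup>2) * indicator P x \<partial>lborel)
      \<le> (\<integral>\<^sup>+x. ennreal (L\<^sup>2) * (ennreal ((norm (\<phi> x) / (h x + s))\<^sup>2) * indicator P x) \<partial>lborel)"
    proof (rule nn_integral_mono)
      fix x
      show "ennreal ((norm (\<phi> x) / (depth \<Omega> x + s))\<^sup>2) * indicator P x
        \<le> ennreal (L\<^sup>2) * (ennreal ((norm (\<phi> x) / (h x + s))\<^sup>2) * indicator P x)"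
      proof (cases "x \<in> P")
        case True
        have hx: "h x > 0" using True by (simp add: P_eq)
        have "1 * s \<le> L * s" using H(4) s by (intro mult_right_mono) auto
        then have "h x + s \<le> L * (depth \<Omega> x + s)" using depth[OF True] by (simp add: algebra_simps)
        then have "norm (\<phi> x) * (h x + s) \<le> norm (\<phi> x) * (L * (depth \<Omega> x + s))" by (rule mult_left_mono) simp
        then have "norm (\<phi> x) / (depth \<Omega> x + s) \<le> L * (norm (\<phi> x) / (h x + s))"
          using s hx depth_nonneg[of \<Omega> x] by (simp add: field_simps add_nonneg_pos add_pos_nonneg)
        then have "(norm (\<phi> x) / (depth \<Omega> x + s))\<^sup>2 \<le> (L * (norm (\<phi> x) / (h x + s)))\<^sup>2"
          using s depth_nonneg[of \<Omega> x] by (intro power_mono) auto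
        then have "(norm (\<phi> x) / (depth \<Omega> x + s))\<^sup>2 \<le> L\<^sup>2 * (norm (\<phi> x) / (h x + s))\<^sup>2"
          by (simp only: power_mult_distrib)
        then show ?thesis using True by (simp add: ennreal_mult[symmetric] ennreal_leI)
      qed simp
    qed
    also have "\<dots> = ennreal (L\<^sup>2) * (\<integral>\<^sup>+x. ennreal ((norm (\<phi> x) / (h x + s))\<^sup>2) * indicator P x \<partial>lborel)"
    proof (rule nn_integral_cmult)
      have [measurable]: "\<phi> \<in> borel_measurable borel" by (rule borel_measurable_continuous_onI[OF c\<phi>])
      show "(\<lambda>x. ennreal ((norm (\<phi> x) / (h x + s))\<^sup>2) * indicator P x) \<in> borel_measurable lborel" by measurable
    qed
    also have "\<dots> \<le> ennreal (L\<^sup>2) * (ennreal (2 / s) * (2 ^ CARD('m) * S) + 4 * G)"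
    proof (rule mult_left_mono)
      have "(\<integral>\<^sup>+x. ennreal ((norm (\<phi> x) / (h x + s))\<^sup>2) * indicator P x \<partial>lborel)
        \<le> ennreal (2 / s) * (2 ^ DIM(real^'m) * S) + 4 * (\<integral>\<^sup>+x. ennreal ((norm (\<phi>' x))\<^sup>2) * indicator P x \<partial>lborel)"
        unfolding P_eq S_def by (rule hardy_patch[OF h d' A fr b s c\<phi> c\<phi>' vd])
      also have "(\<integral>\<^sup>+x. ennreal ((norm (\<phi>' x))\<^sup>2) * indicator P x \<partial>lborel) \<le> G"
        unfolding G_def
      proof (rule nn_integral_mono)
        fix x
        have "norm (\<phi>' x) \<le> norm (classical_gradient \<phi> x)"
          using norm_directional_derivative_le[OF \<phi>, of x \<nu>] H(1) by (simp add: \<phi>'_def)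
        then show "ennreal ((norm (\<phi>' x))\<^sup>2) * indicator P x \<le> ennreal ((norm (classical_gradient \<phi> x))\<^sup>2) * indicator \<Omega> x"
          using P\<Omega> by (auto simp: indicator_def intro!: ennreal_leI power_mono)
      qed
      finally show "(\<integral>\<^sup>+x. ennreal ((norm (\<phi> x) / (h x + s))\<^sup>2) * indicator P x \<partial>lborel)
        \<le> ennreal (2 / s) * (2 ^ CARD('m) * S) + 4 * G"
        by (simp add: add_left_mono mult_left_mono)
    qed simp
    also have "\<dots> \<le> ennreal C * (G + ennreal (1 / s) * S)"
    proof -
      have p2: "(2::ennreal) ^ CARD('m) = ennreal (2 ^ CARD('m))" by (simp add: ennreal_power[symmetric])
      have "ennreal (2 / s) * (2 ^ CARD('m) * S) = ennreal (2 / s * 2 ^ CARD('m)) * S"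
        unfolding p2 using s by (subst ennreal_mult) (auto simp: mult.assoc)
      also have "2 / s * 2 ^ CARD('m) = (2 * 2 ^ CARD('m)) * (1 / s)" by simp
      also have "ennreal ((2 * 2 ^ CARD('m)) * (1 / s)) * S = ennreal (2 * 2 ^ CARD('m)) * (ennreal (1 / s) * S)"
        using s by (subst ennreal_mult) (auto simp only: mult.assoc, auto)
      also have "\<dots> \<le> ennreal (4 + 2 * 2 ^ CARD('m)) * (ennreal (1 / s) * S)"
        by (intro mult_right_mono ennreal_leI) auto
      finally have 1: "ennreal (2 / s) * (2 ^ CARD('m) * S) \<le> ennreal (4 + 2 * 2 ^ CARD('m)) * (ennreal (1 / s) * S)" .
      have "4 * G = ennreal 4 * G" by simp
      also have "\<dots> \<le> ennreal (4 + 2 * 2 ^ CARD('m)) * G"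
        by (intro mult_right_mono ennreal_leI) auto
      finally have "ennreal (2 / s) * (2 ^ CARD('m) * S) + 4 * G \<le> ennreal (4 + 2 * 2 ^ CARD('m)) * (ennreal (1 / s) * S) + ennreal (4 + 2 * 2 ^ CARD('m)) * G"
        using 1 by (intro add_mono)
      also have "\<dots> = ennreal (4 + 2 * 2 ^ CARD('m)) * (G + ennreal (1 / s) * S)"
        by (simp add: distrib_left add.commute)
      finally show ?thesis
        by (simp add: C_def ennreal_mult mult.assoc mult_left_mono)
    qed
    finally show "(\<integral>\<^sup>+x. ennreal ((norm (\<phi> x) / (depth \<Omega> x + s))\<^sup>2) * indicator P x \<partial>lborel) \<le>
      ennreal C * ((\<integral>\<^sup>+x. ennreal ((norm (classical_gradient \<phi> x))\<^sup>2) * indicator \<Omega> x \<partial>lborel)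
        + ennreal (1 / s) * (\<integral>\<^sup>+x. ennreal ((norm (\<phi> x))\<^sup>2) \<partial>surface_measure \<Omega>))"
      unfolding G_def S_def .
  qed
qed

text \<open>
  A point of \<open>\<Omega>\<close> that lies in no patch has depth at least \<open>\<eta>\<close>, and there the weight is at most \<open>1/\<eta>\<^sup>2\<close>.
\<close>

lemma hardy_domain:
  fixes \<Omega> :: "(real^'n) set" and \<omega> :: "nat \<Rightarrow> (real^'m) set"
  assumes \<Omega>: "open \<Omega>" and ne: "- \<Omega> \<noteq> {}" and C2: "C2_boundary \<Omega>" and out: "cylindrical_outlets \<Omega> N \<omega> \<Phi>"
    and d: "CARD('m) + 1 = CARD('n)"
  shows "\<exists>C\<ge>0. \<forall>s>0. \<forall>\<phi>::real^'n \<Rightarrow> complex. Ck 1 \<phi> \<longrightarrow>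
    (\<integral>\<^sup>+x. ennreal ((norm (\<phi> x) / (depth \<Omega> x + s))\<^sup>2) * indicator \<Omega> x \<partial>lborel)
     \<le> ennreal C * ((\<integral>\<^sup>+x. ennreal ((norm (classical_gradient \<phi> x))\<^sup>2) * indicator \<Omega> x \<partial>lborel)
        + (\<integral>\<^sup>+x. ennreal ((norm (\<phi> x))\<^sup>2) * indicator \<Omega> x \<partial>lborel)
        + ennreal (1 / s) * (\<integral>\<^sup>+x. ennreal ((norm (\<phi> x))\<^sup>2) \<partial>surface_measure \<Omega>))"
proof -
  obtain \<P> \<eta> where fin: "finite \<P>" and patch: "\<And>P. P \<in> \<P> \<Longrightarrow> collar_patch \<Omega> P" and \<eta>: "\<eta> > 0"
    and cov: "\<And>x p. x \<in> \<Omega> \<Longrightarrow> p \<in> frontier \<Omega> \<Longrightarrow> dist x p < \<eta> \<Longrightarrow> x \<in> \<Union>\<P>"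
    using finite_collar_cover[OF \<Omega> C2 out] by metis
  have meas_P: "P \<in> sets borel" if mP: "P \<in> \<P>" for P
  proof -
    obtain \<nu> L h A b where ch: "collar_chart \<Omega> \<nu> L h A b" and P_eq: "P = {x\<in>A. 0 < h x \<and> h x < b}"
      using patch[OF mP] unfolding collar_patch_def by blast
    have [measurable]: "A \<in> sets borel" "h \<in> borel_measurable borel"
      using ch height_functionD(5)[of \<nu> L h UNIV] unfolding collar_chart_def
      by (auto intro: borel_measurable_continuous_onI)
    show ?thesis unfolding P_eq by measurable
  qed
  define W where "W P C \<longleftrightarrow> C \<ge> 0 \<and> (\<forall>s>0. \<forall>\<phi>::real^'n \<Rightarrow> complex. Ck 1 \<phi> \<longrightarrow>
      (\<integral>\<^sup>+x. ennreal ((norm (\<phi> x) / (depth \<Omega> x + s))\<^sup>2) * indicator P x \<partial>lborel)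
     \<le> ennreal C * ((\<integral>\<^sup>+x. ennreal ((norm (classical_gradient \<phi> x))\<^sup>2) * indicator \<Omega> x \<partial>lborel)
        + ennreal (1 / s) * (\<integral>\<^sup>+x. ennreal ((norm (\<phi> x))\<^sup>2) \<partial>surface_measure \<Omega>)))" for P C
  have "\<forall>P\<in>\<P>. \<exists>C. W P C" unfolding W_def using collar_patch_hardy[OF patch d ne] by blast
  then obtain c where cW: "\<And>P. P \<in> \<P> \<Longrightarrow> W P (c P)" by metis
  have c: "\<And>P. P \<in> \<P> \<Longrightarrow> c P \<ge> 0"
    "\<And>P s \<phi>. P \<in> \<P> \<Longrightarrow> s > 0 \<Longrightarrow> Ck 1 (\<phi>::real^'n \<Rightarrow> complex) \<Longrightarrow>
      (\<integral>\<^sup>+x. ennreal ((norm (\<phi> x) / (depth \<Omega> x + s))\<^sup>2) * indicator P x \<partial>lborel)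
     \<le> ennreal (c P) * ((\<integral>\<^sup>+x. ennreal ((norm (classical_gradient \<phi> x))\<^sup>2) * indicator \<Omega> x \<partial>lborel)
        + ennreal (1 / s) * (\<integral>\<^sup>+x. ennreal ((norm (\<phi> x))\<^sup>2) \<partial>surface_measure \<Omega>))"
    using cW unfolding W_def by blast+
  define C where "C = (\<Sum>P\<in>\<P>. c P) + 1 / \<eta>\<^sup>2"
  have c0: "(\<Sum>P\<in>\<P>. c P) \<ge> 0" using c(1) by (rule sum_nonneg)
  have deep: "depth \<Omega> x \<ge> \<eta>" if x: "x \<in> \<Omega>" "x \<notin> \<Union>\<P>" for x
  proof -
    have "\<eta> \<le> dist x q" if "q \<in> - \<Omega>" for q
    proof -
      obtain p where p: "p \<in> frontier \<Omega>" "dist x p \<le> dist x q"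
        using exists_frontier_between[OF x(1)] \<open>q \<in> - \<Omega>\<close> by blast
      then show ?thesis using cov[OF x(1) p(1)] x(2) by force
    qed
    then show ?thesis unfolding depth_def infdist_notempty[OF ne] by (intro cINF_greatest ne)
  qed
  show ?thesis
  proof (intro exI[of _ C] conjI allI impI)
    show "C \<ge> 0" using c0 by (simp add: C_def)
    fix s :: real and \<phi> :: "real^'n \<Rightarrow> complex"
    assume s: "s > 0" and \<phi>: "Ck 1 \<phi>"
    define q where "q x = ennreal ((norm (\<phi> x) / (depth \<Omega> x + s))\<^sup>2)" for x
    define G where "G = (\<integral>\<^sup>+x. ennreal ((norm (classical_gradient \<phi> x))\<^sup>2) * indicator \<Omega> x \<partial>lborel)"
    define F where "F = (\<integral>\<^sup>+x. ennreal ((norm (\<phi> x))\<^sup>2) * indicator \<Omega> x \<partial>lborel)"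
    define S where "S = ennreal (1 / s) * (\<integral>\<^sup>+x. ennreal ((norm (\<phi> x))\<^sup>2) \<partial>surface_measure \<Omega>)"
    have [measurable]: "\<phi> \<in> borel_measurable borel" "depth \<Omega> \<in> borel_measurable borel" "\<Omega> \<in> sets borel"
      using Ck_continuous[OF \<phi>] continuous_on_depth[of UNIV \<Omega>] \<Omega> by (auto intro: borel_measurable_continuous_onI)
    have [measurable]: "q \<in> borel_measurable borel" unfolding q_def by measurable
    have "(\<integral>\<^sup>+x. q x * indicator \<Omega> x \<partial>lborel) \<le>
      (\<integral>\<^sup>+x. (\<Sum>P\<in>\<P>. q x * indicator P x) + ennreal (1 / \<eta>\<^sup>2) * (ennreal ((norm (\<phi> x))\<^sup>2) * indicator \<Omega> x) \<partial>lborel)"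
    proof (rule nn_integral_mono)
      fix x
      show "q x * indicator \<Omega> x \<le> (\<Sum>P\<in>\<P>. q x * indicator P x) + ennreal (1 / \<eta>\<^sup>2) * (ennreal ((norm (\<phi> x))\<^sup>2) * indicator \<Omega> x)"
      proof (cases "x \<in> \<Union>\<P>")
        case True
        then obtain P where P: "P \<in> \<P>" "x \<in> P" by blast
        have "q x * indicator \<Omega> x \<le> q x * indicator P x" using P by (simp add: indicator_def)
        also have "\<dots> \<le> (\<Sum>P\<in>\<P>. q x * indicator P x)" using fin P by (intro member_le_sum) auto
        finally show ?thesis by (simp add: add_increasing2)
      next
        case False
        have "q x \<le> ennreal (1 / \<eta>\<^sup>2) * ennreal ((norm (\<phi> x))\<^sup>2)" if x: "x \<in> \<Omega>"
        proof -
          have "norm (\<phi> x) / (depth \<Omega> x + s) \<le> norm (\<phi> x) / \<eta>"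
            using deep[OF x False] \<eta> s by (intro divide_left_mono) auto
          then have "(norm (\<phi> x) / (depth \<Omega> x + s))\<^sup>2 \<le> (norm (\<phi> x) / \<eta>)\<^sup>2"
            using depth_nonneg[of \<Omega> x] s by (intro power_mono) auto
          then show ?thesis unfolding q_def by (simp add: ennreal_mult[symmetric] power_divide ennreal_leI)
        qed
        then show ?thesis by (auto simp: indicator_def intro: add_increasing)
      qed
    qed
    also have "\<dots> = (\<Sum>P\<in>\<P>. \<integral>\<^sup>+x. q x * indicator P x \<partial>lborel) + ennreal (1 / \<eta>\<^sup>2) * F"
      unfolding F_def using meas_P by (subst nn_integral_add, (measurable; fail), (measurable; fail), subst nn_integral_sum) (auto simp: nn_integral_cmult)
    also have "\<dots> \<le> (\<Sum>P\<in>\<P>. ennreal (c P) * (G + S)) + ennreal (1 / \<eta>\<^sup>2) * F"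
      unfolding q_def G_def S_def by (intro add_right_mono sum_mono c s \<phi>)
    also have "\<dots> = ennreal (\<Sum>P\<in>\<P>. c P) * (G + S) + ennreal (1 / \<eta>\<^sup>2) * F"
      using c(1) by (simp add: sum_distrib_right[symmetric] sum_ennreal)
    also have "\<dots> \<le> ennreal C * (G + S) + ennreal C * F"
      using c0 by (intro add_mono mult_right_mono ennreal_leI) (auto simp: C_def)
    also have "\<dots> = ennreal C * (G + F + S)" by (simp add: distrib_left add_ac)
    finally show "(\<integral>\<^sup>+x. ennreal ((norm (\<phi> x) / (depth \<Omega> x + s))\<^sup>2) * indicator \<Omega> x \<partial>lborel)
     \<le> ennreal C * ((\<integral>\<^sup>+x. ennreal ((norm (classical_gradient \<phi> x))\<^sup>2) * indicator \<Omega> x \<partial>lborel)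
        + (\<integral>\<^sup>+x. ennreal ((norm (\<phi> x))\<^sup>2) * indicator \<Omega> x \<partial>lborel)
        + ennreal (1 / s) * (\<integral>\<^sup>+x. ennreal ((norm (\<phi> x))\<^sup>2) \<partial>surface_measure \<Omega>))"
      unfolding q_def G_def F_def S_def .
  qed
qed

text \<open>
  The profile \<open>ln (t/s) / \<Lambda>\<close>, cut off at 0 and 1, has slope \<open>1 / (\<Lambda> t)\<close>.  It reaches 1 at \<open>t = \<eta>/2\<close> when
  \<open>s = (\<eta>/2) exp (- \<Lambda>)\<close>, and so its slope can be made a small multiple of \<open>1/t\<close>.  As a function of the depth it
  is mollified at the scale \<open>s/4\<close>, which is small enough to keep the slope, up to a factor, the value 0 at the
  boundary, and the value 1 at depth \<open>\<eta>\<close>.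
\<close>

lemma log_cutoff:
  fixes \<Omega> :: "'a::euclidean_space set"
  assumes a: "a > 0" and \<eta>: "0 < \<eta>" "\<eta> \<le> 1"
  obtains s \<zeta> where "0 < s" "s \<le> 1" "Ck 1 (\<zeta> :: 'a \<Rightarrow> real)" "\<And>x. 0 \<le> \<zeta> x \<and> \<zeta> x \<le> 1"
    "\<And>x. depth \<Omega> x = 0 \<Longrightarrow> \<zeta> x = 0" "\<And>x. \<eta> \<le> depth \<Omega> x \<Longrightarrow> \<zeta> x = 1"
    "\<And>x. norm (grad \<zeta> x) \<le> a / (depth \<Omega> x + s)"
proof -
  define \<Lambda> where "\<Lambda> = 4 / a"
  define s where "s = \<eta> / 2 * exp (- \<Lambda>)"
  have \<Lambda>: "\<Lambda> > 0" using a by (simp add: \<Lambda>_def)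
  have "exp (- \<Lambda>) \<le> 1" using \<Lambda> by simp
  then have "\<eta> / 2 * exp (- \<Lambda>) \<le> \<eta> / 2 * 1" using \<eta> by (intro mult_left_mono) auto
  then have s: "s > 0" "s \<le> \<eta> / 2" using \<eta> by (auto simp: s_def)
  define \<theta> where "\<theta> t = min 1 (ln (max t s / s) / \<Lambda>)" for t
  have \<theta>01: "0 \<le> \<theta> t \<and> \<theta> t \<le> 1" for t
    using s \<Lambda> by (auto simp: \<theta>_def ln_ge_zero divide_nonneg_pos)
  have \<theta>0: "\<theta> t = 0" if "t \<le> s" for t using that s by (simp add: \<theta>_def max_absorb2)
  have \<theta>1: "\<theta> t = 1" if t: "\<eta> / 2 \<le> t" for t
  proof -
    have "exp \<Lambda> * s = \<eta> / 2" by (simp add: s_def exp_minus)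
    then have "exp \<Lambda> \<le> max t s / s"
      using t by (simp add: pos_le_divide_eq[OF s(1)])
    then have "\<Lambda> \<le> ln (max t s / s)" using s by (subst ln_ge_iff) (auto simp: less_max_iff_disj)
    then show ?thesis using \<Lambda> by (simp add: \<theta>_def min_absorb1)
  qed
  have ln_lip: "\<bar>ln x - ln y\<bar> \<le> \<bar>x - y\<bar> / m" if "0 < m" "m \<le> x" "m \<le> y" for x y m :: real
  proof -
    have *: "ln x - ln y \<le> (x - y) / m" if "0 < m" "m \<le> y" "y \<le> x" for x y :: real
    proof -
      have "ln x - ln y = ln (x / y)" using that by (simp add: ln_div)
      also have "\<dots> \<le> x / y - 1" using that by (intro ln_le_minus_one) auto
      also have "\<dots> = (x - y) / y" using that by (simp add: field_simps)
      also have "\<dots> \<le> (x - y) / m" using that by (intro divide_left_mono) auto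
      finally show ?thesis .
    qed
    show ?thesis
    proof (cases "y \<le> x")
      case True
      then have "ln y \<le> ln x" using that by simp
      then show ?thesis using *[of y x] True that by simp
    next
      case False
      then have "ln x \<le> ln y" using that by simp
      then show ?thesis using *[of x y] False that by simp
    qed
  qed
  have \<theta>_lip: "\<bar>\<theta> t - \<theta> t'\<bar> \<le> \<bar>t - t'\<bar> / (\<Lambda> * m)" if m: "0 < m" "m \<le> max t s" "m \<le> max t' s" for t t' m
  proof -
    have "\<bar>\<theta> t - \<theta> t'\<bar> \<le> \<bar>ln (max t s / s) / \<Lambda> - ln (max t' s / s) / \<Lambda>\<bar>"
      unfolding \<theta>_def by (simp add: min_def)
    also have "\<dots> = \<bar>ln (max t s) - ln (max t' s)\<bar> / \<Lambda>"
    proof -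
      have "ln (max r s / s) = ln (max r s) - ln s" for r
        using s(1) by (intro ln_divide_pos) auto
      then show ?thesis using \<Lambda> by (simp add: diff_divide_distrib[symmetric])
    qed
    also have "\<dots> \<le> (\<bar>max t s - max t' s\<bar> / m) / \<Lambda>"
      using \<Lambda> by (intro divide_right_mono ln_lip m less_imp_le)
    also have "\<dots> \<le> (\<bar>t - t'\<bar> / m) / \<Lambda>"
    proof -
      have "\<bar>max t s - max t' s\<bar> \<le> \<bar>t - t'\<bar>" by (simp add: max_def)
      then show ?thesis using m(1) \<Lambda> by (simp add: divide_right_mono)
    qed
    finally show ?thesis by (simp add: mult.commute)
  qed
  define f where "f x = \<theta> (depth \<Omega> x)" for x
  have "continuous_on UNIV f"
  proof (rule continuous_onI)
    fix x :: 'a and e :: real assume e: "e > 0"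
    have "dist (f y) (f x) \<le> dist y x / (\<Lambda> * s)" for y
    proof -
      have "\<bar>\<theta> (depth \<Omega> y) - \<theta> (depth \<Omega> x)\<bar> \<le> \<bar>depth \<Omega> y - depth \<Omega> x\<bar> / (\<Lambda> * s)"
        using s by (intro \<theta>_lip) auto
      also have "\<dots> \<le> dist y x / (\<Lambda> * s)" using \<Lambda> s by (intro divide_right_mono depth_lipschitz) auto
      finally show ?thesis by (simp add: f_def dist_real_def)
    qed
    moreover have "dist y x / (\<Lambda> * s) \<le> e" if "dist y x < e * (\<Lambda> * s)" for y
      using that \<Lambda> s by (simp add: field_simps)
    ultimately show "\<exists>d>0. \<forall>y\<in>UNIV. dist y x < d \<longrightarrow> dist (f y) (f x) \<le> e"
      using e \<Lambda> s by (intro exI[of _ "e * (\<Lambda> * s)"]) (auto intro: order_trans)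
  qed
  moreover have "s / 4 > 0" using s by simp
  ultimately obtain F where F: "Ck 1 F"
    "\<And>x a b. \<forall>y. dist x y \<le> s / 4 \<longrightarrow> a \<le> f y \<and> f y \<le> b \<Longrightarrow> a \<le> F x \<and> F x \<le> b"
    "\<And>x x' L. \<forall>y. norm y \<le> s / 4 \<longrightarrow> \<bar>f (x - y) - f (x' - y)\<bar> \<le> L \<Longrightarrow> \<bar>F x - F x'\<bar> \<le> L"
    by (rule mollify) (rule that)
  show ?thesis
  proof (rule that[of s F])
    show "s > 0" "s \<le> 1" using s \<eta> by auto
    show "Ck 1 F" by fact
    show "0 \<le> F x \<and> F x \<le> 1" for x using \<theta>01 by (intro F(2)) (auto simp: f_def)
    show "F x = 0" if "depth \<Omega> x = 0" for x
    proof -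
      have "0 \<le> F x \<and> F x \<le> 0"
      proof (rule F(2), intro allI impI)
        fix y assume "dist x y \<le> s / 4"
        then have "depth \<Omega> y \<le> s" using depth_lipschitz[of \<Omega> x y] that s by linarith
        then show "0 \<le> f y \<and> f y \<le> 0" by (simp add: f_def \<theta>0)
      qed
      then show ?thesis by simp
    qed
    show "F x = 1" if "\<eta> \<le> depth \<Omega> x" for x
    proof -
      have "1 \<le> F x \<and> F x \<le> 1"
      proof (rule F(2), intro allI impI)
        fix y assume "dist x y \<le> s / 4"
        then have "\<eta> / 2 \<le> depth \<Omega> y" using depth_lipschitz[of \<Omega> x y] that s by linarith
        then show "1 \<le> f y \<and> f y \<le> 1" by (simp add: f_def \<theta>1)
      qed
      then show ?thesis by simp
    qed
    show "norm (grad F x) \<le> a / (depth \<Omega> x + s)" for x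
    proof (rule norm_grad_le[OF F(1), of "s / 4"])
      fix x' assume x': "dist x x' < s / 4"
      define m where "m = (depth \<Omega> x + s) / 4"
      have m: "m > 0" using depth_nonneg[of \<Omega> x] s by (simp add: m_def)
      show "\<bar>F x' - F x\<bar> \<le> a / (depth \<Omega> x + s) * dist x x'"
      proof (rule F(3), intro allI impI)
        fix y :: 'a assume y: "norm y \<le> s / 4"
        have 1: "depth \<Omega> x \<le> depth \<Omega> (x - y) + s / 4"
          using depth_lipschitz[of \<Omega> x "x - y"] y by (simp add: dist_norm)
        have xx: "dist (x' - y) (x - y) = dist x x'" by (simp add: dist_norm norm_minus_commute)
        have 2: "depth \<Omega> x \<le> depth \<Omega> (x' - y) + s / 2"
          using depth_lipschitz[of \<Omega> "x' - y" "x - y"] 1 x' xx by linarith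
        have quarter: "(p + s) / 4 \<le> max t s" if "p \<le> t + s / 2" for p t
          using that s(1) by (cases "t \<le> s") (simp_all add: max_def)
        have m1: "m \<le> max (depth \<Omega> (x' - y)) s" unfolding m_def using 2 by (rule quarter)
        have m2: "m \<le> max (depth \<Omega> (x - y)) s" unfolding m_def using 1 s(1) by (intro quarter) simp
        have "\<bar>f (x' - y) - f (x - y)\<bar> \<le> \<bar>depth \<Omega> (x' - y) - depth \<Omega> (x - y)\<bar> / (\<Lambda> * m)"
          unfolding f_def by (rule \<theta>_lip[OF m m1 m2])
        also have "\<dots> \<le> dist x x' / (\<Lambda> * m)"
          using depth_lipschitz[of \<Omega> "x' - y" "x - y"] xx \<Lambda> m by (intro divide_right_mono) auto
        also have "\<dots> = a / (depth \<Omega> x + s) * dist x x'"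
        proof -
          have "\<Lambda> * m = (depth \<Omega> x + s) / a" using a by (simp add: \<Lambda>_def m_def field_simps)
          then show ?thesis by simp
        qed
        finally show "\<bar>f (x' - y) - f (x - y)\<bar> \<le> a / (depth \<Omega> x + s) * dist x x'" .
      qed
    qed (use s in simp)
  qed
qed

section \<open>Coercivity\<close>

lemma classical_gradient_scaleR:
  fixes \<phi> :: "real^'n \<Rightarrow> complex"
  assumes \<zeta>: "Ck 1 \<zeta>" and \<phi>: "Ck 1 \<phi>"
  shows "norm (classical_gradient (\<lambda>x. \<zeta> x *\<^sub>R \<phi> x) x)
    \<le> \<bar>\<zeta> x\<bar> * norm (classical_gradient \<phi> x) + norm (grad \<zeta> x) * norm (\<phi> x)"
proof -
  have comp: "frechet_derivative \<zeta> (at x) (axis i 1) = grad \<zeta> x $ i" for i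
  proof -
    have "frechet_derivative \<zeta> (at x) (axis i 1) = grad \<zeta> x \<bullet> axis i 1"
      using \<zeta> by (intro frechet_derivative_eq_grad Ck_differentiable[of 0]) simp
    then show ?thesis by (simp add: inner_axis)
  qed
  have "((\<lambda>x. \<zeta> x *\<^sub>R \<phi> x) has_derivative
      (\<lambda>h. \<zeta> x *\<^sub>R frechet_derivative \<phi> (at x) h + frechet_derivative \<zeta> (at x) h *\<^sub>R \<phi> x)) (at x)"
    using \<zeta> \<phi> by (intro has_derivative_scaleR Ck_has_derivative[of 0]) auto
  then have eq: "classical_gradient (\<lambda>x. \<zeta> x *\<^sub>R \<phi> x) x
      = \<zeta> x *\<^sub>R classical_gradient \<phi> x + (\<chi> i. (grad \<zeta> x $ i) *\<^sub>R \<phi> x)"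
    by (simp add: classical_gradient_def vec_eq_iff frechet_derivative_eqI comp)
  have "norm (\<chi> i. (grad \<zeta> x $ i) *\<^sub>R \<phi> x) = norm (grad \<zeta> x) * norm (\<phi> x)"
    by (simp add: norm_vec_def L2_set_left_distrib[symmetric] L2_set_def power_mult_distrib
        sum_distrib_right[symmetric] real_sqrt_mult)
  then show ?thesis
    unfolding eq using norm_triangle_ineq[of "\<zeta> x *\<^sub>R classical_gradient \<phi> x" "\<chi> i. (grad \<zeta> x $ i) *\<^sub>R \<phi> x"]
    by simp
qed

text \<open>
  The constant sequence \<open>w\<close> shows that 0 is a trace of \<open>w\<close>.
\<close>

lemma H1_zeroI:
  fixes w :: "real^'n \<Rightarrow> complex"
  assumes w: "Ck 1 w" "compact K" "supported_in K w" and \<Omega>: "open \<Omega>" and van: "\<And>x. x \<in> frontier \<Omega> \<Longrightarrow> w x = 0"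
  shows "w \<in> H1_zero \<Omega>"
proof -
  have wg: "has_weak_gradient \<Omega> w (classical_gradient w)" by (rule has_weak_gradient_classical[OF w \<Omega>])
  have "has_weak_gradient \<Omega> (\<lambda>x. w x - w x) (\<lambda>x. classical_gradient w x - classical_gradient w x)"
    by (rule has_weak_gradient_diff[OF \<Omega> wg wg])
  from H1_norm_sq(1)[OF \<Omega> this] have z: "H1_norm \<Omega> (\<lambda>x. w x - w x) = 0" by simp
  have "(\<integral>\<^sup>+x. ennreal ((norm (w x - 0))\<^sup>2) \<partial>surface_measure \<Omega>) = (\<integral>\<^sup>+x. 0 \<partial>surface_measure \<Omega>)"
    by (rule nn_integral_cong) (simp add: van)
  then have "has_trace \<Omega> w (\<lambda>x. 0)"
    unfolding has_trace_def using w wg z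
    by (auto simp: H1_def intro!: exI[of _ "\<lambda>n. w"])
  then show ?thesis using wg by (auto simp: H1_zero_def H1_def)
qed

lemma surface_integrable:
  fixes \<phi> :: "real^'n \<Rightarrow> complex"
  assumes \<Omega>: "open \<Omega>" and C2: "C2_boundary \<Omega>" and d: "CARD('m::finite) + 1 = CARD('n)"
    and \<phi>: "continuous_on UNIV \<phi>" "compact K" "supported_in K \<phi>"
  shows "integrable (surface_measure \<Omega>) (\<lambda>x. (norm (\<phi> x))\<^sup>2)"
proof -
  have d': "DIM(real^'m) + 1 = DIM(real^'n)" "DIM(real^'n) - 1 = DIM(real^'m)" "DIM(real^'n) \<ge> 2"
  proof -
    have "0 < CARD('m)" by simp
    then have "CARD('n) \<ge> 2" using d by linarith
    then show "DIM(real^'m) + 1 = DIM(real^'n)" "DIM(real^'n) - 1 = DIM(real^'m)" "DIM(real^'n) \<ge> 2"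
      using d by simp_all
  qed
  obtain R where R: "\<And>x. x \<in> K \<Longrightarrow> norm x \<le> R"
    using compact_imp_bounded[OF \<phi>(2)] by (auto simp: bounded_iff)
  have "bounded (\<phi> ` K)"
    by (intro compact_imp_bounded compact_continuous_image \<phi>(2) continuous_on_subset[OF \<phi>(1)]) auto
  then obtain B where B: "\<And>x. x \<in> K \<Longrightarrow> norm (\<phi> x) \<le> B" "B > 0" by (auto simp: bounded_pos)
  define Q where "Q = frontier \<Omega> \<inter> cball 0 R"
  have Qb: "Q \<in> sets borel" by (auto simp: Q_def)
  have Qs[measurable]: "Q \<in> sets (surface_measure \<Omega>)"
    unfolding sets_surface_measure sets_restrict_space using Qb by (auto simp: Q_def)
  have "emeasure (surface_measure \<Omega>) Q = hausdorff_outer DIM(real^'m) Q"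
    using emeasure_surface_measure[OF d'(3) Qb] d'(2) by (simp add: Q_def)
  also have "\<dots> < top" unfolding Q_def by (rule surface_locally_finite[OF \<Omega> C2 d'(1)])
  finally have fin: "emeasure (surface_measure \<Omega>) Q < top" .
  show ?thesis
  proof (rule Bochner_Integration.integrable_bound)
    show "integrable (surface_measure \<Omega>) (\<lambda>x. B\<^sup>2 * indicator Q x :: real)"
      using fin by (intro integrable_mult_right integrable_real_indicator Qs) auto
    show "(\<lambda>x. (norm (\<phi> x))\<^sup>2) \<in> borel_measurable (surface_measure \<Omega>)"
      using \<phi>(1) by (intro borel_measurable_surface_measure borel_measurable_continuous_onI continuous_intros)
    show "AE x in surface_measure \<Omega>. norm ((norm (\<phi> x))\<^sup>2) \<le> norm (B\<^sup>2 * indicator Q x :: real)"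
    proof (rule AE_I2)
      fix x assume "x \<in> space (surface_measure \<Omega>)"
      then show "norm ((norm (\<phi> x))\<^sup>2) \<le> norm (B\<^sup>2 * indicator Q x :: real)"
        using \<phi>(3) B R by (cases "x \<in> K") (auto simp: supported_in_def Q_def intro!: power_mono)
    qed
  qed
qed

text \<open>
  Apply (i) to \<open>w = \<zeta> \<phi>\<close>.  Write \<open>e\<close>, \<open>f\<close> and \<open>\<sigma>\<close> for the integrals of \<open>|\<nabla>\<phi>|\<^sup>2\<close>, of \<open>|\<phi>|\<^sup>2\<close> and of \<open>|\<phi>|\<^sup>2\<close>
  over \<open>\<Gamma>\<close>, and \<open>H t\<close> for the integral of \<open>|\<phi>|\<^sup>2 / (d + t)\<^sup>2\<close>.  Then the Dirichlet integral of \<open>w\<close> is at most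
  \<open>(1 + a) e + 2 a H s\<close>, the integral of \<open>|w|\<^sup>2\<close> is at least \<open>f - 4 \<eta>\<^sup>2 H \<eta>\<close>, and
  \<open>H t \<le> C (e + f + \<sigma>/t)\<close> by Hardy's inequality.
\<close>

lemma coercive_smooth:
  fixes \<Omega> :: "(real^'n) set" and \<omega> :: "nat \<Rightarrow> (real^'m) set"
  assumes \<Omega>: "open \<Omega>" and ne: "- \<Omega> \<noteq> {}" and C2: "C2_boundary \<Omega>" and out: "cylindrical_outlets \<Omega> N \<omega> \<Phi>"
    and d: "CARD('m) + 1 = CARD('n)"
    and \<epsilon>: "0 < \<epsilon>" "\<epsilon> \<le> 1" and coer: "\<And>w. w \<in> H1_zero \<Omega> \<Longrightarrow> energy k \<Omega> w \<ge> \<epsilon> * (H1_norm \<Omega> w)\<^sup>2"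
  obtains \<mu> where "\<mu> > 0" "\<And>\<phi> K. Ck 1 \<phi> \<Longrightarrow> compact K \<Longrightarrow> supported_in K \<phi> \<Longrightarrow>
     energy k \<Omega> \<phi> + \<mu> * (\<integral>x. (norm (\<phi> x))\<^sup>2 \<partial>surface_measure \<Omega>) \<ge> \<epsilon> / 2 * (H1_norm \<Omega> \<phi>)\<^sup>2"
proof -
  obtain C where C0: "C \<ge> 0" and hardy: "\<forall>s>0. \<forall>\<phi>::real^'n \<Rightarrow> complex. Ck 1 \<phi> \<longrightarrow>
    (\<integral>\<^sup>+x. ennreal ((norm (\<phi> x) / (depth \<Omega> x + s))\<^sup>2) * indicator \<Omega> x \<partial>lborel)
     \<le> ennreal C * ((\<integral>\<^sup>+x. ennreal ((norm (classical_gradient \<phi> x))\<^sup>2) * indicator \<Omega> x \<partial>lborel)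
        + (\<integral>\<^sup>+x. ennreal ((norm (\<phi> x))\<^sup>2) * indicator \<Omega> x \<partial>lborel)
        + ennreal (1 / s) * (\<integral>\<^sup>+x. ennreal ((norm (\<phi> x))\<^sup>2) \<partial>surface_measure \<Omega>))"
    using hardy_domain[OF \<Omega> ne C2 out d] by blast
  note C = C0 hardy[rule_format]
  \<comment> \<open>With these choices the two error terms proportional to \<open>e + f\<close> are at most \<open>\<epsilon>/4 (e + f)\<close> each.\<close>
  define a where "a = \<epsilon> / (4 * (1 + 2 * C))"
  define \<eta> where "\<eta> = \<epsilon> / (16 * (k\<^sup>2 + 1) * (C + 1))"
  have a: "a > 0" "a \<le> 1" "a * (1 + 2 * C) = \<epsilon> / 4"
    using \<epsilon> C(1) by (auto simp: a_def field_simps)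
  have den: "16 * (k\<^sup>2 + 1) * (C + 1) \<ge> 16"
  proof -
    have "16 * 1 * 1 \<le> 16 * (k\<^sup>2 + 1) * (C + 1)" using C(1) by (intro mult_mono) auto
    then show ?thesis by simp
  qed
  have \<eta>: "\<eta> > 0" "\<eta> \<le> 1"
    using \<epsilon> den by (auto simp: \<eta>_def divide_le_eq_1)
  have \<eta>C: "4 * (k\<^sup>2 + 1) * (\<eta>\<^sup>2 * C) \<le> \<epsilon> / 4"
  proof -
    have "\<eta>\<^sup>2 * C \<le> \<eta> * (C + 1)"
      using \<eta> C(1) by (intro mult_mono) (auto simp: power2_eq_square mult_left_le)
    then have "4 * (k\<^sup>2 + 1) * (\<eta>\<^sup>2 * C) \<le> 4 * (k\<^sup>2 + 1) * (\<eta> * (C + 1))"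
      by (intro mult_left_mono) auto
    also have "\<dots> = \<eta> * (16 * (k\<^sup>2 + 1) * (C + 1)) / 4" by (simp add: algebra_simps)
    also have "\<eta> * (16 * (k\<^sup>2 + 1) * (C + 1)) = \<epsilon>"
    proof -
      have "16 * (k\<^sup>2 + 1) * (C + 1) \<noteq> 0" using den by linarith
      then show ?thesis using nonzero_eq_divide_eq \<eta>_def by blast
    qed
    finally show ?thesis .
  qed
  obtain s \<zeta> where s: "0 < s" "s \<le> 1" and \<zeta>: "Ck 1 (\<zeta> :: real^'n \<Rightarrow> real)" "\<And>x. 0 \<le> \<zeta> x \<and> \<zeta> x \<le> 1"
    "\<And>x. depth \<Omega> x = 0 \<Longrightarrow> \<zeta> x = 0" "\<And>x. \<eta> \<le> depth \<Omega> x \<Longrightarrow> \<zeta> x = 1"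
    "\<And>x. norm (grad \<zeta> x) \<le> a / (depth \<Omega> x + s)"
    by (rule log_cutoff[OF a(1) \<eta>, of \<Omega>]) (rule that)
  \<comment> \<open>The first two summands are the factors of \<open>\<sigma>\<close> in the bounds below; adding 1 makes \<open>\<mu>\<close> positive.\<close>
  define \<mu> where "\<mu> = 2 * a * C / s + (k\<^sup>2 + 1) * (4 * \<eta> * C) + 1"
  have \<mu>0: "\<mu> > 0" using a C(1) s \<eta> by (auto simp: \<mu>_def intro!: add_nonneg_pos add_nonneg_nonneg)
  show ?thesis
  proof (rule that[OF \<mu>0])
    fix \<phi> :: "real^'n \<Rightarrow> complex" and K
    assume \<phi>: "Ck 1 \<phi>" "compact K" "supported_in K \<phi>"
    define e where "e = (\<integral>x. (norm (classical_gradient \<phi> x))\<^sup>2 \<partial>lebesgue_on \<Omega>)"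
    define f where "f = (\<integral>x. (norm (\<phi> x))\<^sup>2 \<partial>lebesgue_on \<Omega>)"
    define \<sigma> where "\<sigma> = (\<integral>x. (norm (\<phi> x))\<^sup>2 \<partial>surface_measure \<Omega>)"
    have pos: "e \<ge> 0" "f \<ge> 0" "\<sigma> \<ge> 0" by (simp_all add: e_def f_def \<sigma>_def)
    have c\<phi>: "continuous_on UNIV \<phi>" using Ck_continuous[OF \<phi>(1)] .
    have c\<phi>': "continuous_on UNIV (classical_gradient \<phi>)" using continuous_on_classical_gradient[OF \<phi>(1)] .
    have s\<phi>': "supported_in K (classical_gradient \<phi>)"
      using classical_gradient_supported[OF compact_imp_closed[OF \<phi>(2)] \<phi>(3)] .
    have en_e: "ennreal e = (\<integral>\<^sup>+x. ennreal ((norm (classical_gradient \<phi> x))\<^sup>2) * indicator \<Omega> x \<partial>lborel)"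
      unfolding e_def by (rule ennreal_integral_norm_sq[OF c\<phi>' \<phi>(2) s\<phi>' \<Omega>])
    have en_f: "ennreal f = (\<integral>\<^sup>+x. ennreal ((norm (\<phi> x))\<^sup>2) * indicator \<Omega> x \<partial>lborel)"
      unfolding f_def by (rule ennreal_integral_norm_sq[OF c\<phi> \<phi>(2,3) \<Omega>])
    have en_\<sigma>: "ennreal \<sigma> = (\<integral>\<^sup>+x. ennreal ((norm (\<phi> x))\<^sup>2) \<partial>surface_measure \<Omega>)"
      unfolding \<sigma>_def by (rule nn_integral_eq_integral[OF surface_integrable[OF \<Omega> C2 d c\<phi> \<phi>(2,3)], symmetric]) auto
    define q where "q t x = (1 / (depth \<Omega> x + t)) *\<^sub>R \<phi> x" for t x
    define H where "H t = (\<integral>x. (norm (q t x))\<^sup>2 \<partial>lebesgue_on \<Omega>)" for t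
    have q_norm: "norm (q t x) = norm (\<phi> x) / (depth \<Omega> x + t)" if "t > 0" for t x
      using that depth_nonneg[of \<Omega> x] by (simp add: q_def)
    have q_cont: "continuous_on UNIV (q t)" if "t > 0" for t
    proof -
      have "depth \<Omega> x + t \<noteq> 0" for x using that depth_nonneg[of \<Omega> x] by linarith
      then show ?thesis unfolding q_def by (intro continuous_intros continuous_on_depth c\<phi>) auto
    qed
    have q_supp: "supported_in K (q t)" for t using \<phi>(3) by (auto simp: supported_in_def q_def)
    have H_le: "H t \<le> C * (e + f + \<sigma> / t)" if t: "t > 0" for t
    proof -
      have "ennreal (H t) = (\<integral>\<^sup>+x. ennreal ((norm (q t x))\<^sup>2) * indicator \<Omega> x \<partial>lborel)"
        unfolding H_def by (rule ennreal_integral_norm_sq[OF q_cont[OF t] \<phi>(2) q_supp \<Omega>])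
      also have "\<dots> \<le> ennreal C * (ennreal e + ennreal f + ennreal (1 / t) * ennreal \<sigma>)"
        unfolding en_e en_f en_\<sigma> q_norm[OF t] by (rule C(2)[OF t \<phi>(1)])
      also have "\<dots> = ennreal (C * (e + f + \<sigma> / t))"
        using pos C(1) t by (simp add: ennreal_mult[symmetric] ennreal_plus[symmetric] del: ennreal_plus)
      finally show ?thesis using pos C(1) t by (subst (asm) ennreal_le_iff) auto
    qed
    define w where "w = (\<lambda>x. \<zeta> x *\<^sub>R \<phi> x)"
    have w: "Ck 1 w" "supported_in K w"
    proof -
      show "Ck 1 w" unfolding w_def by (rule Ck_scaleR[OF \<zeta>(1) \<phi>(1)])
      show "supported_in K w" using \<phi>(3) by (simp add: w_def supported_in_def)
    qed
    have w0: "w \<in> H1_zero \<Omega>"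
    proof (rule H1_zeroI[OF w(1) \<phi>(2) w(2) \<Omega>])
      fix x assume "x \<in> frontier \<Omega>"
      then have "x \<in> - \<Omega>" using \<Omega> by (auto simp: frontier_def interior_open)
      then have "depth \<Omega> x = 0" by (simp add: depth_def)
      then show "w x = 0" using \<zeta>(3) by (simp add: w_def)
    qed
    define E where "E = (\<integral>x. (norm (classical_gradient w x))\<^sup>2 \<partial>lebesgue_on \<Omega>)"
    define F where "F = (\<integral>x. (norm (w x))\<^sup>2 \<partial>lebesgue_on \<Omega>)"
    note wgw = has_weak_gradient_classical[OF w(1) \<phi>(2) w(2) \<Omega>]
    note wg\<phi> = has_weak_gradient_classical[OF \<phi> \<Omega>]
    have coer_w: "E - k\<^sup>2 * F \<ge> \<epsilon> * (E + F)"
      using coer[OF w0] unfolding H1_norm_sq[OF \<Omega> wgw] E_def F_def .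
    have int_e: "integrable (lebesgue_on \<Omega>) (\<lambda>x. (norm (classical_gradient \<phi> x))\<^sup>2)"
      using square_integrable_compact_support[OF c\<phi>' \<phi>(2) s\<phi>' \<Omega>] by (simp add: square_integrable_def)
    have int_E: "integrable (lebesgue_on \<Omega>) (\<lambda>x. (norm (classical_gradient w x))\<^sup>2)"
      using wgw by (simp add: has_weak_gradient_def square_integrable_def)
    have int_f: "integrable (lebesgue_on \<Omega>) (\<lambda>x. (norm (\<phi> x))\<^sup>2)"
      using wg\<phi> by (simp add: has_weak_gradient_def square_integrable_def)
    have int_F: "integrable (lebesgue_on \<Omega>) (\<lambda>x. (norm (w x))\<^sup>2)"
      using wgw by (simp add: has_weak_gradient_def square_integrable_def)
    have int_q: "integrable (lebesgue_on \<Omega>) (\<lambda>x. (norm (q t x))\<^sup>2)" if "t > 0" for t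
      using square_integrable_compact_support[OF q_cont[OF that] \<phi>(2) q_supp \<Omega>] by (simp add: square_integrable_def)
    have E_le: "E \<le> (1 + a) * e + 2 * a * H s"
    proof -
      have "E \<le> (\<integral>x. (1 + a) * (norm (classical_gradient \<phi> x))\<^sup>2 + 2 * a * (norm (q s x))\<^sup>2 \<partial>lebesgue_on \<Omega>)"
        unfolding E_def
      proof (rule integral_mono[OF int_E])
        show "integrable (lebesgue_on \<Omega>) (\<lambda>x. (1 + a) * (norm (classical_gradient \<phi> x))\<^sup>2 + 2 * a * (norm (q s x))\<^sup>2)"
          using int_e int_q[OF s(1)] by simp
        fix x
        define g where "g = norm (classical_gradient \<phi> x)"
        define r where "r = norm (q s x)"
        have "norm (classical_gradient w x) \<le> \<bar>\<zeta> x\<bar> * g + norm (grad \<zeta> x) * norm (\<phi> x)"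
          unfolding w_def g_def by (rule classical_gradient_scaleR[OF \<zeta>(1) \<phi>(1)])
        also have "\<dots> \<le> 1 * g + a / (depth \<Omega> x + s) * norm (\<phi> x)"
          using \<zeta>(2,5) by (intro add_mono mult_right_mono) (auto simp: g_def)
        also have "\<dots> = g + a * r" by (simp add: r_def q_norm[OF s(1)])
        finally have "(norm (classical_gradient w x))\<^sup>2 \<le> (g + a * r)\<^sup>2" by (intro power_mono) auto
        also have "\<dots> = g\<^sup>2 + a * (2 * g * r) + a\<^sup>2 * r\<^sup>2" by (simp add: power2_eq_square algebra_simps)
        also have "\<dots> \<le> g\<^sup>2 + a * (g\<^sup>2 + r\<^sup>2) + a * r\<^sup>2"
        proof (intro add_mono mult_left_mono mult_right_mono order_refl)
          show "2 * g * r \<le> g\<^sup>2 + r\<^sup>2" by (rule sum_squares_bound)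
          show "a\<^sup>2 \<le> a" using a by (simp add: power2_eq_square mult_left_le)
        qed (use a in auto)
        finally show "(norm (classical_gradient w x))\<^sup>2 \<le> (1 + a) * (norm (classical_gradient \<phi> x))\<^sup>2 + 2 * a * (norm (q s x))\<^sup>2"
          unfolding g_def[symmetric] r_def[symmetric] by (simp add: algebra_simps)
      qed
      also have "\<dots> = (1 + a) * e + 2 * a * H s"
        unfolding e_def H_def using int_e int_q[OF s(1)] by simp
      finally show ?thesis .
    qed
    have F_ge: "F \<ge> f - 4 * \<eta>\<^sup>2 * H \<eta>"
    proof -
      have "(\<integral>x. (norm (\<phi> x))\<^sup>2 - 4 * \<eta>\<^sup>2 * (norm (q \<eta> x))\<^sup>2 \<partial>lebesgue_on \<Omega>) \<le> F"
        unfolding F_def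
      proof (rule integral_mono[OF _ int_F])
        show "integrable (lebesgue_on \<Omega>) (\<lambda>x. (norm (\<phi> x))\<^sup>2 - 4 * \<eta>\<^sup>2 * (norm (q \<eta> x))\<^sup>2)"
          using int_f int_q[OF \<eta>(1)] by simp
        fix x
        show "(norm (\<phi> x))\<^sup>2 - 4 * \<eta>\<^sup>2 * (norm (q \<eta> x))\<^sup>2 \<le> (norm (w x))\<^sup>2"
        proof (cases "\<eta> \<le> depth \<Omega> x")
          case True
          then show ?thesis using \<zeta>(4) by (simp add: w_def)
        next
          case False
          have "norm (\<phi> x) \<le> 2 * \<eta> * norm (q \<eta> x)"
          proof -
            have "norm (\<phi> x) * (depth \<Omega> x + \<eta>) \<le> norm (\<phi> x) * (2 * \<eta>)"
              using False by (intro mult_left_mono) auto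
            moreover have "depth \<Omega> x + \<eta> > 0" using depth_nonneg[of \<Omega> x] \<eta> by linarith
            ultimately show ?thesis by (simp add: q_norm[OF \<eta>(1)] pos_le_divide_eq mult.commute)
          qed
          then have "(norm (\<phi> x))\<^sup>2 \<le> (2 * \<eta> * norm (q \<eta> x))\<^sup>2" by (rule power_mono) simp
          then have "(norm (\<phi> x))\<^sup>2 \<le> 4 * \<eta>\<^sup>2 * (norm (q \<eta> x))\<^sup>2" by (simp add: power_mult_distrib)
          then show ?thesis using zero_le_power2[of "norm (w x)"] by linarith
        qed
      qed
      then show ?thesis unfolding f_def H_def using int_f int_q[OF \<eta>(1)] by simp
    qed
    have Eb: "E \<le> e + \<epsilon> / 4 * (e + f) + 2 * a * C / s * \<sigma>"
    proof -
      have "2 * a * H s \<le> 2 * a * (C * (e + f + \<sigma> / s))"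
        using a H_le[OF s(1)] by (intro mult_left_mono) auto
      moreover have "a * e \<le> a * (e + f)" using a pos by (intro mult_left_mono) auto
      ultimately have "E \<le> e + a * (1 + 2 * C) * (e + f) + 2 * a * C / s * \<sigma>"
        using E_le by (simp add: algebra_simps)
      then show ?thesis by (simp add: a(3))
    qed
    have Hb: "(k\<^sup>2 + 1) * (4 * \<eta>\<^sup>2 * H \<eta>) \<le> \<epsilon> / 4 * (e + f) + (k\<^sup>2 + 1) * (4 * \<eta> * C) * \<sigma>"
    proof -
      have "(k\<^sup>2 + 1) * (4 * \<eta>\<^sup>2 * H \<eta>) \<le> (k\<^sup>2 + 1) * (4 * \<eta>\<^sup>2 * (C * (e + f + \<sigma> / \<eta>)))"
        using H_le[OF \<eta>(1)] by (intro mult_left_mono) auto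
      also have "\<dots> = 4 * (k\<^sup>2 + 1) * (\<eta>\<^sup>2 * C) * (e + f) + (k\<^sup>2 + 1) * (4 * \<eta> * C) * \<sigma>"
        using \<eta>(1) by (simp add: field_simps power2_eq_square)
      also have "\<dots> \<le> \<epsilon> / 4 * (e + f) + (k\<^sup>2 + 1) * (4 * \<eta> * C) * \<sigma>"
        using \<eta>C pos by (intro add_right_mono mult_right_mono) auto
      finally show ?thesis .
    qed
    have H0: "H \<eta> \<ge> 0" by (simp add: H_def)
    have Fb: "(k\<^sup>2 + \<epsilon>) * F \<ge> (k\<^sup>2 + \<epsilon>) * f - (k\<^sup>2 + 1) * (4 * \<eta>\<^sup>2 * H \<eta>)"
    proof -
      have "(k\<^sup>2 + \<epsilon>) * (f - 4 * \<eta>\<^sup>2 * H \<eta>) \<le> (k\<^sup>2 + \<epsilon>) * F"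
        using F_ge \<epsilon> by (intro mult_left_mono) auto
      moreover have "(k\<^sup>2 + \<epsilon>) * (4 * \<eta>\<^sup>2 * H \<eta>) \<le> (k\<^sup>2 + 1) * (4 * \<eta>\<^sup>2 * H \<eta>)"
        using \<epsilon> H0 by (intro mult_right_mono) auto
      ultimately show ?thesis by (simp add: right_diff_distrib)
    qed
    have Eb': "(1 - \<epsilon>) * E \<le> (1 - \<epsilon>) * e + \<epsilon> / 4 * (e + f) + 2 * a * C / s * \<sigma>"
    proof -
      define r where "r = \<epsilon> / 4 * (e + f) + 2 * a * C / s * \<sigma>"
      have "r \<ge> 0" using \<epsilon> pos a C(1) s by (simp add: r_def)
      have "(1 - \<epsilon>) * E \<le> (1 - \<epsilon>) * (e + r)"
        using Eb \<epsilon> by (intro mult_left_mono) (auto simp: r_def)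
      also have "\<dots> \<le> (1 - \<epsilon>) * e + r"
        using \<epsilon> \<open>r \<ge> 0\<close> by (simp add: algebra_simps)
      finally show ?thesis by (simp add: r_def)
    qed
    define A where "A = 2 * a * C / s * \<sigma>"
    define B where "B = (k\<^sup>2 + 1) * (4 * \<eta> * C) * \<sigma>"
    have "(k\<^sup>2 + \<epsilon>) * F \<le> (1 - \<epsilon>) * E" using coer_w by (simp add: algebra_simps)
    then have "(k\<^sup>2 + \<epsilon>) * f - (\<epsilon> / 4 * (e + f) + B) \<le> (1 - \<epsilon>) * e + \<epsilon> / 4 * (e + f) + A"
      using Eb' Fb Hb unfolding A_def[symmetric] B_def[symmetric] by linarith
    moreover have "(k\<^sup>2 + \<epsilon>) * f = k\<^sup>2 * f + \<epsilon> * f" "(1 - \<epsilon>) * e = e - \<epsilon> * e"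
      "\<epsilon> / 4 * (e + f) = \<epsilon> * e / 4 + \<epsilon> * f / 4" "\<epsilon> / 2 * (e + f) = \<epsilon> * e / 2 + \<epsilon> * f / 2"
      by (simp_all add: algebra_simps)
    ultimately have "e - k\<^sup>2 * f + (A + B) \<ge> \<epsilon> / 2 * (e + f)" by linarith
    then have "e - k\<^sup>2 * f + (2 * a * C / s * \<sigma> + (k\<^sup>2 + 1) * (4 * \<eta> * C) * \<sigma>) \<ge> \<epsilon> / 2 * (e + f)"
      unfolding A_def B_def .
    moreover have "\<mu> * \<sigma> = 2 * a * C / s * \<sigma> + (k\<^sup>2 + 1) * (4 * \<eta> * C) * \<sigma> + \<sigma>"
      by (simp add: \<mu>_def algebra_simps)
    ultimately show "energy k \<Omega> \<phi> + \<mu> * (\<integral>x. (norm (\<phi> x))\<^sup>2 \<partial>surface_measure \<Omega>) \<ge> \<epsilon> / 2 * (H1_norm \<Omega> \<phi>)\<^sup>2"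
      unfolding H1_norm_sq[OF \<Omega> wg\<phi>] e_def[symmetric] f_def[symmetric] \<sigma>_def[symmetric]
      using pos by linarith
  qed
qed

text \<open>
  The sequence is the one that defines the trace.  The functions of the sequence are square integrable over
  the boundary because the surface measure is finite on compact sets; hence so is \<open>v\<close>.
\<close>

lemma trace_limit:
  fixes u v :: "real^'n \<Rightarrow> complex"
  assumes \<Omega>: "open \<Omega>" and C2: "C2_boundary \<Omega>" and d: "CARD('m::finite) + 1 = CARD('n)"
    and tr: "has_trace \<Omega> u v"
  obtains \<phi> where "\<And>n. Ck 1 (\<phi> n :: real^'n \<Rightarrow> complex)" "\<And>n. \<exists>K. compact K \<and> supported_in K (\<phi> n)"
    "(\<lambda>n. (H1_norm \<Omega> (\<phi> n))\<^sup>2) \<longlonglongrightarrow> (H1_norm \<Omega> u)\<^sup>2"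
    "\<And>k. (\<lambda>n. energy k \<Omega> (\<phi> n)) \<longlonglongrightarrow> energy k \<Omega> u"
    "(\<lambda>n. \<integral>x. (norm (\<phi> n x))\<^sup>2 \<partial>surface_measure \<Omega>) \<longlonglongrightarrow> (\<integral>x. (norm (v x))\<^sup>2 \<partial>surface_measure \<Omega>)"
proof -
  obtain G where G: "has_weak_gradient \<Omega> u G" using tr by (auto simp: has_trace_def H1_def)
  obtain \<phi> where \<phi>: "\<And>n. Ck 1 (\<phi> n)" "\<And>n. \<exists>K. compact K \<and> supported_in K (\<phi> n)"
    and lim: "(\<lambda>n. H1_norm \<Omega> (\<lambda>x. \<phi> n x - u x)) \<longlonglongrightarrow> 0"
    and limS: "(\<lambda>n. \<integral>\<^sup>+x. ennreal ((norm (\<phi> n x - v x))\<^sup>2) \<partial>surface_measure \<Omega>) \<longlonglongrightarrow> 0"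
    using tr unfolding has_trace_def by blast
  have v: "v \<in> borel_measurable (surface_measure \<Omega>)" using tr by (simp add: has_trace_def)
  have wg: "has_weak_gradient \<Omega> (\<phi> n) (classical_gradient (\<phi> n))" for n
    using \<phi> has_weak_gradient_classical[OF _ _ _ \<Omega>] by blast
  define dG where "dG n = (\<integral>x. (norm (classical_gradient (\<phi> n) x - G x))\<^sup>2 \<partial>lebesgue_on \<Omega>)" for n
  define du where "du n = (\<integral>x. (norm (\<phi> n x - u x))\<^sup>2 \<partial>lebesgue_on \<Omega>)" for n
  have wgd: "has_weak_gradient \<Omega> (\<lambda>x. \<phi> n x - u x) (\<lambda>x. classical_gradient (\<phi> n) x - G x)" for n
    by (rule has_weak_gradient_diff[OF \<Omega> wg G])
  have sum: "(H1_norm \<Omega> (\<lambda>x. \<phi> n x - u x))\<^sup>2 = dG n + du n" for n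
    unfolding dG_def du_def by (rule H1_norm_sq(1)[OF \<Omega> wgd])
  have nn: "dG n \<ge> 0" "du n \<ge> 0" for n by (simp_all add: dG_def du_def)
  have lim2: "(\<lambda>n. dG n + du n) \<longlonglongrightarrow> 0"
    using tendsto_power[OF lim, of 2] by (simp add: sum)
  have "dG \<longlonglongrightarrow> 0" by (rule tendsto_sandwich[OF _ _ tendsto_const lim2]) (auto simp: nn)
  moreover have "du \<longlonglongrightarrow> 0" by (rule tendsto_sandwich[OF _ _ tendsto_const lim2]) (auto simp: nn)
  moreover have "ennreal (dG n) = (\<integral>\<^sup>+x. ennreal ((norm (classical_gradient (\<phi> n) x - G x))\<^sup>2) \<partial>lebesgue_on \<Omega>)" for n
    unfolding dG_def using wgd[of n]
    by (intro nn_integral_eq_integral[symmetric]) (auto simp: has_weak_gradient_def square_integrable_def)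
  moreover have "ennreal (du n) = (\<integral>\<^sup>+x. ennreal ((norm (\<phi> n x - u x))\<^sup>2) \<partial>lebesgue_on \<Omega>)" for n
    unfolding du_def using wgd[of n]
    by (intro nn_integral_eq_integral[symmetric]) (auto simp: has_weak_gradient_def square_integrable_def)
  ultimately have limG: "(\<lambda>n. \<integral>\<^sup>+x. ennreal ((norm (classical_gradient (\<phi> n) x - G x))\<^sup>2) \<partial>lebesgue_on \<Omega>) \<longlonglongrightarrow> 0"
    and limu: "(\<lambda>n. \<integral>\<^sup>+x. ennreal ((norm (\<phi> n x - u x))\<^sup>2) \<partial>lebesgue_on \<Omega>) \<longlonglongrightarrow> 0"
    using tendsto_ennrealI[of dG 0 sequentially] tendsto_ennrealI[of du 0 sequentially] by simp_all
  have LG: "(\<lambda>n. \<integral>x. (norm (classical_gradient (\<phi> n) x))\<^sup>2 \<partial>lebesgue_on \<Omega>) \<longlonglongrightarrow> (\<integral>x. (norm (G x))\<^sup>2 \<partial>lebesgue_on \<Omega>)"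
    using wg G by (intro L2_norm_tendsto(2)[OF _ _ _ limG]) (auto simp: has_weak_gradient_def square_integrable_def)
  have Lu: "(\<lambda>n. \<integral>x. (norm (\<phi> n x))\<^sup>2 \<partial>lebesgue_on \<Omega>) \<longlonglongrightarrow> (\<integral>x. (norm (u x))\<^sup>2 \<partial>lebesgue_on \<Omega>)"
    using wg G by (intro L2_norm_tendsto(2)[OF _ _ _ limu]) (auto simp: has_weak_gradient_def square_integrable_def)
  have Lv: "(\<lambda>n. \<integral>x. (norm (\<phi> n x))\<^sup>2 \<partial>surface_measure \<Omega>) \<longlonglongrightarrow> (\<integral>x. (norm (v x))\<^sup>2 \<partial>surface_measure \<Omega>)"
  proof (rule L2_norm_tendsto(2)[OF _ v _ limS])
    show "\<phi> n \<in> borel_measurable (surface_measure \<Omega>)" for n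
      by (intro borel_measurable_surface_measure borel_measurable_continuous_onI Ck_continuous[OF \<phi>(1)])
    show "integrable (surface_measure \<Omega>) (\<lambda>x. (norm (\<phi> n x))\<^sup>2)" for n
      using \<phi>(2)[of n] surface_integrable[OF \<Omega> C2 d Ck_continuous[OF \<phi>(1)]] by blast
  qed
  show ?thesis
  proof (rule that[OF \<phi> _ _ Lv])
    show "(\<lambda>n. (H1_norm \<Omega> (\<phi> n))\<^sup>2) \<longlonglongrightarrow> (H1_norm \<Omega> u)\<^sup>2"
      unfolding H1_norm_sq(1)[OF \<Omega> wg] H1_norm_sq(1)[OF \<Omega> G] by (intro tendsto_add LG Lu)
    show "(\<lambda>n. energy k \<Omega> (\<phi> n)) \<longlonglongrightarrow> energy k \<Omega> u" for k
      unfolding H1_norm_sq(2)[OF \<Omega> wg] H1_norm_sq(2)[OF \<Omega> G] by (intro tendsto_intros LG Lu)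
  qed
qed

theorem lemma2p3:
  fixes \<Omega> :: "(real^'n) set"
    and N :: nat
    and \<omega> :: "nat \<Rightarrow> (real^'m) set"
    and \<Phi> :: "nat \<Rightarrow> (real^'m) \<times> real \<Rightarrow> real^'n"
    and k :: real
  assumes "CARD('n) \<ge> 2"
    and "CARD('m) = CARD('n) - 1"
    and "domain \<Omega>"
    and "C2_boundary \<Omega>"
    and "cylindrical_outlets \<Omega> N \<omega> \<Phi>"
  shows "(\<exists>\<epsilon>>0. \<forall>u\<in>H1_zero \<Omega>. energy k \<Omega> u \<ge> \<epsilon> * (H1_norm \<Omega> u)\<^sup>2)
     \<longleftrightarrow> (\<exists>\<mu>>0. \<exists>\<delta>>0. \<forall>u\<in>H1 \<Omega>. \<forall>v. has_trace \<Omega> u v \<longrightarrow>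
            energy k \<Omega> u + \<mu> * (\<integral>x. (norm (v x))\<^sup>2 \<partial>surface_measure \<Omega>)
              \<ge> \<delta> * (H1_norm \<Omega> u)\<^sup>2)"
proof
  assume "\<exists>\<mu>>0. \<exists>\<delta>>0. \<forall>u\<in>H1 \<Omega>. \<forall>v. has_trace \<Omega> u v \<longrightarrow>
            energy k \<Omega> u + \<mu> * (\<integral>x. (norm (v x))\<^sup>2 \<partial>surface_measure \<Omega>) \<ge> \<delta> * (H1_norm \<Omega> u)\<^sup>2"
  then obtain \<mu> \<delta> where "\<delta> > 0" and *: "\<And>u v. u \<in> H1 \<Omega> \<Longrightarrow> has_trace \<Omega> u v \<Longrightarrow>
      energy k \<Omega> u + \<mu> * (\<integral>x. (norm (v x))\<^sup>2 \<partial>surface_measure \<Omega>) \<ge> \<delta> * (H1_norm \<Omega> u)\<^sup>2"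
    by blast
  have "energy k \<Omega> u \<ge> \<delta> * (H1_norm \<Omega> u)\<^sup>2" if "u \<in> H1_zero \<Omega>" for u
    using *[of u "\<lambda>x. 0"] that by (simp add: H1_zero_def)
  with \<open>\<delta> > 0\<close> show "\<exists>\<epsilon>>0. \<forall>u\<in>H1_zero \<Omega>. energy k \<Omega> u \<ge> \<epsilon> * (H1_norm \<Omega> u)\<^sup>2" by blast
next
  assume "\<exists>\<epsilon>>0. \<forall>u\<in>H1_zero \<Omega>. energy k \<Omega> u \<ge> \<epsilon> * (H1_norm \<Omega> u)\<^sup>2"
  then obtain \<epsilon>0 where \<epsilon>0: "\<epsilon>0 > 0" "\<And>u. u \<in> H1_zero \<Omega> \<Longrightarrow> energy k \<Omega> u \<ge> \<epsilon>0 * (H1_norm \<Omega> u)\<^sup>2" by blast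
  have \<Omega>: "open \<Omega>" using assms(3) by (simp add: domain_def)
  have d: "CARD('m) + 1 = CARD('n)" using assms(1,2) by simp
  show "\<exists>\<mu>>0. \<exists>\<delta>>0. \<forall>u\<in>H1 \<Omega>. \<forall>v. has_trace \<Omega> u v \<longrightarrow>
            energy k \<Omega> u + \<mu> * (\<integral>x. (norm (v x))\<^sup>2 \<partial>surface_measure \<Omega>) \<ge> \<delta> * (H1_norm \<Omega> u)\<^sup>2"
  proof (cases "- \<Omega> = {}")
    \<comment> \<open>The boundary is empty, so a function that has a trace also has trace 0.\<close>
    case True
    then have "\<Omega> = UNIV" by auto
    then have sp: "space (surface_measure \<Omega>) = {}" by simp
    have "energy k \<Omega> u + 1 * (\<integral>x. (norm (v x))\<^sup>2 \<partial>surface_measure \<Omega>) \<ge> \<epsilon>0 * (H1_norm \<Omega> u)\<^sup>2"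
      if u: "u \<in> H1 \<Omega>" and tr: "has_trace \<Omega> u v" for u v
    proof -
      have "(\<integral>\<^sup>+x. g x \<partial>surface_measure \<Omega>) = 0" for g
        using nn_integral_cong[of "surface_measure \<Omega>" g "\<lambda>_. 0"] sp by simp
      then have "has_trace \<Omega> u (\<lambda>x. 0)" using tr by (simp add: has_trace_def)
      then have "u \<in> H1_zero \<Omega>" using u by (simp add: H1_zero_def)
      then have "energy k \<Omega> u \<ge> \<epsilon>0 * (H1_norm \<Omega> u)\<^sup>2" by (rule \<epsilon>0(2))
      moreover have "0 \<le> (\<integral>x. (norm (v x))\<^sup>2 \<partial>surface_measure \<Omega>)" by simp
      ultimately show ?thesis by linarith
    qed
    then show ?thesis using \<epsilon>0(1) zero_less_one by blast
  next
    case False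
    define \<epsilon> where "\<epsilon> = min \<epsilon>0 1"
    have \<epsilon>: "0 < \<epsilon>" "\<epsilon> \<le> 1" using \<epsilon>0(1) by (auto simp: \<epsilon>_def)
    have coer: "energy k \<Omega> w \<ge> \<epsilon> * (H1_norm \<Omega> w)\<^sup>2" if "w \<in> H1_zero \<Omega>" for w
    proof -
      have "\<epsilon> * (H1_norm \<Omega> w)\<^sup>2 \<le> \<epsilon>0 * (H1_norm \<Omega> w)\<^sup>2"
        by (intro mult_right_mono) (auto simp: \<epsilon>_def)
      then show ?thesis using \<epsilon>0(2)[OF that] by linarith
    qed
    obtain \<mu> where \<mu>: "\<mu> > 0" "\<And>\<phi> K. Ck 1 \<phi> \<Longrightarrow> compact K \<Longrightarrow> supported_in K \<phi> \<Longrightarrow>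
        energy k \<Omega> \<phi> + \<mu> * (\<integral>x. (norm (\<phi> x))\<^sup>2 \<partial>surface_measure \<Omega>) \<ge> \<epsilon> / 2 * (H1_norm \<Omega> \<phi>)\<^sup>2"
      using coercive_smooth[OF \<Omega> False assms(4,5) d \<epsilon> coer] by metis
    have "energy k \<Omega> u + \<mu> * (\<integral>x. (norm (v x))\<^sup>2 \<partial>surface_measure \<Omega>) \<ge> \<epsilon> / 2 * (H1_norm \<Omega> u)\<^sup>2"
      if tr: "has_trace \<Omega> u v" for u v
    proof -
      obtain \<phi> where \<phi>: "\<And>n. Ck 1 (\<phi> n :: real^'n \<Rightarrow> complex)" "\<And>n. \<exists>K. compact K \<and> supported_in K (\<phi> n)"
        and l1: "(\<lambda>n. (H1_norm \<Omega> (\<phi> n))\<^sup>2) \<longlonglongrightarrow> (H1_norm \<Omega> u)\<^sup>2"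
        and l2: "\<And>k. (\<lambda>n. energy k \<Omega> (\<phi> n)) \<longlonglongrightarrow> energy k \<Omega> u"
        and l3: "(\<lambda>n. \<integral>x. (norm (\<phi> n x))\<^sup>2 \<partial>surface_measure \<Omega>) \<longlonglongrightarrow> (\<integral>x. (norm (v x))\<^sup>2 \<partial>surface_measure \<Omega>)"
        using trace_limit[OF \<Omega> assms(4) d tr] by metis
      show ?thesis
      proof (rule LIMSEQ_le)
        show "(\<lambda>n. \<epsilon> / 2 * (H1_norm \<Omega> (\<phi> n))\<^sup>2) \<longlonglongrightarrow> \<epsilon> / 2 * (H1_norm \<Omega> u)\<^sup>2"
          by (intro tendsto_mult tendsto_const l1)
        show "(\<lambda>n. energy k \<Omega> (\<phi> n) + \<mu> * (\<integral>x. (norm (\<phi> n x))\<^sup>2 \<partial>surface_measure \<Omega>))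
          \<longlonglongrightarrow> energy k \<Omega> u + \<mu> * (\<integral>x. (norm (v x))\<^sup>2 \<partial>surface_measure \<Omega>)"
          by (intro tendsto_add tendsto_mult tendsto_const l2 l3)
        show "\<exists>N. \<forall>n\<ge>N. \<epsilon> / 2 * (H1_norm \<Omega> (\<phi> n))\<^sup>2 \<le> energy k \<Omega> (\<phi> n) + \<mu> * (\<integral>x. (norm (\<phi> n x))\<^sup>2 \<partial>surface_measure \<Omega>)"
          using \<mu>(2) \<phi> by blast
      qed
    qed
    then show ?thesis using \<mu>(1) \<epsilon>(1) half_gt_zero by blast
  qed
qed

end
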